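(* Assume the resolution condition $H/\varepsilon\le\left(2C_{I_H}\sqrt{C_{\rm ol}V_{\max}(1+C_{I_H}C_{\rm ol}\gamma)}\right)^{-1}$. Then there exists $0<\beta<1$, independent of $\varepsilon,\delta,m$ and $H$, such that for all $j=1,\dots,N_H$ and all $m\in\mathbb N$, $$\|\nabla\psi_j\|_{\Omega\setminus N^m(S_j)}\le\beta^m\|\nabla\psi_j\|,$$ where $S_j=\mathrm{supp}(\phi_j)$.
   Context: Setting. $\Omega=[0,2\pi]^d$; functions are complex-valued; $(v,w)=\int_\Omega v\bar w$, $\|\cdot\|$ is the $L^2(\Omega)$ norm, $\|\cdot\|_K$ the $L^2(K)$ norm for $K\subset\Omega$; $H^1_P(\Omega)=\{w\in H^1(\Omega): w \text{ is periodic on }\partial\Omega\}$. The small parameters satisfy $0<\varepsilon\ll1$, $0<\delta\ll1$. $V=V^\delta$ is a real potential with $V_{\min}\le V\le V_{\max}$ on $\Omega$, where $0<V_{\min}\le V_{\max}$ do not depend on $\varepsilon,\delta$, and $\|D^{\sigma}_xV\|_\infty\le C\delta^{-|\sigma|}$ for multi-indices $\sigma$. Set $a(v,w)=\frac12\varepsilon^2(\nabla v,\nabla w)+(Vv,w)$. Mesh. $\mathcal T_H$ is a quasi-uniform, shape-regular simplicial mesh of $\Omega$ of mesh size $H$, compatible with the periodic boundary conditions (opposite faces of $\Omega$ are identified). For a union $K$ of elements, $N(K)=\bigcup\{G\in\mathcal T_H: G\cap K\ne\emptyset\}$, $N^0(K)=K$, $N^{m+1}(K)=N(N^m(K))$.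 $\Phi_H\subset H^1_P(\Omega)$ is the space of functions that are polynomials of degree $\le1$ on each element, with nodal basis $\phi_1,\dots,\phi_{N_H}$ (one for each vertex, vertices identified by periodicity being counted once). The Clément-type interpolation is $I_Hv=\sum_{j=1}^{N_H}\frac{(v,\phi_j)}{(1,\phi_j)}\phi_j$ for $v\in H^1_P(\Omega)$. Constants, independent of $\varepsilon,\delta,m,H$: $C_{\rm ol}$ with $\max_{T\in\mathcal T_H}\mathrm{card}\{G\in\mathcal T_H: G\subset N(T)\}\le C_{\rm ol}$; $C_{I_H}$ with $H^{-1}\|v-I_Hv\|_T+\|\nabla(v-I_Hv)\|_T\le C_{I_H}\|\nabla v\|_{N(T)}$ for all $T\in\mathcal T_H$, $v\in H^1_P(\Omega)$; $\gamma$ with $H\|\nabla\eta\|_\infty\le\gamma$ for all cutoffs $\eta(x)=\frac{\mathrm{dist}(x,N^m(K))}{\mathrm{dist}(x,N^m(K))+\mathrm{dist}(x,\Omega\setminus N^{m+1}(K))}$. Multiscale basis: $\psi_j$ ($j=1,\dots,N_H$) is the minimizer of $a(\psi,\psi)$ over $\psi\in H^1_P(\Omega)$ subject to $(\psi,\phi_k)=\delta_{jk}$ (Kronecker delta), $k=1,\dots,N_H$. *)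

theory Defs
  imports "HOL-Analysis.Analysis"
begin

section \<open>The periodic cell and its Sobolev spaces\<close>

definition Omega :: "(real ^ 'n::finite) set" where
  "Omega = cbox 0 (\<chi> i. 2 * pi)"

(* The representative of x modulo 2 pi Z^n in [0, 2 pi)^n. Two points of Omega are identified by
   periodicity iff they have the same representative. *)
definition wrap :: "real ^ 'n::finite \<Rightarrow> real ^ 'n" where
  "wrap x = (\<chi> i. 2 * pi * frac (x $ i / (2 * pi)))"

definition square_integrable_on :: "(real ^ 'n::finite \<Rightarrow> 'b::euclidean_space) \<Rightarrow> (real ^ 'n) set \<Rightarrow> bool" where
  "square_integrable_on f K \<longleftrightarrow>
     f \<in> borel_measurable (lebesgue_on K) \<and> integrable (lebesgue_on K) (\<lambda>x. (norm (f x))\<^sup>2)"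

definition L2norm :: "(real ^ 'n::finite) set \<Rightarrow> (real ^ 'n \<Rightarrow> 'b::euclidean_space) \<Rightarrow> real" where
  "L2norm K f = sqrt (LINT x|lebesgue_on K. (norm (f x))\<^sup>2)"

definition L2inner :: "(real ^ 'n::finite \<Rightarrow> complex) \<Rightarrow> (real ^ 'n \<Rightarrow> complex) \<Rightarrow> complex" where
  "L2inner v w = (LINT x|lebesgue_on Omega. v x * cnj (w x))"

(* g is the weak gradient of u on the open set U, with once continuously differentiable test
   functions of compact support in U (as in Gilbarg and Trudinger; by mollification smooth test
   functions give the same notion). theta' is the gradient of theta. The local integrability of u
   and g has to be demanded, because the integral of a non-integrable function is 0. *)
definition has_weak_gradient_on ::
  "(real ^ 'n::finite \<Rightarrow> 'b::euclidean_space) \<Rightarrow> (real ^ 'n \<Rightarrow> 'b ^ 'n) \<Rightarrow> (real ^ 'n) set \<Rightarrow> bool" where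
  "has_weak_gradient_on u g U \<longleftrightarrow>
     (\<forall>K. compact K \<and> K \<subseteq> U \<longrightarrow> integrable (lebesgue_on K) u \<and> integrable (lebesgue_on K) g) \<and>
     (\<forall>\<theta> :: real ^ 'n \<Rightarrow> real. \<forall>\<theta>' :: real ^ 'n \<Rightarrow> real ^ 'n.
        (\<forall>x. (\<theta> has_derivative (\<lambda>h. \<theta>' x \<bullet> h)) (at x)) \<and> continuous_on UNIV \<theta>' \<and>
        compact (closure {x. \<theta> x \<noteq> 0}) \<and> closure {x. \<theta> x \<noteq> 0} \<subseteq> U \<longrightarrow>
        (\<forall>i. (LINT x|lebesgue_on U. \<theta>' x $ i *\<^sub>R u x) = - (LINT x|lebesgue_on U. \<theta> x *\<^sub>R g x $ i)))"

definition H1 :: "(real ^ 'n::finite \<Rightarrow> complex) set" where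
  "H1 = {w. square_integrable_on w Omega \<and>
            (\<exists>g. square_integrable_on g Omega \<and> has_weak_gradient_on w g (interior Omega))}"

(* The weak gradient of an element of H1; it is determined up to null sets. *)
definition grad :: "(real ^ 'n::finite \<Rightarrow> complex) \<Rightarrow> real ^ 'n \<Rightarrow> complex ^ 'n" where
  "grad w = (SOME g. square_integrable_on g Omega \<and> has_weak_gradient_on w g (interior Omega))"

(* Periodicity of w in H1 (equality of the traces on opposite faces of Omega) means that the periodic
   extension of w does not jump across the translates of the faces: its weak gradient on the whole
   space exists and is the periodic extension of grad w. *)
definition H1P :: "(real ^ 'n::finite \<Rightarrow> complex) set" where
  "H1P = {w \<in> H1. has_weak_gradient_on (w \<circ> wrap) (grad w \<circ> wrap) UNIV}"

section \<open>Periodic simplicial meshes\<close>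

definition mesh_vertices :: "(real ^ 'n::finite) set set \<Rightarrow> (real ^ 'n) set" where
  "mesh_vertices \<T> = (\<Union>T\<in>\<T>. {v. v extreme_point_of T})"

(* Vertices identified by periodicity are counted once: their common representative is used.
   These nodes are the index set of the basis functions. *)
definition mesh_nodes :: "(real ^ 'n::finite) set set \<Rightarrow> (real ^ 'n) set" where
  "mesh_nodes \<T> = wrap ` mesh_vertices \<T>"

definition mesh_size :: "(real ^ 'n::finite) set set \<Rightarrow> real" where
  "mesh_size \<T> = Max (diameter ` \<T>)"

(* Compatibility with the identification of opposite faces: the periodic continuation of the mesh
   to the whole space is again conforming. *)
definition periodic_simplicial_mesh :: "(real ^ 'n::finite) set set \<Rightarrow> bool" where
  "periodic_simplicial_mesh \<T> \<longleftrightarrow>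
     triangulation \<T> \<and> (\<forall>T\<in>\<T>. int CARD('n) simplex T) \<and> \<Union>\<T> = Omega \<and>
     (\<forall>T\<in>\<T>. \<forall>T'\<in>\<T>. \<forall>k. (\<forall>i. \<exists>z::int. k $ i = 2 * pi * of_int z) \<longrightarrow>
        T \<inter> (+) k ` T' face_of T \<and> T \<inter> (+) k ` T' face_of (+) k ` T')"

definition shape_regular :: "real \<Rightarrow> (real ^ 'n::finite) set set \<Rightarrow> bool" where
  "shape_regular \<sigma> \<T> \<longleftrightarrow> (\<forall>T\<in>\<T>. \<exists>c r. ball c r \<subseteq> T \<and> diameter T \<le> \<sigma> * r)"

definition quasi_uniform :: "real \<Rightarrow> (real ^ 'n::finite) set set \<Rightarrow> bool" where
  "quasi_uniform \<rho> \<T> \<longleftrightarrow> (\<forall>T\<in>\<T>. mesh_size \<T> \<le> \<rho> * diameter T)"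

(* The union of the elements meeting K, where points of Omega identified by periodicity count as
   equal. *)
definition nbhd :: "(real ^ 'n::finite) set set \<Rightarrow> (real ^ 'n) set \<Rightarrow> (real ^ 'n) set" where
  "nbhd \<T> K = \<Union>{G \<in> \<T>. wrap ` G \<inter> wrap ` K \<noteq> {}}"

definition overlap_bound :: "(real ^ 'n::finite) set set \<Rightarrow> real \<Rightarrow> bool" where
  "overlap_bound \<T> C\<^sub>o\<^sub>l \<longleftrightarrow> (\<forall>T\<in>\<T>. real (card {G \<in> \<T>. G \<subseteq> nbhd \<T> T}) \<le> C\<^sub>o\<^sub>l)"

(* Distance from x to A modulo periodicity, i.e. to the union of the translates of A. *)
definition periodic_dist :: "real ^ 'n::finite \<Rightarrow> (real ^ 'n) set \<Rightarrow> real" where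
  "periodic_dist x A = infdist x {y. wrap y \<in> wrap ` A}"

definition cutoff :: "(real ^ 'n::finite) set set \<Rightarrow> (real ^ 'n) set \<Rightarrow> nat \<Rightarrow> real ^ 'n \<Rightarrow> real" where
  "cutoff \<T> K m x =
     periodic_dist x ((nbhd \<T> ^^ m) K) /
     (periodic_dist x ((nbhd \<T> ^^ m) K) + periodic_dist x (Omega - (nbhd \<T> ^^ Suc m) K))"

(* The cutoff is meaningful only if K and the complement of its (m+1)-st neighbourhood are nonempty. *)
definition cutoff_bound :: "(real ^ 'n::finite) set set \<Rightarrow> real \<Rightarrow> bool" where
  "cutoff_bound \<T> \<gamma> \<longleftrightarrow>
     (\<forall>\<K> m. \<K> \<subseteq> \<T> \<and> \<K> \<noteq> {} \<and> (nbhd \<T> ^^ Suc m) (\<Union>\<K>) \<noteq> Omega \<longrightarrow>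
        (\<exists>g. has_weak_gradient_on (cutoff \<T> (\<Union>\<K>) m) g (interior Omega) \<and>
             (AE x in lebesgue_on Omega. mesh_size \<T> * norm (g x) \<le> \<gamma>)))"

section \<open>Finite element space and interpolation\<close>

definition P1_space :: "(real ^ 'n::finite) set set \<Rightarrow> (real ^ 'n \<Rightarrow> complex) set" where
  "P1_space \<T> = {v \<in> H1P. \<forall>T\<in>\<T>. \<exists>(a::complex) (b::complex ^ 'n).
     \<forall>x\<in>T. v x = a + (\<Sum>i\<in>UNIV. b $ i * complex_of_real (x $ i))}"

definition nodal_basis :: "(real ^ 'n::finite) set set \<Rightarrow> (real ^ 'n \<Rightarrow> real ^ 'n \<Rightarrow> complex) \<Rightarrow> bool" where
  "nodal_basis \<T> \<phi> \<longleftrightarrow>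
     (\<forall>p\<in>mesh_nodes \<T>. \<phi> p \<in> P1_space \<T> \<and>
        (\<forall>v\<in>mesh_vertices \<T>. \<phi> p v = (if wrap v = p then 1 else 0)))"

definition supp :: "(real ^ 'n::finite \<Rightarrow> complex) \<Rightarrow> (real ^ 'n) set" where
  "supp f = closure {x \<in> Omega. f x \<noteq> 0}"

definition clement :: "(real ^ 'n::finite) set set \<Rightarrow> (real ^ 'n \<Rightarrow> real ^ 'n \<Rightarrow> complex) \<Rightarrow>
    (real ^ 'n \<Rightarrow> complex) \<Rightarrow> real ^ 'n \<Rightarrow> complex" where
  "clement \<T> \<phi> v x =
     (\<Sum>p\<in>mesh_nodes \<T>. L2inner v (\<phi> p) / L2inner (\<lambda>_. 1) (\<phi> p) * \<phi> p x)"

definition interpolation_bound ::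
  "(real ^ 'n::finite) set set \<Rightarrow> (real ^ 'n \<Rightarrow> real ^ 'n \<Rightarrow> complex) \<Rightarrow> real \<Rightarrow> bool" where
  "interpolation_bound \<T> \<phi> C\<^sub>I \<longleftrightarrow>
     (\<forall>T\<in>\<T>. \<forall>v\<in>H1P.
        inverse (mesh_size \<T>) * L2norm T (\<lambda>x. v x - clement \<T> \<phi> v x)
          + L2norm T (grad (\<lambda>x. v x - clement \<T> \<phi> v x))
        \<le> C\<^sub>I * L2norm (nbhd \<T> T) (grad v))"

section \<open>The potential, the energy form and the multiscale basis\<close>

(* D s is the partial derivative of V with multi-index s; C s is the constant of its bound. *)
definition admissible_potential ::
  "real \<Rightarrow> real \<Rightarrow> (('n::finite \<Rightarrow> nat) \<Rightarrow> real) \<Rightarrow> real \<Rightarrow> (real ^ 'n \<Rightarrow> real) \<Rightarrow> bool" where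
  "admissible_potential Vmin Vmax C \<delta> V \<longleftrightarrow>
     (\<forall>x\<in>Omega. Vmin \<le> V x \<and> V x \<le> Vmax) \<and>
     (\<exists>D :: ('n \<Rightarrow> nat) \<Rightarrow> real ^ 'n \<Rightarrow> real. \<forall>x\<in>interior Omega.
        D (\<lambda>_. 0) x = V x \<and>
        (\<forall>s i. ((\<lambda>t. D s (x + t *\<^sub>R axis i 1)) has_real_derivative D (s(i := Suc (s i))) x) (at 0)) \<and>
        (\<forall>s. \<bar>D s x\<bar> \<le> C s / \<delta> ^ (\<Sum>i\<in>UNIV. s i)))"

definition energy_form ::
  "real \<Rightarrow> (real ^ 'n::finite \<Rightarrow> real) \<Rightarrow> (real ^ 'n \<Rightarrow> complex) \<Rightarrow> (real ^ 'n \<Rightarrow> complex) \<Rightarrow> complex" where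
  "energy_form \<epsilon> V v w =
     complex_of_real (\<epsilon>\<^sup>2 / 2) * (LINT x|lebesgue_on Omega. (\<Sum>i\<in>UNIV. grad v x $ i * cnj (grad w x $ i)))
     + L2inner (\<lambda>x. complex_of_real (V x) * v x) w"

(* energy_form \<epsilon> V w w is a nonnegative real number, so Re only changes its type. *)
definition multiscale_basis_function :: "(real ^ 'n::finite) set set \<Rightarrow>
    (real ^ 'n \<Rightarrow> real ^ 'n \<Rightarrow> complex) \<Rightarrow> real \<Rightarrow> (real ^ 'n \<Rightarrow> real) \<Rightarrow>
    real ^ 'n \<Rightarrow> (real ^ 'n \<Rightarrow> complex) \<Rightarrow> bool" where
  "multiscale_basis_function \<T> \<phi> \<epsilon> V p \<psi> \<longleftrightarrow>
     is_arg_min (\<lambda>w. Re (energy_form \<epsilon> V w w))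
       (\<lambda>w. w \<in> H1P \<and> (\<forall>q\<in>mesh_nodes \<T>. L2inner w (\<phi> q) = (if p = q then 1 else 0))) \<psi>"

end

theory Submission
  imports Defs "HOL-Real_Asymp.Real_Asymp"
begin

text \<open>For a set \<open>M\<close> of nodes containing \<open>p\<close>, let \<open>\<eta>\<close> be the sum of the hat functions of the nodes outside \<open>M\<close>.
  On the elements without nodes in \<open>M\<close> it is 1, on those with all nodes in \<open>M\<close> it is 0; the remaining
  elements are called mixed. The constraints on \<open>\<eta> \<psi>\<close> are restored by a correction \<open>b\<close> which consists of
  smooth bumps dual to the hat functions inside each mixed element, so that \<open>a(\<psi>, \<eta> \<psi> - b) = 0\<close>. This bounds
  \<open>\<parallel>\<nabla>\<psi>\<parallel>\<^sup>2\<close> away from \<open>M\<close> by \<open>\<parallel>\<nabla>\<psi>\<parallel>\<^sup>2 + H\<^sup>-\<^sup>2 \<parallel>\<psi>\<parallel>\<^sup>2\<close> on the mixed elements alone (the resolution condition absorbs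
  the potential). On an element outside the support of \<open>\<phi>\<^sub>p\<close> the interpolant of \<open>\<psi>\<close> vanishes, hence
  \<open>H\<^sup>-\<^sup>1 \<parallel>\<psi>\<parallel>\<close> is bounded there by \<open>\<parallel>\<nabla>\<psi>\<parallel>\<close> on the neighbouring elements. Taking for \<open>M\<close> the nodes of the \<open>m\<close>-th
  layer around \<open>p\<close> yields geometric decay up to a constant factor; taking \<open>M = {p}\<close> yields a strict decrease in
  the first layer, which removes this factor.\<close>

section \<open>Weak gradients and piecewise smooth multipliers\<close>

text \<open>The decay factor carries no constant in front, so already the passage to the complement
  of one neighbourhood of the support must gain. This is why, for \<open>M = {p}\<close>, the error
  terms are kept inside the support of \<open>\<phi> p\<close> by a correction that does not leave
  the mixed elements: an interpolation-type correction would spread to their neighbours. It also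
  requires control of \<open>\<psi>\<close> itself inside that support, where its interpolant is a
  multiple of \<open>\<phi> p\<close>. The gradient bound for the interpolation error controls this
  multiple wherever \<open>\<phi> p\<close> is not constant, and elements on which it is constant
  are never mixed for this \<open>M\<close>. All ratios in the estimates are scale free:
  \<open>H / r\<close> is controlled by shape regularity and quasi-uniformity,
  \<open>H / \<epsilon>\<close> by the resolution condition. On the analytic side, multipliers are
  only piecewise smooth and \<open>grad\<close> is an arbitrary choice of weak gradient, which calls
  for a product rule across element boundaries and for uniqueness of weak gradients.\<close>

definition C1 :: "(real ^ 'n::finite \<Rightarrow> real) \<Rightarrow> (real ^ 'n \<Rightarrow> real ^ 'n) \<Rightarrow> bool" where
  "C1 f f' \<longleftrightarrow> (\<forall>x. (f has_derivative (\<lambda>h. f' x \<bullet> h)) (at x)) \<and> continuous_on UNIV f'"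

text \<open>On the exceptional set the values of \<open>f'\<close> are irrelevant, but bounded.\<close>
definition pwC1 :: "(real ^ 'n::finite \<Rightarrow> real) \<Rightarrow> (real ^ 'n \<Rightarrow> real ^ 'n) \<Rightarrow> bool" where
  "pwC1 f f' \<longleftrightarrow> f' \<in> borel_measurable borel \<and>
     (\<exists>L. L-lipschitz_on UNIV f \<and> (\<forall>x. \<bar>f x\<bar> \<le> L \<and> norm (f' x) \<le> L)) \<and>
     (\<exists>Z. closed Z \<and> negligible Z \<and> continuous_on (- Z) f' \<and>
          (\<forall>x. x \<notin> Z \<longrightarrow> (f has_derivative (\<lambda>h. f' x \<bullet> h)) (at x)))"

lemma pwC1_continuous: "pwC1 f f' \<Longrightarrow> continuous_on S f"
  unfolding pwC1_def by (meson continuous_on_subset lipschitz_on_continuous_on subset_UNIV)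

lemma pwC1_borel_measurable: "pwC1 f f' \<Longrightarrow> f \<in> borel_measurable borel"
  by (simp add: borel_measurable_continuous_onI pwC1_continuous)

section \<open>Mollification by averages over small balls\<close>

lemma negligible_affine_vimage:
  fixes Z :: "(real ^ 'n::finite) set"
  assumes "negligible Z" "h \<noteq> 0"
  shows "negligible {z. x + h *\<^sub>R z \<in> Z}"
proof -
  have "{z. x + h *\<^sub>R z \<in> Z} = (\<lambda>y. inverse h *\<^sub>R (y - x)) ` Z"
  proof (intro set_eqI iffI)
    fix z assume "z \<in> {z. x + h *\<^sub>R z \<in> Z}"
    then have "x + h *\<^sub>R z \<in> Z" by simp
    moreover have "z = inverse h *\<^sub>R ((x + h *\<^sub>R z) - x)" using assms by simp
    ultimately show "z \<in> (\<lambda>y. inverse h *\<^sub>R (y - x)) ` Z" by blast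
  qed (use assms in auto)
  moreover have "negligible ((\<lambda>y. inverse h *\<^sub>R (y - x)) ` Z)"
    by (rule negligible_differentiable_image_negligible[OF _ assms(1)])
       (auto intro!: derivative_intros)
  ultimately show ?thesis by simp
qed

lemma AE_unit_ball_notin:
  fixes Z :: "(real ^ 'n::finite) set"
  assumes "negligible Z" "h \<noteq> 0"
  shows "AE z in lebesgue_on (ball 0 1). x + h *\<^sub>R z \<notin> Z"
proof -
  have "AE z in lebesgue. x + h *\<^sub>R z \<notin> Z"
    using negligible_affine_vimage[OF assms, of x]
    by (auto simp: negligible_iff_null_sets intro!: AE_I'[where N="{z. x + h *\<^sub>R z \<in> Z}"])
  then show ?thesis
    by (subst AE_restrict_space_iff) auto
qed

lemma finite_measure_unit_ball: "finite_measure (lebesgue_on (ball 0 1 :: (real ^ 'n::finite) set))"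
  by (simp add: finite_measure_lebesgue_on)

lemma borel_measurable_affine_lebesgue_on:
  fixes f :: "real ^ 'n::finite \<Rightarrow> 'b::euclidean_space"
  assumes "f \<in> borel_measurable borel"
  shows "(\<lambda>z. f (x + h *\<^sub>R z)) \<in> borel_measurable (lebesgue_on S)"
proof -
  have "(\<lambda>z. f (x + h *\<^sub>R z)) \<in> borel_measurable borel"
    using assms by measurable
  then show ?thesis
    by (simp add: measurable_completion measurable_restrict_space1)
qed

lemma integrable_bounded_lebesgue_on:
  fixes f :: "real ^ 'n::finite \<Rightarrow> 'b::euclidean_space"
  assumes "f \<in> borel_measurable (lebesgue_on S)" "S \<in> lmeasurable" "\<And>x. x \<in> S \<Longrightarrow> norm (f x) \<le> B"
  shows "integrable (lebesgue_on S) f"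
proof -
  interpret finite_measure "lebesgue_on S"
    using assms(2) by (simp add: finite_measure_lebesgue_on)
  show ?thesis
    by (rule integrable_const_bound[of f B]) (use assms in \<open>auto intro!: AE_I2\<close>)
qed

text \<open>The mean of \<open>f\<close> over a ball of radius \<open>h\<close> about
  \<open>x\<close>, written over the fixed unit ball so that \<open>x\<close> and \<open>h\<close>
  occur only in the integrand and dominated convergence applies to both. The kernel is
  discontinuous; a \<open>C1\<close> result is still obtained because \<open>f\<close> will be
  Lipschitz with a gradient continuous off a null set.\<close>

definition mollify :: "real \<Rightarrow> (real ^ 'n::finite \<Rightarrow> 'b::euclidean_space) \<Rightarrow> real ^ 'n \<Rightarrow> 'b" where
  "mollify h f x = (1 / measure lebesgue (ball 0 1 :: (real ^ 'n) set)) *\<^sub>R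
     (LINT z|lebesgue_on (ball 0 1). f (x + h *\<^sub>R z))"

lemma norm_mollify_le:
  fixes f :: "real ^ 'n::finite \<Rightarrow> 'b::euclidean_space"
  assumes "f \<in> borel_measurable borel" "\<And>z. norm z < 1 \<Longrightarrow> norm (f (x + h *\<^sub>R z)) \<le> B"
  shows "norm (mollify h f x) \<le> B"
proof -
  let ?B = "ball 0 1 :: (real ^ 'n) set" and ?M = "lebesgue_on (ball 0 1 :: (real ^ 'n) set)"
  have V: "measure lebesgue ?B > 0"
    by (simp add: content_ball_pos)
  have int: "integrable ?M (\<lambda>z. f (x + h *\<^sub>R z))"
    by (rule integrable_bounded_lebesgue_on[where B=B])
       (use assms in \<open>auto intro: borel_measurable_affine_lebesgue_on\<close>)
  have intB: "integrable ?M (\<lambda>z. B)"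
    by (rule integrable_bounded_lebesgue_on[where B="norm B"]) auto
  have "norm (LINT z|?M. f (x + h *\<^sub>R z)) \<le> (LINT z|?M. norm (f (x + h *\<^sub>R z)))"
    by (rule integral_norm_bound)
  also have "\<dots> \<le> (LINT z|?M. B)"
    by (rule integral_mono) (use int intB assms in auto)
  also have "\<dots> = B * measure lebesgue ?B"
    by (simp add: measure_restrict_space)
  finally show ?thesis
    using V by (simp add: mollify_def field_simps)
qed

text \<open>Differentiation under the integral. For fixed \<open>x\<close>, almost every
  \<open>z\<close> moves \<open>x\<close> to a point off the exceptional set, where the difference
  quotients converge; the Lipschitz constant and the gradient bound majorize the remainders by
  \<open>2 * L\<close>. Continuity of the averaged gradient rests on the same null set
  argument.\<close>

lemma mollify_C1:
  fixes f :: "real ^ 'n::finite \<Rightarrow> real"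
  assumes f: "pwC1 f f'" and h: "h \<noteq> 0"
  shows "C1 (mollify h f) (mollify h f')"
proof -
  let ?B = "ball 0 1 :: (real ^ 'n) set" and ?M = "lebesgue_on (ball 0 1 :: (real ^ 'n) set)"
  let ?v = "1 / measure lebesgue ?B"
  interpret finite_measure ?M by (rule finite_measure_unit_ball)
  obtain L Z where L: "L-lipschitz_on UNIV f" "\<And>x. norm (f' x) \<le> L"
    and Z: "closed Z" "negligible Z" "continuous_on (- Z) f'"
      "\<And>x. x \<notin> Z \<Longrightarrow> (f has_derivative (\<lambda>h. f' x \<bullet> h)) (at x)"
    and meas: "f' \<in> borel_measurable borel"
    using f unfolding pwC1_def by blast
  have L0: "0 \<le> L" using L(1) lipschitz_on_nonneg by blast
  have fmeas: "f \<in> borel_measurable borel" by (rule pwC1_borel_measurable[OF f])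
  have mf: "(\<lambda>z. f (x + h *\<^sub>R z)) \<in> borel_measurable ?M" for x
    by (rule borel_measurable_affine_lebesgue_on[OF fmeas])
  have mf': "(\<lambda>z. f' (x + h *\<^sub>R z)) \<in> borel_measurable ?M" for x
    by (rule borel_measurable_affine_lebesgue_on[OF meas])
  have intf': "integrable ?M (\<lambda>z. f' (x + h *\<^sub>R z))" for x
    by (rule integrable_bounded_lebesgue_on[where B=L]) (use L mf' in auto)
  have intf: "integrable ?M (\<lambda>z. f (x + h *\<^sub>R z))" for x
  proof (rule integrable_bounded_lebesgue_on[where B="\<bar>f x\<bar> + L * \<bar>h\<bar>"])
    fix z :: "real ^ 'n" assume z: "z \<in> ball 0 1"
    have "\<bar>f (x + h *\<^sub>R z) - f x\<bar> \<le> L * norm (h *\<^sub>R z)"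
      using lipschitz_onD[OF L(1), of "x + h *\<^sub>R z" x] by (simp add: dist_norm)
    also have "\<dots> \<le> L * \<bar>h\<bar>"
      using z L0 by (auto intro!: mult_left_mono simp: mult_le_cancel_left1 mult_left_le)
    finally show "norm (f (x + h *\<^sub>R z)) \<le> \<bar>f x\<bar> + L * \<bar>h\<bar>" by simp
  qed (use mf in auto)
  have der: "(mollify h f has_derivative (\<lambda>k. mollify h f' x \<bullet> k)) (at x)" for x
    unfolding has_derivative_at
  proof
    show "bounded_linear (\<lambda>k. mollify h f' x \<bullet> k)" by (rule bounded_linear_inner_right)
    show "(\<lambda>k. norm (mollify h f (x + k) - mollify h f x - mollify h f' x \<bullet> k) / norm k) \<midarrow>0\<rightarrow> 0"
      unfolding LIMSEQ_SEQ_conv[symmetric]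
    proof (intro allI impI, elim conjE)
      fix S :: "nat \<Rightarrow> real ^ 'n" assume S0: "\<forall>n. S n \<noteq> 0" and S: "S \<longlonglongrightarrow> 0"
      define d where "d n z = (f (x + S n + h *\<^sub>R z) - f (x + h *\<^sub>R z) - f' (x + h *\<^sub>R z) \<bullet> S n) / norm (S n)" for n z
      have dm: "d n \<in> borel_measurable ?M" for n
        unfolding d_def by (intro borel_measurable_divide borel_measurable_diff borel_measurable_inner mf mf') auto
      have lim: "(\<lambda>n. LINT z|?M. d n z) \<longlonglongrightarrow> (LINT z|?M. 0)"
      proof (rule integral_dominated_convergence[where w="\<lambda>_. 2 * L"])
        show "AE z in ?M. (\<lambda>n. d n z) \<longlonglongrightarrow> 0"
          using AE_unit_ball_notin[OF Z(2) h, of x]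
        proof eventually_elim
          case (elim z)
          have "(\<lambda>k. norm (f (x + h *\<^sub>R z + k) - f (x + h *\<^sub>R z) - f' (x + h *\<^sub>R z) \<bullet> k) / norm k) \<midarrow>0\<rightarrow> 0"
            using Z(4)[OF elim] unfolding has_derivative_at by blast
          then have "(\<lambda>n. norm (f (x + h *\<^sub>R z + S n) - f (x + h *\<^sub>R z) - f' (x + h *\<^sub>R z) \<bullet> S n) / norm (S n)) \<longlonglongrightarrow> 0"
            unfolding LIMSEQ_SEQ_conv[symmetric] using S0 S by blast
          then have "(\<lambda>n. norm (d n z)) \<longlonglongrightarrow> 0"
            unfolding d_def by (simp add: algebra_simps)
          then show ?case using tendsto_norm_zero_iff by blast
        qed
        show "AE z in ?M. norm (d n z) \<le> 2 * L" for n
        proof (rule AE_I2)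
          fix z
          have "\<bar>f (x + S n + h *\<^sub>R z) - f (x + h *\<^sub>R z)\<bar> \<le> L * norm (S n)"
            using lipschitz_onD[OF L(1), of "x + S n + h *\<^sub>R z" "x + h *\<^sub>R z"] by (simp add: dist_norm)
          moreover have "\<bar>f' (x + h *\<^sub>R z) \<bullet> S n\<bar> \<le> L * norm (S n)"
            by (rule order_trans[OF Cauchy_Schwarz_ineq2]) (simp add: L(2) mult_right_mono)
          ultimately have "\<bar>f (x + S n + h *\<^sub>R z) - f (x + h *\<^sub>R z) - f' (x + h *\<^sub>R z) \<bullet> S n\<bar> \<le> 2 * L * norm (S n)"
            by linarith
          then show "norm (d n z) \<le> 2 * L"
            unfolding d_def using S0 by (simp add: divide_le_eq)
        qed
      qed (use dm in auto)
      have "norm (mollify h f (x + S n) - mollify h f x - mollify h f' x \<bullet> S n) / norm (S n)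
            = norm (?v * (LINT z|?M. d n z))" for n
      proof -
        have "(LINT z|?M. d n z) = ((LINT z|?M. f (x + S n + h *\<^sub>R z)) - (LINT z|?M. f (x + h *\<^sub>R z))
             - (LINT z|?M. f' (x + h *\<^sub>R z)) \<bullet> S n) / norm (S n)"
          unfolding d_def using intf[of x] intf[of "x + S n"] intf'[of x] by simp
        then have "?v * (LINT z|?M. d n z) = (mollify h f (x + S n) - mollify h f x - mollify h f' x \<bullet> S n) / norm (S n)"
          by (simp add: mollify_def inner_diff_left diff_divide_distrib mult.commute)
        then show ?thesis by (simp add: abs_divide)
      qed
      moreover have "(\<lambda>n. norm (?v * (LINT z|?M. d n z))) \<longlonglongrightarrow> 0"
        using tendsto_norm[OF tendsto_mult_left[OF lim, of ?v]] by simp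
      ultimately show "(\<lambda>n. norm (mollify h f (x + S n) - mollify h f x - mollify h f' x \<bullet> S n) / norm (S n)) \<longlonglongrightarrow> 0"
        by simp
    qed
  qed
  have "continuous_on UNIV (mollify h f')"
    unfolding continuous_on_sequentially
  proof (intro allI ballI impI, elim conjE)
    fix S x assume S: "S \<longlonglongrightarrow> (x :: real ^ 'n)"
    have "(\<lambda>n. LINT z|?M. f' (S n + h *\<^sub>R z)) \<longlonglongrightarrow> (LINT z|?M. f' (x + h *\<^sub>R z))"
    proof (rule integral_dominated_convergence[where w="\<lambda>_. L"])
      show "AE z in ?M. (\<lambda>n. f' (S n + h *\<^sub>R z)) \<longlonglongrightarrow> f' (x + h *\<^sub>R z)"
        using AE_unit_ball_notin[OF Z(2) h, of x]
      proof eventually_elim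
        case (elim z)
        have "isCont f' (x + h *\<^sub>R z)"
          using Z(1,3) elim by (simp add: continuous_on_eq_continuous_at open_Compl)
        moreover have "(\<lambda>n. S n + h *\<^sub>R z) \<longlonglongrightarrow> x + h *\<^sub>R z"
          by (intro tendsto_intros S)
        ultimately show ?case by (rule isCont_tendsto_compose)
      qed
    qed (use L mf' in auto)
    then show "(mollify h f' \<circ> S) \<longlonglongrightarrow> mollify h f' x"
      unfolding mollify_def o_def by (intro tendsto_intros)
  qed
  with der show ?thesis unfolding C1_def by blast
qed

lemma mollify_tendsto:
  fixes f :: "real ^ 'n::finite \<Rightarrow> 'b::euclidean_space"
  assumes f: "f \<in> borel_measurable borel" "isCont f x" and B: "\<And>y. norm y \<le> norm x + 1 \<Longrightarrow> norm (f y) \<le> B"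
    and h: "\<And>n. 0 \<le> h n \<and> h n \<le> 1" "h \<longlonglongrightarrow> 0"
  shows "(\<lambda>n. mollify (h n) f x) \<longlonglongrightarrow> f x"
proof -
  let ?B = "ball 0 1 :: (real ^ 'n) set" and ?M = "lebesgue_on (ball 0 1 :: (real ^ 'n) set)"
  interpret finite_measure ?M by (rule finite_measure_unit_ball)
  have V: "measure lebesgue ?B > 0"
    by (simp add: content_ball_pos)
  have "(\<lambda>n. LINT z|?M. f (x + h n *\<^sub>R z)) \<longlonglongrightarrow> (LINT z|?M. f x)"
  proof (rule integral_dominated_convergence[where w="\<lambda>_. B"])
    show "AE z in ?M. (\<lambda>n. f (x + h n *\<^sub>R z)) \<longlonglongrightarrow> f x"
    proof (rule AE_I2)
      fix z
      have "(\<lambda>n. x + h n *\<^sub>R z) \<longlonglongrightarrow> x + 0 *\<^sub>R z"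
        by (intro tendsto_intros h)
      then show "(\<lambda>n. f (x + h n *\<^sub>R z)) \<longlonglongrightarrow> f x"
        using isCont_tendsto_compose[OF f(2)] by simp
    qed
    show "AE z in ?M. norm (f (x + h n *\<^sub>R z)) \<le> B" for n
    proof (rule AE_I2)
      fix z assume "z \<in> space ?M"
      then have "norm z < 1" by simp
      then have "h n * norm z \<le> 1" using h(1)[of n] by (simp add: mult_le_one)
      then have "norm (x + h n *\<^sub>R z) \<le> norm x + 1"
        using h(1)[of n] norm_triangle_ineq[of x "h n *\<^sub>R z"] by simp
      then show "norm (f (x + h n *\<^sub>R z)) \<le> B" by (rule B)
    qed
  qed (use f in \<open>auto intro: borel_measurable_affine_lebesgue_on\<close>)
  then have "(\<lambda>n. (1 / measure lebesgue ?B) *\<^sub>R (LINT z|?M. f (x + h n *\<^sub>R z)))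
     \<longlonglongrightarrow> (1 / measure lebesgue ?B) *\<^sub>R (LINT z|?M. f x)"
    by (intro tendsto_intros)
  moreover have "(1 / measure lebesgue ?B) *\<^sub>R (LINT z|?M. f x) = f x"
    using V by (simp add: measure_restrict_space)
  ultimately show ?thesis by (simp add: mollify_def)
qed

section \<open>Test functions and products as piecewise smooth functions\<close>

lemma C1_imp_pwC1:
  fixes f :: "real ^ 'n::finite \<Rightarrow> real"
  assumes "C1 f f'" "\<And>x. \<bar>f x\<bar> \<le> B" "\<And>x. norm (f' x) \<le> B"
  shows "pwC1 f f'"
proof -
  have d: "(f has_derivative (\<lambda>h. f' x \<bullet> h)) (at x)" for x
    using assms(1) by (simp add: C1_def)
  have "B-lipschitz_on UNIV f"
  proof (rule bounded_derivative_imp_lipschitz[where f'="\<lambda>x h. f' x \<bullet> h"])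
    show "onorm (\<lambda>h. f' x \<bullet> h) \<le> B" for x
      by (rule onorm_le) (metis Cauchy_Schwarz_ineq2 assms(3) mult_right_mono norm_ge_zero order_trans real_norm_def)
    show "0 \<le> B" using assms(2)[of 0] by linarith
  qed (use d in \<open>auto intro: has_derivative_at_withinI\<close>)
  then show ?thesis
    unfolding pwC1_def using assms d
    by (auto simp: C1_def intro!: borel_measurable_continuous_onI exI[of _ B] exI[of _ "{}"])
qed

lemma C1_zero_outside:
  fixes f :: "real ^ 'n::finite \<Rightarrow> real"
  assumes "C1 f f'" "\<And>x. x \<notin> S \<Longrightarrow> f x = 0" "closed S" "x \<notin> S"
  shows "f' x = 0"
proof -
  have "(f has_derivative (\<lambda>h. f' x \<bullet> h)) (at x)"
    using assms(1) by (simp add: C1_def)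
  moreover have "((\<lambda>_. 0) has_derivative (\<lambda>h. 0)) (at x)" by simp
  then have "(f has_derivative (\<lambda>h. 0)) (at x)"
    by (rule has_derivative_transform_within_open[of _ _ _ _ "- S"]) (use assms in auto)
  ultimately have "(\<lambda>h. f' x \<bullet> h) = (\<lambda>h. 0)" by (rule has_derivative_unique)
  then have "f' x \<bullet> f' x = 0" by meson
  then show ?thesis by simp
qed

text \<open>Makes test functions piecewise smooth multipliers in their own right, so that the
  product of a test function and a multiplier falls under \<open>pwC1_mult\<close> and can itself be
  used for testing.\<close>

lemma C1_compact_support_imp_pwC1:
  fixes f :: "real ^ 'n::finite \<Rightarrow> real"
  assumes f: "C1 f f'" and K: "compact K" "\<And>x. x \<notin> K \<Longrightarrow> f x = 0"
  shows "pwC1 f f'"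
proof -
  have cf: "continuous_on UNIV f"
    using f by (meson C1_def continuous_at_imp_continuous_on has_derivative_continuous)
  have z: "f' x = 0" if "x \<notin> K" for x
    using C1_zero_outside[OF f K(2) compact_imp_closed[OF K(1)] that] .
  have "bounded (f ` K)" "bounded (f' ` K)"
    using f cf K(1) unfolding C1_def
    by (meson compact_continuous_image compact_imp_bounded continuous_on_subset subset_UNIV)+
  then obtain B1 B2 where B: "\<And>x. x \<in> K \<Longrightarrow> \<bar>f x\<bar> \<le> B1" "\<And>x. x \<in> K \<Longrightarrow> norm (f' x) \<le> B2"
    by (auto simp: bounded_iff)
  show ?thesis
  proof (rule C1_imp_pwC1[OF f])
    show "\<bar>f x\<bar> \<le> max 0 (max B1 B2)" "norm (f' x) \<le> max 0 (max B1 B2)" for x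
      by (cases "x \<in> K"; use B K(2) z in force)+
  qed
qed

lemma pwC1_mult:
  fixes f g :: "real ^ 'n::finite \<Rightarrow> real"
  assumes f: "pwC1 f f'" and g: "pwC1 g g'"
  shows "pwC1 (\<lambda>x. f x * g x) (\<lambda>x. f x *\<^sub>R g' x + g x *\<^sub>R f' x)"
proof -
  obtain L Z where L: "L-lipschitz_on UNIV f" "\<And>x. \<bar>f x\<bar> \<le> L" "\<And>x. norm (f' x) \<le> L"
    and Z: "closed Z" "negligible Z" "continuous_on (- Z) f'"
      "\<And>x. x \<notin> Z \<Longrightarrow> (f has_derivative (\<lambda>h. f' x \<bullet> h)) (at x)"
    and meas: "f' \<in> borel_measurable borel"
    using f unfolding pwC1_def by blast
  obtain M W where M: "M-lipschitz_on UNIV g" "\<And>x. \<bar>g x\<bar> \<le> M" "\<And>x. norm (g' x) \<le> M"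
    and W: "closed W" "negligible W" "continuous_on (- W) g'"
      "\<And>x. x \<notin> W \<Longrightarrow> (g has_derivative (\<lambda>h. g' x \<bullet> h)) (at x)"
    and meas2: "g' \<in> borel_measurable borel"
    using g unfolding pwC1_def by blast
  have L0: "0 \<le> L" "0 \<le> M" using L(1) M(1) lipschitz_on_nonneg by blast+
  \<comment> \<open>The definition of \<open>pwC1\<close> asks for a single constant;
    \<open>2 * L * M\<close> serves as Lipschitz constant, as bound of the product and as bound of
    its gradient.\<close>
  have "\<bar>f x * g x - f y * g y\<bar> \<le> (2 * L * M) * dist x y" for x y
  proof -
    have "f x * g x - f y * g y = f x * (g x - g y) + (f x - f y) * g y" by (simp add: algebra_simps)
    moreover have "\<bar>f x * (g x - g y)\<bar> \<le> L * (M * dist x y)"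
      unfolding abs_mult using lipschitz_onD[OF M(1), of x y] L(2) L0
      by (intro mult_mono) (auto simp: dist_real_def)
    moreover have "\<bar>(f x - f y) * g y\<bar> \<le> (L * dist x y) * M"
      unfolding abs_mult using lipschitz_onD[OF L(1), of x y] M(2) L0
      by (intro mult_mono) (auto simp: dist_real_def)
    ultimately show ?thesis by (simp add: algebra_simps)
  qed
  then have lip: "(2 * L * M)-lipschitz_on UNIV (\<lambda>x. f x * g x)"
    using L0 by (auto simp: lipschitz_on_def dist_real_def)
  have b1: "\<bar>f x * g x\<bar> \<le> 2 * L * M" for x
  proof -
    have "\<bar>f x * g x\<bar> \<le> L * M" unfolding abs_mult using L M L0 by (intro mult_mono) auto
    moreover have "0 \<le> L * M" using L0 by simp
    ultimately show ?thesis by linarith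
  qed
  have b2: "norm (f x *\<^sub>R g' x + g x *\<^sub>R f' x) \<le> 2 * L * M" for x
  proof -
    have "\<bar>f x\<bar> * norm (g' x) \<le> L * M" "\<bar>g x\<bar> * norm (f' x) \<le> M * L"
      using L M L0 by (auto intro!: mult_mono)
    then show ?thesis
      using norm_triangle_ineq[of "f x *\<^sub>R g' x" "g x *\<^sub>R f' x"] mult.commute[of M L] by simp
  qed
  have der: "((\<lambda>x. f x * g x) has_derivative (\<lambda>h. (f x *\<^sub>R g' x + g x *\<^sub>R f' x) \<bullet> h)) (at x)" if "x \<notin> Z \<union> W" for x
    using has_derivative_mult[OF Z(4) W(4), of x] that by (simp add: inner_add_left mult.commute)
  have cont: "continuous_on (- (Z \<union> W)) (\<lambda>x. f x *\<^sub>R g' x + g x *\<^sub>R f' x)"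
    by (intro continuous_intros pwC1_continuous[OF f] pwC1_continuous[OF g]
        continuous_on_subset[OF Z(3)] continuous_on_subset[OF W(3)]) auto
  have m: "(\<lambda>x. f x *\<^sub>R g' x + g x *\<^sub>R f' x) \<in> borel_measurable borel"
    using meas meas2 pwC1_borel_measurable[OF f] pwC1_borel_measurable[OF g] by measurable
  have "closed (Z \<union> W)" "negligible (Z \<union> W)" using Z W by auto
  then show ?thesis
    unfolding pwC1_def using m lip b1 b2 der cont by blast
qed

section \<open>Local integrability and testing with piecewise smooth functions\<close>

lemma integral_lebesgue_on_support:
  fixes f :: "real ^ 'n::finite \<Rightarrow> 'b::euclidean_space"
  assumes "S \<in> sets lebesgue" "\<And>x. x \<notin> S \<Longrightarrow> f x = 0"
  shows "(LINT x|lebesgue_on S. f x) = (LINT x|lebesgue. f x)"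
proof -
  have "(\<lambda>x. indicator S x *\<^sub>R f x) = f" using assms(2) by (auto simp: indicator_def)
  then show ?thesis using assms(1) by (simp add: integral_restrict_space)
qed

definition locally_integrable :: "(real ^ 'n::finite \<Rightarrow> 'b::euclidean_space) \<Rightarrow> bool" where
  "locally_integrable u \<longleftrightarrow> (\<forall>K. compact K \<longrightarrow> integrable (lebesgue_on K) u)"

lemma locally_integrable_measurable:
  fixes w :: "real ^ 'n::finite \<Rightarrow> 'c::euclidean_space"
  assumes "locally_integrable w"
  shows "w \<in> borel_measurable lebesgue"
proof (rule borel_measurable_LIMSEQ_metric)
  show "(\<lambda>x. indicator (cball 0 (real n)) x *\<^sub>R w x) \<in> borel_measurable lebesgue" for n
    using borel_measurable_integrable[of "lebesgue_on (cball 0 (real n))" w] assms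
    by (simp add: borel_measurable_restrict_space_iff locally_integrable_def)
  show "(\<lambda>n. indicator (cball 0 (real n)) x *\<^sub>R w x) \<longlonglongrightarrow> w x" for x
  proof (rule tendsto_eventually)
    obtain N where "norm x \<le> real N" using real_arch_simple by blast
    then show "\<forall>\<^sub>F n in sequentially. indicator (cball 0 (real n)) x *\<^sub>R w x = w x"
      by (auto simp: eventually_sequentially indicator_def intro!: exI[of _ N])
  qed
qed

lemma has_weak_gradient_on_UNIV_locally_integrable:
  "has_weak_gradient_on u g UNIV \<Longrightarrow> locally_integrable u \<and> locally_integrable g"
  by (auto simp: has_weak_gradient_on_def locally_integrable_def)

lemma has_weak_gradient_on_test:
  assumes "has_weak_gradient_on u g U" "C1 f f'" "compact K" "K \<subseteq> U" "\<And>x. x \<notin> K \<Longrightarrow> f x = 0"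
  shows "(LINT x|lebesgue_on U. f' x $ i *\<^sub>R u x) = - (LINT x|lebesgue_on U. f x *\<^sub>R g x $ i)"
proof -
  have "closure {x. f x \<noteq> 0} \<subseteq> K"
    using assms by (intro closure_minimal compact_imp_closed) auto
  moreover from this have "compact (closure {x. f x \<noteq> 0})"
    using assms(3) by (meson bounded_subset closed_closure compact_eq_bounded_closed)
  ultimately show ?thesis
    using assms unfolding has_weak_gradient_on_def C1_def by blast
qed

text \<open>The gradients of the mollified test functions converge boundedly off the exceptional set.\<close>
lemma weak_gradient_test_pwC1:
  fixes u :: "real ^ 'n::finite \<Rightarrow> 'b::euclidean_space"
  assumes wg: "has_weak_gradient_on u g UNIV" and f: "pwC1 f f'" and R: "\<And>x. R < norm x \<Longrightarrow> f x = 0"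
  shows "(LINT x|lebesgue. f' x $ i *\<^sub>R u x) = - (LINT x|lebesgue. f x *\<^sub>R g x $ i)"
proof -
  \<comment> \<open>Averaging with radii \<open>h n \<le> 1\<close> enlarges the support by at most
    1, so one ball carries all mollified functions.\<close>
  let ?K = "cball 0 (R + 1) :: (real ^ 'n) set" and ?M = "lebesgue_on (cball 0 (R + 1) :: (real ^ 'n) set)"
  define h where "h n = inverse (real (Suc n))" for n
  have h: "0 \<le> h n \<and> h n \<le> 1" "h n \<noteq> 0" for n
    by (auto simp: h_def inverse_le_1_iff)
  have h0: "h \<longlonglongrightarrow> 0" unfolding h_def by (rule LIMSEQ_inverse_real_of_nat)
  obtain L Z where L: "L-lipschitz_on UNIV f" "\<And>x. \<bar>f x\<bar> \<le> L" "\<And>x. norm (f' x) \<le> L"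
    and Z: "closed Z" "negligible Z" "continuous_on (- Z) f'"
      "\<And>x. x \<notin> Z \<Longrightarrow> (f has_derivative (\<lambda>h. f' x \<bullet> h)) (at x)"
    and meas: "f' \<in> borel_measurable borel"
    using f unfolding pwC1_def by blast
  have fmeas: "f \<in> borel_measurable borel" by (rule pwC1_borel_measurable[OF f])
  note um = has_weak_gradient_on_UNIV_locally_integrable[OF wg, THEN conjunct1, THEN locally_integrable_measurable]
    has_weak_gradient_on_UNIV_locally_integrable[OF wg, THEN conjunct2, THEN locally_integrable_measurable]
  have gm: "(\<lambda>x. g x $ i) \<in> borel_measurable lebesgue"
    by (rule borel_measurable_continuous_on[OF _ um(2), of "\<lambda>v. v $ i"]) (intro continuous_intros)
  have iu: "integrable ?M u" and ig: "integrable ?M g"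
    using wg by (auto simp: has_weak_gradient_on_def)
  define F where "F n = mollify (h n) f" for n
  define F' where "F' n = mollify (h n) f'" for n
  have C1F: "C1 (F n) (F' n)" for n unfolding F_def F'_def by (rule mollify_C1[OF f h(2)])
  have F0: "F n x = 0" if "x \<notin> ?K" for n x
  proof -
    have "norm (F n x) \<le> 0" unfolding F_def
    proof (rule norm_mollify_le[OF fmeas])
      fix z :: "real ^ 'n" assume "norm z < 1"
      then have "norm (h n *\<^sub>R z) \<le> 1" using h(1)[of n] by (auto intro: mult_le_one)
      then have "R < norm (x + h n *\<^sub>R z)"
        using that norm_diff_ineq[of x "h n *\<^sub>R z"] by simp
      then show "norm (f (x + h n *\<^sub>R z)) \<le> 0" using R by simp
    qed
    then show ?thesis by simp
  qed
  have F'0: "F' n x = 0" if "x \<notin> ?K" for n x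
    by (rule C1_zero_outside[OF C1F F0 _ that]) auto
  have f0: "f x = 0" if "x \<notin> ?K" for x using that R by simp
  have eq: "(LINT x|?M. F' n x $ i *\<^sub>R u x) = - (LINT x|?M. F n x *\<^sub>R g x $ i)" for n
  proof -
    have "(LINT x|lebesgue_on UNIV. F' n x $ i *\<^sub>R u x) = - (LINT x|lebesgue_on UNIV. F n x *\<^sub>R g x $ i)"
      by (rule has_weak_gradient_on_test[OF wg C1F[of n], where K="?K"]) (use F0 in auto)
    moreover have "(LINT x|?M. F' n x $ i *\<^sub>R u x) = (LINT x|lebesgue. F' n x $ i *\<^sub>R u x)"
      "(LINT x|?M. F n x *\<^sub>R g x $ i) = (LINT x|lebesgue. F n x *\<^sub>R g x $ i)"
      by (rule integral_lebesgue_on_support; use F0 F'0 in auto)+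
    ultimately show ?thesis by (simp add: lebesgue_on_UNIV_eq)
  qed
  have cF: "F n \<in> borel_measurable borel" "F' n \<in> borel_measurable borel" for n
    using C1F[of n] unfolding C1_def
    by (auto intro!: borel_measurable_continuous_onI continuous_at_imp_continuous_on intro: has_derivative_continuous simp: continuous_on_eq_continuous_at)
  have cF'i: "(\<lambda>x. F' n x $ i) \<in> borel_measurable borel" for n
    by (rule borel_measurable_continuous_on[OF _ cF(2), of "\<lambda>v. v $ i"]) (intro continuous_intros)
  have f'im: "(\<lambda>x. f' x $ i) \<in> borel_measurable borel"
    by (rule borel_measurable_continuous_on[OF _ meas, of "\<lambda>v. v $ i"]) (intro continuous_intros)
  have lm: "w \<in> borel_measurable ?M" if "w \<in> borel_measurable lebesgue" for w :: "real ^ 'n \<Rightarrow> 'c::euclidean_space"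
    using that by (rule measurable_restrict_space1)
  have bl: "w \<in> borel_measurable ?M" if "w \<in> borel_measurable borel" for w :: "real ^ 'n \<Rightarrow> 'c::euclidean_space"
    using that by (auto intro!: lm measurable_completion)
  have aeZ: "AE x in lebesgue. x \<notin> Z"
    using Z(2) by (auto simp: negligible_iff_null_sets intro!: AE_I'[where N=Z])
  have lim1: "(\<lambda>n. LINT x|?M. F' n x $ i *\<^sub>R u x) \<longlonglongrightarrow> (LINT x|?M. f' x $ i *\<^sub>R u x)"
  proof (rule integral_dominated_convergence[where w="\<lambda>x. L * norm (u x)"])
    show "AE x in ?M. (\<lambda>n. F' n x $ i *\<^sub>R u x) \<longlonglongrightarrow> f' x $ i *\<^sub>R u x"
    proof (subst AE_restrict_space_iff)
      show "AE x in lebesgue. x \<in> ?K \<longrightarrow> (\<lambda>n. F' n x $ i *\<^sub>R u x) \<longlonglongrightarrow> f' x $ i *\<^sub>R u x"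
        using aeZ
      proof eventually_elim
        case (elim x)
        have "isCont f' x" using Z(1,3) elim by (simp add: continuous_on_eq_continuous_at open_Compl)
        then have "(\<lambda>n. F' n x) \<longlonglongrightarrow> f' x"
          unfolding F'_def by (intro mollify_tendsto[where B=L] meas L h(1) h0)
        then show ?case by (auto intro!: tendsto_intros)
      qed
    qed auto
    show "AE x in ?M. norm (F' n x $ i *\<^sub>R u x) \<le> L * norm (u x)" for n
    proof (rule AE_I2)
      fix x
      have "norm (F' n x) \<le> L" unfolding F'_def by (rule norm_mollify_le[OF meas L(3)])
      then have "\<bar>F' n x $ i\<bar> \<le> L" using component_le_norm_cart order_trans by blast
      then show "norm (F' n x $ i *\<^sub>R u x) \<le> L * norm (u x)" by (simp add: mult_right_mono)
    qed
    show "(\<lambda>x. f' x $ i *\<^sub>R u x) \<in> borel_measurable ?M" "(\<lambda>x. F' n x $ i *\<^sub>R u x) \<in> borel_measurable ?M" for n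
      by (intro borel_measurable_scaleR bl f'im cF'i lm um)+
  qed (use iu in auto)
  have lim2: "(\<lambda>n. LINT x|?M. F n x *\<^sub>R g x $ i) \<longlonglongrightarrow> (LINT x|?M. f x *\<^sub>R g x $ i)"
  proof (rule integral_dominated_convergence[where w="\<lambda>x. L * norm (g x)"])
    show "AE x in ?M. (\<lambda>n. F n x *\<^sub>R g x $ i) \<longlonglongrightarrow> f x *\<^sub>R g x $ i"
    proof (rule AE_I2)
      fix x
      have "isCont f x" using pwC1_continuous[OF f, of UNIV] by (simp add: continuous_on_eq_continuous_at)
      then have "(\<lambda>n. F n x) \<longlonglongrightarrow> f x"
        unfolding F_def by (intro mollify_tendsto[where B=L] fmeas h(1) h0) (simp_all add: L)
      then show "(\<lambda>n. F n x *\<^sub>R g x $ i) \<longlonglongrightarrow> f x *\<^sub>R g x $ i" by (auto intro!: tendsto_intros)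
    qed
    show "AE x in ?M. norm (F n x *\<^sub>R g x $ i) \<le> L * norm (g x)" for n
    proof (rule AE_I2)
      fix x
      have "norm (F n x) \<le> L" unfolding F_def by (rule norm_mollify_le[OF fmeas]) (simp add: L)
      then show "norm (F n x *\<^sub>R g x $ i) \<le> L * norm (g x)"
        using Finite_Cartesian_Product.norm_nth_le[of "g x" i] by (auto intro!: mult_mono)
    qed
    show "(\<lambda>x. f x *\<^sub>R g x $ i) \<in> borel_measurable ?M" "(\<lambda>x. F n x *\<^sub>R g x $ i) \<in> borel_measurable ?M" for n
      by (intro borel_measurable_scaleR bl fmeas cF lm gm)+
  qed (use ig in auto)
  have "(LINT x|?M. f' x $ i *\<^sub>R u x) = - (LINT x|?M. f x *\<^sub>R g x $ i)"
    using LIMSEQ_unique[OF lim1[unfolded eq] tendsto_minus[OF lim2]] .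
  moreover have "(LINT x|?M. f x *\<^sub>R g x $ i) = (LINT x|lebesgue. f x *\<^sub>R g x $ i)"
    by (rule integral_lebesgue_on_support) (auto simp: f0)
  moreover have "(LINT x|?M. f' x $ i *\<^sub>R u x) = (LINT x|lebesgue. f' x $ i *\<^sub>R u x)"
  proof -
    \<comment> \<open>On \<open>Z\<close> the values of \<open>f'\<close> are arbitrary, so
      \<open>f'\<close> vanishes outside the ball only almost everywhere, and the two integrals are
      compared up to a null set.\<close>
    have ae0: "AE x in lebesgue. x \<notin> ?K \<longrightarrow> f' x = 0"
      using aeZ
    proof eventually_elim
      case (elim x)
      show ?case
      proof
        assume x: "x \<notin> ?K"
        have "((\<lambda>_. 0) has_derivative (\<lambda>h. 0)) (at x)" by simp
        then have "(f has_derivative (\<lambda>h. 0)) (at x)"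
          by (rule has_derivative_transform_within_open[of _ _ _ _ "- ?K"]) (use x f0 in auto)
        then have "(\<lambda>h. f' x \<bullet> h) = (\<lambda>h. 0)" using Z(4)[OF elim] has_derivative_unique by blast
        then have "f' x \<bullet> f' x = 0" by meson
        then show "f' x = 0" by simp
      qed
    qed
    have "(LINT x|?M. f' x $ i *\<^sub>R u x) = (LINT x|lebesgue. indicator ?K x *\<^sub>R (f' x $ i *\<^sub>R u x))"
      by (rule integral_restrict_space) auto
    also have "\<dots> = (LINT x|lebesgue. f' x $ i *\<^sub>R u x)"
    proof (rule integral_cong_AE)
      show "AE x in lebesgue. indicator ?K x *\<^sub>R (f' x $ i *\<^sub>R u x) = f' x $ i *\<^sub>R u x"
        using ae0 by eventually_elim (auto simp: indicator_def)
      show "(\<lambda>x. f' x $ i *\<^sub>R u x) \<in> borel_measurable lebesgue"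
        "(\<lambda>x. indicator ?K x *\<^sub>R (f' x $ i *\<^sub>R u x)) \<in> borel_measurable lebesgue"
        using measurable_completion[of "\<lambda>x. f' x $ i" lborel borel] f'im um
        by (intro borel_measurable_scaleR borel_measurable_indicator; simp)+
    qed
    finally show ?thesis .
  qed
  ultimately show ?thesis by simp
qed

section \<open>Product rule, sums and linear images of weak gradients\<close>

definition outer :: "real ^ 'n::finite \<Rightarrow> 'b::euclidean_space \<Rightarrow> 'b ^ 'n" where
  "outer a b = (\<chi> i. a $ i *\<^sub>R b)"

lemma outer_nth [simp]: "outer a b $ i = a $ i *\<^sub>R b"
  by (simp add: outer_def)

lemma norm_outer: "norm (outer a b) = norm a * norm b"
  by (simp add: outer_def norm_vec_def L2_set_left_distrib)

lemma borel_measurable_vec_nth [measurable (raw)]: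
  fixes f :: "'a \<Rightarrow> 'b::euclidean_space ^ 'n::finite"
  assumes "f \<in> borel_measurable M"
  shows "(\<lambda>x. f x $ i) \<in> borel_measurable M"
  by (rule borel_measurable_continuous_on[OF _ assms, of "\<lambda>v. v $ i"]) (intro continuous_intros)

lemma borel_measurable_outer:
  assumes [measurable]: "f \<in> borel_measurable M" "u \<in> borel_measurable M"
  shows "(\<lambda>x. outer (f x :: real ^ 'n::finite) (u x :: 'b::euclidean_space)) \<in> borel_measurable M"
proof -
  have "(\<lambda>x. outer (f x) (u x) \<bullet> axis i b) \<in> borel_measurable M" for i b
    by (simp add: inner_axis)
  then show ?thesis
    by (subst borel_measurable_euclidean_space) (auto simp: Basis_vec_def)
qed

lemma borel_measurable_vec_lambda:
  fixes f :: "'n::finite \<Rightarrow> 'a \<Rightarrow> 'b::euclidean_space"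
  assumes [measurable]: "\<And>i. f i \<in> borel_measurable M"
  shows "(\<lambda>x. \<chi> i. f i x) \<in> borel_measurable M"
proof -
  have "(\<lambda>x. (\<chi> i. f i x) \<bullet> axis i b) \<in> borel_measurable M" for i b
    by (simp add: inner_axis)
  then show ?thesis
    by (subst borel_measurable_euclidean_space) (auto simp: Basis_vec_def)
qed

lemma borel_imp_lebesgue_on:
  "f \<in> borel_measurable borel \<Longrightarrow> f \<in> borel_measurable (lebesgue_on S)"
  by (simp add: measurable_completion measurable_restrict_space1)

lemma locally_integrable_add:
  "locally_integrable u \<Longrightarrow> locally_integrable v \<Longrightarrow> locally_integrable (\<lambda>x. u x + v x)"
  by (simp add: locally_integrable_def)

lemma locally_integrable_bound:
  fixes w :: "real ^ 'n::finite \<Rightarrow> 'c::euclidean_space" and u :: "real ^ 'n \<Rightarrow> 'b::euclidean_space"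
  assumes "locally_integrable u" "w \<in> borel_measurable lebesgue" "\<And>x. norm (w x) \<le> B * norm (u x)"
  shows "locally_integrable w"
  unfolding locally_integrable_def
proof (intro allI impI)
  fix K :: "(real ^ 'n) set" assume "compact K"
  then have "integrable (lebesgue_on K) (\<lambda>x. B * norm (u x))"
    using assms(1) by (simp add: locally_integrable_def)
  then show "integrable (lebesgue_on K) w"
    by (rule Bochner_Integration.integrable_bound)
       (use assms in \<open>auto intro!: AE_I2 measurable_restrict_space1 intro: order_trans[OF _ abs_ge_self]\<close>)
qed

lemma locally_integrable_const: "locally_integrable (\<lambda>x::real ^ 'n::finite. c :: 'c::euclidean_space)"
  unfolding locally_integrable_def
  by (auto intro!: integrable_bounded_lebesgue_on[where B="norm c"] lmeasurable_compact)

lemma integrable_compact_support_scaleR: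
  fixes u :: "real ^ 'n::finite \<Rightarrow> 'b::euclidean_space"
  assumes u: "locally_integrable u" and c: "c \<in> borel_measurable borel" "\<And>x. \<bar>c x\<bar> \<le> L"
    and R: "\<And>x. R < norm x \<Longrightarrow> c x = 0"
  shows "integrable lebesgue (\<lambda>x. c x *\<^sub>R u x)"
proof (rule Bochner_Integration.integrable_bound)
  have "integrable (lebesgue_on (cball 0 R)) (\<lambda>x. L * norm (u x))"
    using u by (simp add: locally_integrable_def)
  then show "integrable lebesgue (\<lambda>x. indicator (cball 0 R) x *\<^sub>R (L * norm (u x)))"
    by (subst (asm) integrable_restrict_space) auto
  show "(\<lambda>x. c x *\<^sub>R u x) \<in> borel_measurable lebesgue"
    using c(1) locally_integrable_measurable[OF u] by (auto intro!: borel_measurable_scaleR simp: measurable_completion)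
  show "AE x in lebesgue. norm (c x *\<^sub>R u x) \<le> norm (indicator (cball 0 R) x *\<^sub>R (L * norm (u x)))"
  proof (rule AE_I2)
    fix x
    show "norm (c x *\<^sub>R u x) \<le> norm (indicator (cball 0 R) x *\<^sub>R (L * norm (u x)))"
    proof (cases "norm x \<le> R")
      case True
      have "\<bar>c x\<bar> * norm (u x) \<le> \<bar>L\<bar> * norm (u x)"
        using c(2)[of x] by (intro mult_right_mono) auto
      then show ?thesis using True by (simp add: abs_mult)
    qed (use R in simp)
  qed
qed

text \<open>Introduction rule in the form in which the later proofs consume test functions: support
  in a ball, gradient vanishing outside that ball, and \<open>pwC1\<close> already derived, so that
  \<open>weak_gradient_test_pwC1\<close> applies to the test function and to its products.\<close>

lemma has_weak_gradient_on_UNIV_I: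
  fixes u :: "real ^ 'n::finite \<Rightarrow> 'b::euclidean_space"
  assumes "locally_integrable u" "locally_integrable g"
    and "\<And>\<theta> \<theta>' i R. \<lbrakk>C1 \<theta> \<theta>'; pwC1 \<theta> \<theta>'; \<And>x. R < norm x \<Longrightarrow> \<theta> x = 0; \<And>x. R < norm x \<Longrightarrow> \<theta>' x = 0\<rbrakk> \<Longrightarrow>
      (LINT x|lebesgue. \<theta>' x $ i *\<^sub>R u x) = - (LINT x|lebesgue. \<theta> x *\<^sub>R g x $ i)"
  shows "has_weak_gradient_on u g UNIV"
  unfolding has_weak_gradient_on_def lebesgue_on_UNIV_eq
proof (intro conjI allI impI)
  fix \<theta> :: "real ^ 'n \<Rightarrow> real" and \<theta>' i
  assume *: "(\<forall>x. (\<theta> has_derivative (\<lambda>h. \<theta>' x \<bullet> h)) (at x)) \<and> continuous_on UNIV \<theta>' \<and>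
     compact (closure {x. \<theta> x \<noteq> 0}) \<and> closure {x. \<theta> x \<noteq> 0} \<subseteq> UNIV"
  then have C: "C1 \<theta> \<theta>'" by (simp add: C1_def)
  have "bounded {x. \<theta> x \<noteq> 0}" using * compact_imp_bounded bounded_subset closure_subset by blast
  then obtain R where R: "\<And>x. \<theta> x \<noteq> 0 \<Longrightarrow> norm x \<le> R" by (auto simp: bounded_iff)
  have z: "\<theta> x = 0" if "x \<notin> cball 0 R" for x using R[of x] that by auto
  show "(LINT x|lebesgue. \<theta>' x $ i *\<^sub>R u x) = - (LINT x|lebesgue. \<theta> x *\<^sub>R g x $ i)"
  proof (rule assms(3)[OF C C1_compact_support_imp_pwC1[OF C compact_cball z]])
    show "\<theta> x = 0" if "R < norm x" for x
      using z that by simp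
    show "\<theta>' x = 0" if "R < norm x" for x
      using C1_zero_outside[where S="cball 0 R", OF C z closed_cball] that by simp
  qed
qed (use assms in \<open>auto simp: locally_integrable_def\<close>)

lemma add_eq_minus_imp: "a + b = - c \<Longrightarrow> b = - (c + a)" for a b c :: "'a::ab_group_add"
proof -
  assume eq: "a + b = - c"
  have "b = (a + b) - a" by simp
  then show ?thesis unfolding eq by simp
qed

text \<open>The weak gradient of \<open>u\<close> is tested with \<open>\<theta> * f\<close>, which
  is piecewise smooth with bounded support. The term in which the derivative hits \<open>f\<close>
  is moved to the other side and becomes the tensor product
  \<open>outer (f' x) (u x)\<close>.\<close>

lemma has_weak_gradient_on_mult:
  fixes u :: "real ^ 'n::finite \<Rightarrow> 'b::euclidean_space"
  assumes wg: "has_weak_gradient_on u g UNIV" and f: "pwC1 f f'"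
  shows "has_weak_gradient_on (\<lambda>x. f x *\<^sub>R u x) (\<lambda>x. f x *\<^sub>R g x + outer (f' x) (u x)) UNIV"
proof -
  have li: "locally_integrable u" "locally_integrable g"
    using has_weak_gradient_on_UNIV_locally_integrable[OF wg] by auto
  note um = li[THEN locally_integrable_measurable]
  obtain L where L: "\<And>x. \<bar>f x\<bar> \<le> L" "\<And>x. norm (f' x) \<le> L" and meas: "f' \<in> borel_measurable borel"
    using f unfolding pwC1_def by blast
  have fm: "f \<in> borel_measurable borel" by (rule pwC1_borel_measurable[OF f])
  have fl: "f \<in> borel_measurable lebesgue" "f' \<in> borel_measurable lebesgue"
    using fm meas by (simp_all add: measurable_completion)
  have l1: "locally_integrable (\<lambda>x. f x *\<^sub>R u x)"
    by (rule locally_integrable_bound[OF li(1), where B=L]) (use fl um L in \<open>auto intro: mult_right_mono\<close>)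
  have l2: "locally_integrable (\<lambda>x. f x *\<^sub>R g x)"
    by (rule locally_integrable_bound[OF li(2), where B=L]) (use fl um L in \<open>auto intro: mult_right_mono\<close>)
  have l3: "locally_integrable (\<lambda>x. outer (f' x) (u x))"
    by (rule locally_integrable_bound[OF li(1), where B=L])
       (use fl um L in \<open>auto intro: mult_right_mono borel_measurable_outer simp: norm_outer\<close>)
  show ?thesis
  proof (rule has_weak_gradient_on_UNIV_I[OF l1 locally_integrable_add[OF l2 l3]])
    fix \<theta> :: "real ^ 'n \<Rightarrow> real" and \<theta>' i R
    assume th: "pwC1 \<theta> \<theta>'" and R: "\<And>x. R < norm x \<Longrightarrow> \<theta> x = 0" "\<And>x. R < norm x \<Longrightarrow> \<theta>' x = 0"
    have tm: "\<theta> \<in> borel_measurable borel" by (rule pwC1_borel_measurable[OF th])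
    obtain M where M: "\<And>x. \<bar>\<theta> x\<bar> \<le> M" "\<And>x. norm (\<theta>' x) \<le> M" and meas2: "\<theta>' \<in> borel_measurable borel"
      using th unfolding pwC1_def by blast
    have Mi: "\<bar>\<theta>' x $ i\<bar> \<le> M" and Li: "\<bar>f' x $ i\<bar> \<le> L" for x
      using component_le_norm_cart order_trans M(2) L(2) by blast+
    have M0: "0 \<le> M" using M(1)[of 0] by linarith
    have I1: "integrable lebesgue (\<lambda>x. (\<theta> x * f' x $ i) *\<^sub>R u x)"
      by (rule integrable_compact_support_scaleR[OF li(1), where L="M * L" and R=R])
         (use tm meas R M Li M0 in \<open>auto simp: abs_mult intro: mult_mono\<close>)
    have I2: "integrable lebesgue (\<lambda>x. (f x * \<theta>' x $ i) *\<^sub>R u x)"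
      by (rule integrable_compact_support_scaleR[OF li(1), where L="M * L" and R=R])
         (use fm meas2 R Mi L M0 in \<open>auto simp: abs_mult mult.commute[of "\<bar>f _\<bar>"] intro: mult_mono\<close>)
    have I3: "integrable lebesgue (\<lambda>x. (\<theta> x * f x) *\<^sub>R g x)"
      by (rule integrable_compact_support_scaleR[OF li(2), where L="M * L" and R=R])
         (use tm fm R M L M0 in \<open>auto simp: abs_mult intro: mult_mono\<close>)
    have I3': "integrable lebesgue (\<lambda>x. (\<theta> x * f x) *\<^sub>R g x $ i)"
      using integrable_bounded_linear[OF bounded_linear_vec_nth I3, of i] by simp
    have e1: "(LINT x|lebesgue. (\<theta> x *\<^sub>R f' x + f x *\<^sub>R \<theta>' x) $ i *\<^sub>R u x) = - (LINT x|lebesgue. (\<theta> x * f x) *\<^sub>R g x $ i)"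
      by (rule weak_gradient_test_pwC1[OF wg pwC1_mult[OF th f], where R=R]) (use R in simp)
    have e2: "(LINT x|lebesgue. (\<theta> x *\<^sub>R f' x + f x *\<^sub>R \<theta>' x) $ i *\<^sub>R u x) =
       (LINT x|lebesgue. (\<theta> x * f' x $ i) *\<^sub>R u x) + (LINT x|lebesgue. (f x * \<theta>' x $ i) *\<^sub>R u x)"
      using I1 I2 by (simp add: scaleR_add_left)
    have e3: "(LINT x|lebesgue. \<theta> x *\<^sub>R (f x *\<^sub>R g x + outer (f' x) (u x)) $ i)
      = (LINT x|lebesgue. (\<theta> x * f x) *\<^sub>R g x $ i) + (LINT x|lebesgue. (\<theta> x * f' x $ i) *\<^sub>R u x)"
      using I1 I3' by (simp add: scaleR_add_right)
    have e4: "(LINT x|lebesgue. \<theta>' x $ i *\<^sub>R (f x *\<^sub>R u x)) = (LINT x|lebesgue. (f x * \<theta>' x $ i) *\<^sub>R u x)"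
      by (simp add: mult.commute)
    show "(LINT x|lebesgue. \<theta>' x $ i *\<^sub>R (f x *\<^sub>R u x))
       = - (LINT x|lebesgue. \<theta> x *\<^sub>R (f x *\<^sub>R g x + outer (f' x) (u x)) $ i)"
      unfolding e4 e3 using e1 unfolding e2 by (rule add_eq_minus_imp)
  qed
qed

lemma has_weak_gradient_on_add:
  fixes u v :: "real ^ 'n::finite \<Rightarrow> 'b::euclidean_space"
  assumes u: "has_weak_gradient_on u g UNIV" and v: "has_weak_gradient_on v h UNIV"
  shows "has_weak_gradient_on (\<lambda>x. u x + v x) (\<lambda>x. g x + h x) UNIV"
proof -
  have li: "locally_integrable u" "locally_integrable g" "locally_integrable v" "locally_integrable h"
    using has_weak_gradient_on_UNIV_locally_integrable u v by auto
  show ?thesis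
  proof (rule has_weak_gradient_on_UNIV_I)
    fix \<theta> :: "real ^ 'n \<Rightarrow> real" and \<theta>' i R
    assume th: "pwC1 \<theta> \<theta>'" and R: "\<And>x. R < norm x \<Longrightarrow> \<theta> x = 0" "\<And>x. R < norm x \<Longrightarrow> \<theta>' x = 0"
    have tm: "\<theta> \<in> borel_measurable borel" by (rule pwC1_borel_measurable[OF th])
    obtain M where M: "\<And>x. \<bar>\<theta> x\<bar> \<le> M" "\<And>x. norm (\<theta>' x) \<le> M" and meas2: "\<theta>' \<in> borel_measurable borel"
      using th unfolding pwC1_def by blast
    have Mi: "\<bar>\<theta>' x $ i\<bar> \<le> M" for x
      using component_le_norm_cart order_trans M(2) by blast
    have I: "integrable lebesgue (\<lambda>x. \<theta> x *\<^sub>R w x)" if "locally_integrable w" for w :: "real ^ 'n \<Rightarrow> 'c::euclidean_space"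
      by (rule integrable_compact_support_scaleR[OF that, where L=M and R=R]) (use tm M R in auto)
    have I1: "integrable lebesgue (\<lambda>x. \<theta> x *\<^sub>R w x $ i)" if "locally_integrable w" for w :: "real ^ 'n \<Rightarrow> 'b ^ 'n"
      using integrable_bounded_linear[OF bounded_linear_vec_nth I[OF that], of i] by simp
    have I': "integrable lebesgue (\<lambda>x. \<theta>' x $ i *\<^sub>R w x)" if "locally_integrable w" for w :: "real ^ 'n \<Rightarrow> 'b"
      by (rule integrable_compact_support_scaleR[OF that, where L=M and R=R]) (use meas2 Mi R in auto)
    have "(LINT x|lebesgue. \<theta>' x $ i *\<^sub>R u x) = - (LINT x|lebesgue. \<theta> x *\<^sub>R g x $ i)"
      "(LINT x|lebesgue. \<theta>' x $ i *\<^sub>R v x) = - (LINT x|lebesgue. \<theta> x *\<^sub>R h x $ i)"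
      by (rule weak_gradient_test_pwC1[OF _ th R(1)]; use u v in simp)+
    then show "(LINT x|lebesgue. \<theta>' x $ i *\<^sub>R (u x + v x)) = - (LINT x|lebesgue. \<theta> x *\<^sub>R (g x + h x) $ i)"
      using I1[OF li(2)] I1[OF li(4)] I'[OF li(1)] I'[OF li(3)] by (simp add: scaleR_add_right)
  qed (intro locally_integrable_add li)+
qed

text \<open>A bounded linear map commutes with the integral. The case needed later is multiplication
  by a complex constant, which is not a real scalar multiple.\<close>

lemma has_weak_gradient_on_linear:
  fixes u :: "real ^ 'n::finite \<Rightarrow> 'b::euclidean_space"
  assumes u: "has_weak_gradient_on u g UNIV" and T: "bounded_linear T"
  shows "has_weak_gradient_on (\<lambda>x. T (u x) :: 'b) (\<lambda>x. \<chi> i. T (g x $ i)) UNIV"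
proof -
  interpret T: bounded_linear T by fact
  have li: "locally_integrable u" "locally_integrable g"
    using has_weak_gradient_on_UNIV_locally_integrable u by auto
  note um = li[THEN locally_integrable_measurable]
  obtain B where B: "\<And>x. norm (T x) \<le> norm x * B" "0 \<le> B" using T.nonneg_bounded by blast
  have Tm: "(\<lambda>x. T (w x)) \<in> borel_measurable M" if "w \<in> borel_measurable M" for w and M :: "'c measure"
    by (rule borel_measurable_continuous_on[OF _ that]) (simp add: T linear_continuous_on)
  have l1: "locally_integrable (\<lambda>x. T (u x))"
    by (rule locally_integrable_bound[OF li(1), where B=B]) (use um Tm B in \<open>auto simp: mult.commute\<close>)
  have l2: "locally_integrable (\<lambda>x. \<chi> i. T (g x $ i))"
  proof (rule locally_integrable_bound[OF li(2), where B=B])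
    show "(\<lambda>x. \<chi> i. T (g x $ i)) \<in> borel_measurable lebesgue"
      by (intro borel_measurable_vec_lambda Tm borel_measurable_vec_nth um)
    show "norm (\<chi> i. T (g x $ i)) \<le> B * norm (g x)" for x
    proof -
      have "norm (\<chi> i. T (g x $ i)) \<le> L2_set (\<lambda>i. B * norm (g x $ i)) UNIV"
        unfolding norm_vec_def by (rule L2_set_mono) (use B in \<open>auto simp: mult.commute\<close>)
      then show ?thesis using B(2) by (simp add: norm_vec_def L2_set_right_distrib)
    qed
  qed
  show ?thesis
  proof (rule has_weak_gradient_on_UNIV_I[OF l1 l2])
    fix \<theta> :: "real ^ 'n \<Rightarrow> real" and \<theta>' i R
    assume th: "pwC1 \<theta> \<theta>'" and R: "\<And>x. R < norm x \<Longrightarrow> \<theta> x = 0" "\<And>x. R < norm x \<Longrightarrow> \<theta>' x = 0"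
    have tm: "\<theta> \<in> borel_measurable borel" by (rule pwC1_borel_measurable[OF th])
    obtain M where M: "\<And>x. \<bar>\<theta> x\<bar> \<le> M" "\<And>x. norm (\<theta>' x) \<le> M" and meas2: "\<theta>' \<in> borel_measurable borel"
      using th unfolding pwC1_def by blast
    have Mi: "\<bar>\<theta>' x $ i\<bar> \<le> M" for x
      using component_le_norm_cart order_trans M(2) by blast
    have "integrable lebesgue (\<lambda>x. \<theta> x *\<^sub>R g x)"
      by (rule integrable_compact_support_scaleR[OF li(2), where L=M and R=R]) (use tm M R in auto)
    then have I1: "integrable lebesgue (\<lambda>x. \<theta> x *\<^sub>R g x $ i)"
      using integrable_bounded_linear[OF bounded_linear_vec_nth, of lebesgue _ i] by fastforce
    have I': "integrable lebesgue (\<lambda>x. \<theta>' x $ i *\<^sub>R u x)"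
      by (rule integrable_compact_support_scaleR[OF li(1), where L=M and R=R]) (use meas2 Mi R in auto)
    have "(LINT x|lebesgue. \<theta>' x $ i *\<^sub>R T (u x)) = T (LINT x|lebesgue. \<theta>' x $ i *\<^sub>R u x)"
      using integral_bounded_linear[OF T I'] by (simp add: T.scaleR)
    also have "\<dots> = T (- (LINT x|lebesgue. \<theta> x *\<^sub>R g x $ i))"
      by (subst weak_gradient_test_pwC1[OF u th R(1)]) auto
    also have "\<dots> = - (LINT x|lebesgue. \<theta> x *\<^sub>R T (g x $ i))"
      using integral_bounded_linear[OF T I1] by (simp add: T.scaleR T.neg)
    finally show "(LINT x|lebesgue. \<theta>' x $ i *\<^sub>R T (u x)) = - (LINT x|lebesgue. \<theta> x *\<^sub>R (\<chi> i. T (g x $ i)) $ i)"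
      by simp
  qed
qed

section \<open>Translation invariance and the gradient of constants\<close>

lemma integral_lebesgue_translation:
  fixes f :: "real ^ 'n::finite \<Rightarrow> 'b::euclidean_space"
  assumes "f \<in> borel_measurable borel"
  shows "(LINT x|lebesgue. f (a + x)) = (LINT x|lebesgue. f x)"
proof -
  have "(LINT x|lborel. f x) = (LINT x|distr lborel borel ((+) a). f x)"
    by (simp add: lborel_distr_plus)
  also have "\<dots> = (LINT x|lborel. f (a + x))"
    by (rule integral_distr) (use assms in auto)
  finally show ?thesis
    using assms by (simp add: integral_completion)
qed

text \<open>The difference quotients in direction \<open>i\<close> have integral zero by translation
  invariance, and they converge to the partial derivative under the majorant \<open>L\<close> on the
  ball of radius \<open>R + 1\<close>, the shifts being at most 1. This is what gives constants the
  weak gradient zero.\<close>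

lemma C1_integral_gradient_eq_0:
  fixes f :: "real ^ 'n::finite \<Rightarrow> real"
  assumes f: "C1 f f'" and R: "\<And>x. R < norm x \<Longrightarrow> f x = 0"
  shows "(LINT x|lebesgue. f' x $ i) = 0"
proof -
  have z: "f x = 0" if "x \<notin> cball 0 R" for x using that R by auto
  have pw: "pwC1 f f'" by (rule C1_compact_support_imp_pwC1[OF f compact_cball z])
  obtain L where L: "L-lipschitz_on UNIV f" "\<And>x. \<bar>f x\<bar> \<le> L" "\<And>x. norm (f' x) \<le> L"
    and meas: "f' \<in> borel_measurable borel"
    using pw unfolding pwC1_def by blast
  have fm: "f \<in> borel_measurable borel" by (rule pwC1_borel_measurable[OF pw])
  have L0: "0 \<le> L" using L(2)[of 0] by linarith
  let ?e = "axis i 1 :: real ^ 'n"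
  define h where "h n = inverse (real (Suc n))" for n
  have h: "0 < h n" "h n \<le> 1" for n by (auto simp: h_def inverse_le_1_iff)
  have h0: "h \<longlonglongrightarrow> 0" unfolding h_def by (rule LIMSEQ_inverse_real_of_nat)
  have intf: "integrable lebesgue f"
    using integrable_compact_support_scaleR[OF locally_integrable_const[of "1::real"] fm L(2) R] by simp
  have intt: "integrable lebesgue (\<lambda>x. f (h n *\<^sub>R ?e + x))" for n
  proof -
    have "integrable lebesgue (\<lambda>x. f (h n *\<^sub>R ?e + x) *\<^sub>R (1::real))"
    proof (rule integrable_compact_support_scaleR[OF locally_integrable_const[of "1::real"], where L=L and R="R + 1"])
      fix x :: "real ^ 'n" assume "R + 1 < norm x"
      moreover have "norm x \<le> norm (h n *\<^sub>R ?e + x) + norm (h n *\<^sub>R ?e)"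
        using norm_triangle_ineq4[of "h n *\<^sub>R ?e + x" "h n *\<^sub>R ?e"] by simp
      ultimately show "f (h n *\<^sub>R ?e + x) = 0" using h[of n] by (intro R) (simp add: norm_axis_1)
    qed (use fm L in \<open>auto\<close>)
    then show ?thesis by simp
  qed
  have lim: "(\<lambda>n. LINT x|lebesgue. (f (h n *\<^sub>R ?e + x) - f x) / h n) \<longlonglongrightarrow> (LINT x|lebesgue. f' x $ i)"
  proof (rule integral_dominated_convergence[where w="\<lambda>x. indicator (cball 0 (R + 1)) x *\<^sub>R L"])
    show "AE x in lebesgue. (\<lambda>n. (f (h n *\<^sub>R ?e + x) - f x) / h n) \<longlonglongrightarrow> f' x $ i"
    proof (rule AE_I2)
      fix x
      have "(f has_derivative (\<lambda>h. f' x \<bullet> h)) (at x)" using f by (simp add: C1_def)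
      then have f: "(f has_derivative (\<lambda>h. f' x \<bullet> h)) (at (x + 0 *\<^sub>R ?e))" by simp
      have "((\<lambda>t. x + t *\<^sub>R ?e) has_derivative (\<lambda>t. t *\<^sub>R ?e)) (at 0)"
        by (auto intro!: derivative_eq_intros)
      from has_derivative_compose[OF this f]
      have "((\<lambda>t. f (x + t *\<^sub>R ?e)) has_real_derivative f' x $ i) (at 0)"
        by (simp add: has_field_derivative_def inner_axis mult_commute_abs)
      then have "(\<lambda>t. (f (x + t *\<^sub>R ?e) - f x) / t) \<midarrow>0\<rightarrow> f' x $ i"
        by (simp add: DERIV_def)
      then have "(\<lambda>n. (f (x + h n *\<^sub>R ?e) - f x) / h n) \<longlonglongrightarrow> f' x $ i"
        using h(1) h0 unfolding LIMSEQ_SEQ_conv[symmetric] by (auto dest!: spec[of _ h] simp: less_imp_neq[symmetric])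
      then show "(\<lambda>n. (f (h n *\<^sub>R ?e + x) - f x) / h n) \<longlonglongrightarrow> f' x $ i" by (simp add: add.commute)
    qed
    show "AE x in lebesgue. norm ((f (h n *\<^sub>R ?e + x) - f x) / h n) \<le> indicator (cball 0 (R + 1)) x *\<^sub>R L" for n
    proof (rule AE_I2)
      fix x
      have "\<bar>f (h n *\<^sub>R ?e + x) - f x\<bar> \<le> L * h n"
        using lipschitz_onD[OF L(1), of "h n *\<^sub>R ?e + x" x] h[of n] by (simp add: dist_norm norm_axis_1)
      moreover have "f (h n *\<^sub>R ?e + x) - f x = 0" if "R + 1 < norm x"
      proof -
        have "norm x \<le> norm (h n *\<^sub>R ?e + x) + norm (h n *\<^sub>R ?e)"
          using norm_triangle_ineq4[of "h n *\<^sub>R ?e + x" "h n *\<^sub>R ?e"] by simp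
        then show ?thesis using that R h[of n] by (simp add: norm_axis_1)
      qed
      ultimately show "norm ((f (h n *\<^sub>R ?e + x) - f x) / h n) \<le> indicator (cball 0 (R + 1)) x *\<^sub>R L"
        using h[of n] by (cases "norm x \<le> R + 1") (auto simp: divide_le_eq)
    qed
    have "integrable (lebesgue_on (cball 0 (R + 1) :: (real ^ 'n) set)) (\<lambda>x. L)"
      using locally_integrable_const[of L, where 'n='n] by (simp add: locally_integrable_def)
    then show "integrable lebesgue (\<lambda>x :: real ^ 'n. indicator (cball 0 (R + 1)) x *\<^sub>R L)"
      by (subst (asm) integrable_restrict_space) auto
    show "(\<lambda>x. f' x $ i) \<in> borel_measurable lebesgue"
      using meas by (intro borel_measurable_vec_nth) (simp add: measurable_completion)
    show "(\<lambda>x. (f (h n *\<^sub>R ?e + x) - f x) / h n) \<in> borel_measurable lebesgue" for n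
      using intf intt by (intro borel_measurable_divide borel_measurable_diff) auto
  qed
  have zero: "(LINT x|lebesgue. (f (h n *\<^sub>R ?e + x) - f x) / h n) = 0" for n
    using intf intt by (simp add: integral_lebesgue_translation[OF fm])
  have "(\<lambda>n::nat. 0::real) \<longlonglongrightarrow> (LINT x|lebesgue. f' x $ i)"
    using lim unfolding zero .
  then show ?thesis by (simp add: LIMSEQ_const_iff)
qed

lemma has_weak_gradient_on_const:
  "has_weak_gradient_on (\<lambda>x::real ^ 'n::finite. c :: 'b::euclidean_space) (\<lambda>x. 0) UNIV"
proof (rule has_weak_gradient_on_UNIV_I)
  fix \<theta> :: "real ^ 'n \<Rightarrow> real" and \<theta>' i R
  assume C: "C1 \<theta> \<theta>'" "pwC1 \<theta> \<theta>'" and R: "\<And>x. R < norm x \<Longrightarrow> \<theta> x = 0" "\<And>x. R < norm x \<Longrightarrow> \<theta>' x = 0"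
  have "(LINT x|lebesgue. \<theta>' x $ i *\<^sub>R c) = (LINT x|lebesgue. \<theta>' x $ i) *\<^sub>R c"
  proof (rule integral_scaleR_left)
    obtain M where M: "\<And>x. norm (\<theta>' x) \<le> M" and meas: "\<theta>' \<in> borel_measurable borel"
      using C(2) unfolding pwC1_def by blast
    have Mi: "\<bar>\<theta>' x $ i\<bar> \<le> M" for x
      using component_le_norm_cart order_trans M by blast
    show "integrable lebesgue (\<lambda>x. \<theta>' x $ i)"
      using integrable_compact_support_scaleR[OF locally_integrable_const[of "1::real"], of "\<lambda>x. \<theta>' x $ i" M R] meas Mi R(2)
      by simp
  qed
  then show "(LINT x|lebesgue. \<theta>' x $ i *\<^sub>R c) = - (LINT x|lebesgue. \<theta> x *\<^sub>R (0 :: 'b ^ 'n) $ i)"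
    using C1_integral_gradient_eq_0[OF C(1) R(1)] by simp
qed (rule locally_integrable_const)+

section \<open>Uniqueness of weak gradients\<close>

lemma C1_continuous: "C1 f f' \<Longrightarrow> continuous_on S f"
  by (meson C1_def continuous_at_imp_continuous_on has_derivative_continuous)

lemma C1_mult:
  assumes "C1 f f'" "C1 g g'"
  shows "C1 (\<lambda>x. f x * g x) (\<lambda>x. f x *\<^sub>R g' x + g x *\<^sub>R f' x)"
proof -
  have "((\<lambda>x. f x * g x) has_derivative (\<lambda>h. (f x *\<^sub>R g' x + g x *\<^sub>R f' x) \<bullet> h)) (at x)" for x
    using has_derivative_mult[of f "\<lambda>h. f' x \<bullet> h" x UNIV g "\<lambda>h. g' x \<bullet> h"] assms
    by (simp add: C1_def inner_add_left mult.commute)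
  moreover have "continuous_on UNIV (\<lambda>x. f x *\<^sub>R g' x + g x *\<^sub>R f' x)"
    using assms by (intro continuous_intros C1_continuous[OF assms(1)] C1_continuous[OF assms(2)]) (simp_all add: C1_def)
  ultimately show ?thesis by (simp add: C1_def)
qed

lemma C1_compose:
  fixes u :: "real ^ 'n::finite \<Rightarrow> real"
  assumes u: "C1 u u'" and q: "\<And>t. (q has_real_derivative q' t) (at t)" "continuous_on UNIV q'"
  shows "C1 (\<lambda>x. q (u x)) (\<lambda>x. q' (u x) *\<^sub>R u' x)"
proof -
  have "((\<lambda>x. q (u x)) has_derivative (\<lambda>h. (q' (u x) *\<^sub>R u' x) \<bullet> h)) (at x)" for x
    using has_derivative_compose[of u "\<lambda>h. u' x \<bullet> h" x UNIV q "\<lambda>h. q' (u x) * h"] u q(1)[of "u x"]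
    by (simp add: C1_def has_field_derivative_def)
  moreover have "continuous_on UNIV (\<lambda>x. q' (u x) *\<^sub>R u' x)"
    using u by (intro continuous_on_scaleR continuous_on_compose2[OF q(2) C1_continuous[OF u]]) (auto simp: C1_def)
  ultimately show ?thesis by (simp add: C1_def)
qed

lemma C1_affine: "C1 (\<lambda>x. a + b \<bullet> x) (\<lambda>x. b)"
  unfolding C1_def by (auto intro!: derivative_eq_intros)

text \<open>Squaring smooths the kink of the positive part: at 0 the difference quotient is bounded
  by \<open>\<bar>h\<bar>\<close>. This profile underlies the half-space functions, the test
  functions approximating indicators, and the bumps.\<close>

lemma has_real_derivative_max_0_sqr: "((\<lambda>t::real. (max 0 t)\<^sup>2) has_real_derivative 2 * max 0 t) (at t)"
proof -
  consider "t < 0" | "t > 0" | "t = 0" by linarith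
  then show ?thesis
  proof cases
    case 1
    have "((\<lambda>t::real. 0) has_real_derivative 2 * max 0 t) (at t)" using 1 by simp
    then show ?thesis
      by (rule DERIV_cong_ev[THEN iffD1, rotated -1])
         (use 1 in \<open>auto simp: eventually_nhds intro!: exI[of _ "{..<0}"]\<close>)
  next
    case 2
    have "((\<lambda>t::real. t\<^sup>2) has_real_derivative 2 * max 0 t) (at t)" using 2 by (auto intro!: derivative_eq_intros)
    then show ?thesis
      by (rule DERIV_cong_ev[THEN iffD1, rotated -1])
         (use 2 in \<open>auto simp: eventually_nhds intro!: exI[of _ "{0<..}"]\<close>)
  next
    case 3
    have "(\<lambda>h::real. (max 0 h)\<^sup>2 / h) \<midarrow>0\<rightarrow> 0"
    proof (rule Lim_null_comparison[where g="\<lambda>h. \<bar>h\<bar>"])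
      have "norm ((max 0 h)\<^sup>2 / h) \<le> \<bar>h\<bar>" for h :: real
        by (cases "h \<le> 0") (auto simp: power2_eq_square)
      then show "\<forall>\<^sub>F h in at 0. norm ((max 0 h)\<^sup>2 / h) \<le> \<bar>h :: real\<bar>" by simp
      show "(\<lambda>h::real. \<bar>h\<bar>) \<midarrow>0\<rightarrow> 0" by (intro tendsto_eq_intros) auto
    qed
    then show ?thesis using 3 by (simp add: DERIV_def)
  qed
qed

text \<open>Sets of this form are stable under intersection (multiply the functions), include the
  half-spaces and hence generate the Borel sets, and their indicators are limits of test functions.
  They reduce the fundamental lemma of the calculus of variations to a Dynkin argument.\<close>

definition positivity_set :: "(real ^ 'n::finite) set \<Rightarrow> bool" where
  "positivity_set B \<longleftrightarrow> (\<exists>u u'. C1 u u' \<and> (\<forall>x. 0 \<le> u x) \<and> B = {x. 0 < u x})"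

lemma positivity_set_UNIV: "positivity_set UNIV"
  unfolding positivity_set_def
  by (rule exI[of _ "\<lambda>x. 1"], rule exI[of _ "\<lambda>x. 0"]) (use C1_affine[of 1 0] in auto)

lemma positivity_set_Int:
  assumes "positivity_set A" "positivity_set B"
  shows "positivity_set (A \<inter> B)"
proof -
  obtain u u' v v' where "C1 u u'" "\<And>x. 0 \<le> u x" "A = {x. 0 < u x}" "C1 v v'" "\<And>x. 0 \<le> v x" "B = {x. 0 < v x}"
    using assms unfolding positivity_set_def by blast
  then show ?thesis
    unfolding positivity_set_def using C1_mult[of u u' v v']
    by (intro exI[of _ "\<lambda>x. u x * v x"] exI) (auto simp: zero_less_mult_iff order.strict_iff_order)
qed

lemma positivity_set_Inter:
  "finite I \<Longrightarrow> (\<And>i. i \<in> I \<Longrightarrow> positivity_set (A i)) \<Longrightarrow> positivity_set (\<Inter>i\<in>I. A i)"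
  by (induction I rule: finite_induct) (auto simp: positivity_set_UNIV intro!: positivity_set_Int)

lemma positivity_set_halfspace: "positivity_set {x. a < b \<bullet> x}"
proof -
  have "C1 (\<lambda>x. (max 0 (- a + b \<bullet> x))\<^sup>2) (\<lambda>x. (2 * max 0 (- a + b \<bullet> x)) *\<^sub>R b)"
    by (rule C1_compose[OF C1_affine]) (auto intro!: has_real_derivative_max_0_sqr continuous_intros)
  then show ?thesis
    unfolding positivity_set_def
  proof (intro exI conjI)
    show "{x. a < b \<bullet> x} = {x. 0 < (max 0 (- a + b \<bullet> x))\<^sup>2}"
      by (rule set_eqI) (auto simp: max_def split: if_splits)
  qed simp_all
qed

lemma positivity_set_box: "positivity_set (box a b :: (real ^ 'n::finite) set)"
proof -
  have "box a b = (\<Inter>i\<in>Basis. {x. a \<bullet> i < i \<bullet> x} \<inter> {x. - (b \<bullet> i) < (- i) \<bullet> x})"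
    by (auto simp: box_def inner_commute)
  then show ?thesis
    by (auto intro!: positivity_set_Inter positivity_set_Int positivity_set_halfspace simp del: inner_minus_left)
qed

lemma positivity_set_measurable: "positivity_set B \<Longrightarrow> B \<in> sets borel"
  unfolding positivity_set_def using C1_continuous[of _ _ UNIV]
  by (auto intro!: borel_open open_Collect_less continuous_on_const)

lemma borel_eq_sigma_positivity_sets:
  "sets (borel :: (real ^ 'n::finite) measure) = sigma_sets UNIV (Collect positivity_set)"
proof (rule antisym)
  have "positivity_set {x. a < x \<bullet> i}" for a and i :: "real ^ 'n"
    using positivity_set_halfspace[of a i] by (simp add: inner_commute)
  then show "sets (borel :: (real ^ 'n::finite) measure) \<subseteq> sigma_sets UNIV (Collect positivity_set)"
    unfolding borel_eq_halfspace_greater by (subst sets_measure_of) (auto intro!: sigma_sets_mono')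
  show "sigma_sets UNIV (Collect positivity_set) \<subseteq> sets (borel :: (real ^ 'n) measure)"
    using sets.sigma_sets_subset[of "Collect positivity_set" "borel :: (real ^ 'n) measure"] positivity_set_measurable
    by auto
qed

text \<open>The test functions \<open>\<tau> (n u)\<close> with \<open>\<tau> t = s / (1 + s)\<close>, \<open>s = (max 0 (t - 1))\<^sup>2\<close>, increase to the
  indicator function of \<open>{u > 0}\<close> and are supported in \<open>{u \<ge> 1/n}\<close>.\<close>
lemma integral_positivity_set_eq_0:
  fixes r :: "real ^ 'n::finite \<Rightarrow> real"
  assumes U: "bounded U" "positivity_set U" and r: "integrable (lebesgue_on U) r"
    and test: "\<And>\<theta> \<theta>' K. \<lbrakk>C1 \<theta> \<theta>'; compact K; K \<subseteq> U; \<And>x. x \<notin> K \<Longrightarrow> \<theta> x = 0\<rbrakk> \<Longrightarrow>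
      (LINT x|lebesgue_on U. \<theta> x * r x) = 0"
    and B: "positivity_set B"
  shows "(LINT x|lebesgue_on U. indicator B x * r x) = 0"
proof -
  obtain u u' where u: "C1 u u'" "\<And>x. 0 \<le> u x" "B \<inter> U = {x. 0 < u x}"
    using positivity_set_Int[OF B U(2)] unfolding positivity_set_def by blast
  define s where "s n x = (max 0 (- 1 + real n * u x))\<^sup>2" for n x
  define \<theta> where "\<theta> n x = s n x / (1 + s n x)" for n x
  have s0: "0 \<le> s n x" for n x by (simp add: s_def)
  have C: "\<exists>\<theta>'. C1 (\<theta> n) \<theta>'" for n
  proof -
    have "\<exists>q'. (\<forall>t. ((\<lambda>t::real. (max 0 t)\<^sup>2 / (1 + (max 0 t)\<^sup>2)) has_real_derivative q' t) (at t)) \<and> continuous_on UNIV q'"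
    proof (intro exI conjI allI)
      have nz: "1 + (max 0 t)\<^sup>2 \<noteq> (0::real)" for t
        using zero_le_power2[of "max 0 t"] by linarith
      have "((\<lambda>t. 1 + (max 0 t)\<^sup>2) has_real_derivative 2 * max 0 t) (at t)" for t :: real
        using DERIV_add[OF DERIV_const has_real_derivative_max_0_sqr] by simp
      from DERIV_divide[OF has_real_derivative_max_0_sqr this nz]
      show "((\<lambda>t::real. (max 0 t)\<^sup>2 / (1 + (max 0 t)\<^sup>2)) has_real_derivative
        (2 * max 0 t * (1 + (max 0 t)\<^sup>2) - (max 0 t)\<^sup>2 * (2 * max 0 t)) / ((1 + (max 0 t)\<^sup>2) * (1 + (max 0 t)\<^sup>2))) (at t)" for t .
      show "continuous_on UNIV (\<lambda>t::real. (2 * max 0 t * (1 + (max 0 t)\<^sup>2) - (max 0 t)\<^sup>2 * (2 * max 0 t)) / ((1 + (max 0 t)\<^sup>2) * (1 + (max 0 t)\<^sup>2)))"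
        by (intro continuous_intros) (use nz in auto)
    qed
    then obtain q' where q': "\<And>t. ((\<lambda>t::real. (max 0 t)\<^sup>2 / (1 + (max 0 t)\<^sup>2)) has_real_derivative q' t) (at t)" "continuous_on UNIV q'"
      by blast
    have 1: "((\<lambda>t. - 1 + real n * t) has_real_derivative real n) (at t)" for t
      by (auto intro!: derivative_eq_intros)
    have "C1 (\<lambda>x. - 1 + real n * u x) (\<lambda>x. real n *\<^sub>R u' x)"
      by (rule C1_compose[OF u(1) 1]) auto
    from C1_compose[OF this q'] show ?thesis unfolding \<theta>_def s_def by blast
  qed
  have "(LINT x|lebesgue_on U. \<theta> n x * r x) = 0" for n
  proof -
    obtain \<theta>' where \<theta>': "C1 (\<theta> n) \<theta>'" using C by blast
    \<comment> \<open>Closed in the whole space, because \<open>u\<close> is continuous everywhere,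
      and contained in \<open>U\<close>, because \<open>u\<close> vanishes outside
      \<open>B \<inter> U\<close>; boundedness of \<open>U\<close> gives compactness.\<close>
    let ?K = "{x. 1 \<le> real n * u x}"
    have sub: "?K \<subseteq> U" 
    proof
      fix x assume "x \<in> ?K"
      then have "0 < real n * u x" by simp
      then have "0 < u x" using u(2)[of x] by (simp add: zero_less_mult_iff)
      then show "x \<in> U" using u(3) by auto
    qed
    have "closed ?K"
      by (intro closed_Collect_le continuous_intros C1_continuous[OF u(1)])
    then have "compact ?K" using sub U(1) bounded_subset compact_eq_bounded_closed by blast
    then show ?thesis
      by (rule test[OF \<theta>' _ sub]) (auto simp: \<theta>_def s_def)
  qed
  moreover have "(\<lambda>n. LINT x|lebesgue_on U. \<theta> n x * r x) \<longlonglongrightarrow> (LINT x|lebesgue_on U. indicator B x * r x)"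
  proof (rule integral_dominated_convergence[where w="\<lambda>x. norm (r x)"])
    have Um: "U \<in> sets lebesgue" using positivity_set_measurable[OF U(2)] by simp
    show "AE x in lebesgue_on U. (\<lambda>n. \<theta> n x * r x) \<longlonglongrightarrow> indicator B x * r x"
    proof (rule AE_I2)
      fix x assume "x \<in> space (lebesgue_on U)"
      then have xU: "x \<in> U" by simp
      have "(\<lambda>n. \<theta> n x) \<longlonglongrightarrow> indicator B x"
      proof (cases "x \<in> B")
        case True
        then have ux: "0 < u x" using xU u(3) by auto
        have "filterlim (\<lambda>n. - 1 + u x * real n) at_top sequentially"
          using ux by real_asymp
        then have "filterlim (\<lambda>n. (- 1 + real n * u x)) at_top sequentially" by (simp add: mult.commute)
        moreover have "((\<lambda>t::real. t\<^sup>2 / (1 + t\<^sup>2)) \<longlongrightarrow> 1) at_top" by real_asymp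
        ultimately have l: "(\<lambda>n. (- 1 + real n * u x)\<^sup>2 / (1 + (- 1 + real n * u x)\<^sup>2)) \<longlonglongrightarrow> 1"
          by (rule filterlim_compose[rotated])
        have "\<forall>\<^sub>F n in sequentially. 0 \<le> - 1 + real n * u x"
          using \<open>filterlim (\<lambda>n. (- 1 + real n * u x)) at_top sequentially\<close>
          unfolding filterlim_at_top by blast
        then have "\<forall>\<^sub>F n in sequentially. (- 1 + real n * u x)\<^sup>2 / (1 + (- 1 + real n * u x)\<^sup>2) = \<theta> n x"
          by eventually_elim (simp add: \<theta>_def s_def max_def)
        from Lim_transform_eventually[OF l this] show ?thesis using True by simp
      next
        case False
        then have "u x = 0" using u(2)[of x] u(3) xU by (auto simp: order.strict_iff_order)
        then show ?thesis using False by (simp add: \<theta>_def s_def)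
      qed
      then show "(\<lambda>n. \<theta> n x * r x) \<longlonglongrightarrow> indicator B x * r x" by (intro tendsto_intros)
    qed
    have "\<theta> n \<in> borel_measurable borel" for n
      using C[of n] C1_continuous by (blast intro: borel_measurable_continuous_onI)
    then have "\<theta> n \<in> borel_measurable (lebesgue_on U)" for n by (rule borel_imp_lebesgue_on)
    then show "(\<lambda>x. \<theta> n x * r x) \<in> borel_measurable (lebesgue_on U)" for n
      using r by (intro borel_measurable_times) simp_all
    have "indicator B \<in> borel_measurable (borel :: (real ^ 'n) measure)"
      using positivity_set_measurable[OF B] by simp
    then have "indicator B \<in> borel_measurable (lebesgue_on U)" by (rule borel_imp_lebesgue_on)
    then show "(\<lambda>x. indicator B x * r x) \<in> borel_measurable (lebesgue_on U)"
      using r by (intro borel_measurable_times) simp_all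
    show "AE x in lebesgue_on U. norm (\<theta> n x * r x) \<le> norm (r x)" for n
    proof (rule AE_I2)
      fix x
      have "0 \<le> \<theta> n x" "\<theta> n x \<le> 1" using s0[of n x] by (auto simp: \<theta>_def divide_le_eq_1)
      then show "norm (\<theta> n x * r x) \<le> norm (r x)" by (simp add: abs_mult mult_left_le_one_le)
    qed
  qed (use r in simp)
  ultimately show ?thesis by (simp add: LIMSEQ_const_iff)
qed

text \<open>The Borel sets over which \<open>r\<close> integrates to zero form a Dynkin system
  containing the intersection-stable generator of positivity sets, hence they are all Borel sets.
  Integrating over the sets where \<open>r\<close> has one sign then forces \<open>r\<close> to
  vanish.\<close>

lemma AE_eq_0_of_test_functions:
  fixes r :: "real ^ 'n::finite \<Rightarrow> real"
  assumes U: "bounded U" "positivity_set U" and r: "integrable (lebesgue_on U) r"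
    and test: "\<And>\<theta> \<theta>' K. \<lbrakk>C1 \<theta> \<theta>'; compact K; K \<subseteq> U; \<And>x. x \<notin> K \<Longrightarrow> \<theta> x = 0\<rbrakk> \<Longrightarrow>
      (LINT x|lebesgue_on U. \<theta> x * r x) = 0"
  shows "AE x in lebesgue_on U. r x = 0"
proof -
  let ?M = "lebesgue_on U"
  have Um: "U \<in> sets lebesgue" using positivity_set_measurable[OF U(2)] by simp
  have intB: "integrable ?M (\<lambda>x. indicator B x * r x)" if "B \<in> sets borel" for B
  proof (rule Bochner_Integration.integrable_bound[OF r])
    have "indicator B \<in> borel_measurable (borel :: (real ^ 'n) measure)" using that by simp
    then have "indicator B \<in> borel_measurable ?M" by (rule borel_imp_lebesgue_on)
    then show "(\<lambda>x. indicator B x * r x) \<in> borel_measurable ?M"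
      using r by (intro borel_measurable_times) simp_all
  qed (auto simp: indicator_def)
  have zero: "(LINT x|?M. indicator B x * r x) = 0" if "B \<in> sets borel" for B
  proof -
    have int0: "(LINT x|?M. r x) = 0"
      using integral_positivity_set_eq_0[OF U r test positivity_set_UNIV] by simp
    have "Int_stable (Collect (positivity_set :: (real ^ 'n) set \<Rightarrow> bool))"
      by (auto simp: Int_stable_def positivity_set_Int)
    moreover have "Collect positivity_set \<subseteq> Pow (UNIV :: (real ^ 'n) set)" by simp
    moreover have "B \<in> sigma_sets UNIV (Collect positivity_set)"
      using that by (simp add: borel_eq_sigma_positivity_sets)
    ultimately show ?thesis
    proof (induction rule: sigma_sets_induct_disjoint[consumes 3, case_names basic empty compl union])
      case (basic A)
      then show ?case by (intro integral_positivity_set_eq_0[OF U r test]) auto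
    next
      case (compl A)
      then have A: "A \<in> sets borel" by (simp add: borel_eq_sigma_positivity_sets)
      have "(LINT x|?M. indicator (UNIV - A) x * r x) = (LINT x|?M. r x - indicator A x * r x)"
        by (rule Bochner_Integration.integral_cong) (auto simp: indicator_def)
      then show ?case using compl int0 intB[OF A] r by simp
    next
      case (union A)
      then have A: "A i \<in> sets borel" for i by (simp add: borel_eq_sigma_positivity_sets image_subset_iff)
      have "(\<lambda>n. LINT x|?M. (\<Sum>i<n. indicator (A i) x * r x)) \<longlonglongrightarrow> (LINT x|?M. indicator (\<Union>i. A i) x * r x)"
      proof (rule integral_dominated_convergence[where w="\<lambda>x. norm (r x)"])
        have sum: "(\<Sum>i<n. indicator (A i) x * r x) = indicator (\<Union>i<n. A i) x * r x" for n x
          using union(1) by (subst indicator_UN_disjoint)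
            (auto simp: sum_distrib_right disjoint_family_on_def)
        show "AE x in ?M. (\<lambda>n. \<Sum>i<n. indicator (A i) x * r x) \<longlonglongrightarrow> indicator (\<Union>i. A i) x * r x"
          unfolding sum by (intro AE_I2 tendsto_intros LIMSEQ_indicator_UN)
        show "AE x in ?M. norm (\<Sum>i<n. indicator (A i) x * r x) \<le> norm (r x)" for n
          unfolding sum by (auto simp: indicator_def)
        show "(\<lambda>x. indicator (\<Union>i. A i) x * r x) \<in> borel_measurable ?M"
          using intB[of "\<Union>i. A i"] A by auto
        show "(\<lambda>x. \<Sum>i<n. indicator (A i) x * r x) \<in> borel_measurable ?M" for n
          using intB A by (intro borel_measurable_sum) auto
      qed (use r in simp)
      moreover have "(LINT x|?M. (\<Sum>i<n. indicator (A i) x * r x)) = 0" for n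
        using intB A union(3) by (subst Bochner_Integration.integral_sum) auto
      ultimately show ?case by (simp add: LIMSEQ_const_iff)
    qed simp_all
  qed
  \<comment> \<open>The sign sets of \<open>r\<close> are only Lebesgue measurable, while vanishing
    integrals are known over Borel sets; a Borel version \<open>r'\<close> supplies the
    sets.\<close>
  have "(\<lambda>x. indicator U x *\<^sub>R r x) \<in> borel_measurable lebesgue"
    using borel_measurable_restrict_space_iff[of U lebesgue r] borel_measurable_integrable[OF r] Um by simp
  then obtain r' where r': "r' \<in> borel_measurable lborel" "AE x in lborel. indicator U x *\<^sub>R r x = r' x"
    using completion_ex_borel_measurable_real by blast
  have r'm: "r' \<in> borel_measurable borel" using r'(1) by simp
  have "AE x in lebesgue. indicator U x *\<^sub>R r x = r' x"
    using r'(2) by (rule AE_completion)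
  then have ae: "AE x in ?M. r x = r' x"
    using Um by (subst AE_restrict_space_iff) (auto elim!: eventually_mono)
  have "AE x in ?M. indicator B x * r x = 0" if B: "B \<in> sets borel" and pos: "\<And>x. x \<in> B \<Longrightarrow> 0 \<le> c * r' x" and c: "c \<noteq> 0" for B c
  proof -
    have "(LINT x|?M. c * (indicator B x * r x)) = 0" using zero[OF B] by simp
    moreover have "AE x in ?M. 0 \<le> c * (indicator B x * r x)"
      using ae by eventually_elim (use pos in \<open>auto simp: indicator_def\<close>)
    moreover have "integrable ?M (\<lambda>x. c * (indicator B x * r x))" using intB[OF B] by simp
    ultimately have "AE x in ?M. c * (indicator B x * r x) = 0"
      using integral_nonneg_eq_0_iff_AE by blast
    then show ?thesis using c by simp
  qed note * = this
  have "AE x in ?M. indicator {x. 0 \<le> r' x} x * r x = 0"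
    by (rule *[where c=1]) (use r'm in auto)
  moreover have "AE x in ?M. indicator {x. r' x \<le> 0} x * r x = 0"
    by (rule *[where c="-1"]) (use r'm in auto)
  ultimately show ?thesis
    by eventually_elim (auto simp: indicator_def split: if_splits)
qed

text \<open>Both gradients have the same integrals against test functions; the vanishing lemma is
  scalar and is applied to each of the finitely many real coordinates of the difference.\<close>

lemma weak_gradient_unique:
  fixes u :: "real ^ 'n::finite \<Rightarrow> 'b::euclidean_space"
  assumes U: "bounded U" "positivity_set U"
    and g: "has_weak_gradient_on u g U" "integrable (lebesgue_on U) g"
    and h: "has_weak_gradient_on u h U" "integrable (lebesgue_on U) h"
  shows "AE x in lebesgue_on U. g x = h x"
proof -
  have *: "AE x in lebesgue_on U. (g x - h x) $ i \<bullet> b = 0" for i b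
  proof (rule AE_eq_0_of_test_functions[OF U])
    have intd: "integrable (lebesgue_on U) (\<lambda>x. g x - h x)" using g h by simp
    then show "integrable (lebesgue_on U) (\<lambda>x. (g x - h x) $ i \<bullet> b)"
      by (intro integrable_inner_left integrable_bounded_linear[OF bounded_linear_vec_nth])
    fix \<theta> :: "real ^ 'n \<Rightarrow> real" and \<theta>' K assume t: "C1 \<theta> \<theta>'" "compact K" "K \<subseteq> U" "\<And>x. x \<notin> K \<Longrightarrow> \<theta> x = 0"
    obtain B where B: "\<And>x. \<bar>\<theta> x\<bar> \<le> B"
      using C1_compact_support_imp_pwC1[OF t(1,2,4)] unfolding pwC1_def by blast
    have int: "integrable (lebesgue_on U) (\<lambda>x. \<theta> x *\<^sub>R w x $ i)"
      if w: "integrable (lebesgue_on U) w" for w :: "real ^ 'n \<Rightarrow> 'b ^ 'n"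
    proof (rule Bochner_Integration.integrable_bound)
      show "integrable (lebesgue_on U) (\<lambda>x. B * norm (w x))" using w by simp
      have "\<theta> \<in> borel_measurable borel" using C1_continuous[OF t(1)] by (rule borel_measurable_continuous_onI)
      then have "\<theta> \<in> borel_measurable (lebesgue_on U)" by (rule borel_imp_lebesgue_on)
      then show "(\<lambda>x. \<theta> x *\<^sub>R w x $ i) \<in> borel_measurable (lebesgue_on U)"
        using w by (intro borel_measurable_scaleR borel_measurable_vec_nth) simp_all
      show "AE x in lebesgue_on U. norm (\<theta> x *\<^sub>R w x $ i) \<le> norm (B * norm (w x))"
      proof (rule AE_I2)
        fix x
        have "norm (\<theta> x *\<^sub>R w x $ i) \<le> B * norm (w x)"
          using B[of x] Finite_Cartesian_Product.norm_nth_le[of "w x" i] by (auto intro!: mult_mono)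
        then show "norm (\<theta> x *\<^sub>R w x $ i) \<le> norm (B * norm (w x))" by simp
      qed
    qed
    have "(LINT x|lebesgue_on U. \<theta> x *\<^sub>R g x $ i) = (LINT x|lebesgue_on U. \<theta> x *\<^sub>R h x $ i)"
      using has_weak_gradient_on_test[OF g(1) t, of i] has_weak_gradient_on_test[OF h(1) t, of i] by simp
    then have z: "(LINT x|lebesgue_on U. \<theta> x *\<^sub>R g x $ i - \<theta> x *\<^sub>R h x $ i) = 0"
      using int[OF g(2)] int[OF h(2)] by simp
    have "(LINT x|lebesgue_on U. (\<theta> x *\<^sub>R g x $ i - \<theta> x *\<^sub>R h x $ i) \<bullet> b) = 0"
      using int[OF g(2)] int[OF h(2)] z by (subst integral_inner_left) auto
    then show "(LINT x|lebesgue_on U. \<theta> x * ((g x - h x) $ i \<bullet> b)) = 0"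
      by (simp add: inner_diff_left algebra_simps)
  qed
  have 1: "AE x in lebesgue_on U. \<forall>b\<in>Basis. (g x - h x) $ i \<bullet> b = 0" for i
    by (subst AE_finite_all[OF finite_Basis], rule ballI, rule *)
  have "AE x in lebesgue_on U. \<forall>i\<in>UNIV. \<forall>b\<in>Basis. (g x - h x) $ i \<bullet> b = 0"
    by (subst AE_finite_all[OF finite], rule ballI, rule 1)
  then show ?thesis
  proof eventually_elim
    case (elim x)
    have "(g x - h x) $ i = 0" for i
    proof (rule euclidean_eqI)
      fix b :: 'b assume "b \<in> Basis"
      then show "(g x - h x) $ i \<bullet> b = 0 \<bullet> b" using elim by (metis UNIV_I inner_zero_left)
    qed
    then have "g x - h x = 0" by (metis vec_eq_iff zero_index)
    then show ?case by (metis right_minus_eq)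
  qed
qed

section \<open>Gradients of periodic functions\<close>

lemma Omega_iff: "x \<in> Omega \<longleftrightarrow> (\<forall>i. 0 \<le> x $ i \<and> x $ i \<le> 2 * pi)"
  by (simp add: Omega_def mem_box_cart)

lemma interior_Omega: "interior Omega = box 0 (\<chi> i. 2 * pi)"
  by (simp add: Omega_def)

lemma interior_Omega_iff: "x \<in> interior Omega \<longleftrightarrow> (\<forall>i. 0 < x $ i \<and> x $ i < 2 * pi)"
  by (simp add: interior_Omega mem_box_cart)

lemma Omega_lmeasurable [simp]: "Omega \<in> lmeasurable"
  by (simp add: Omega_def)

lemma Omega_sets [simp]: "Omega \<in> sets lebesgue"
  by (simp add: fmeasurableD)

text \<open>Indexed by integer functions on a finite type, hence a countable family: unions over all
  lattice translates preserve null sets and measurability.\<close>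

definition lattice_vec :: "('n::finite \<Rightarrow> int) \<Rightarrow> real ^ 'n" where
  "lattice_vec z = (\<chi> i. 2 * pi * of_int (z i))"

lemma lattice_vec_nth [simp]: "lattice_vec z $ i = 2 * pi * of_int (z i)"
  by (simp add: lattice_vec_def)

lemma wrap_nth [simp]: "wrap x $ i = 2 * pi * frac (x $ i / (2 * pi))"
  by (simp add: wrap_def)

lemma wrap_in_Omega: "wrap x \<in> Omega"
  by (auto simp: Omega_iff mult_le_cancel_left1 frac_lt_1 less_imp_le)

lemma wrap_eq_minus_lattice: "\<exists>z. wrap x = x - lattice_vec z"
proof
  show "wrap x = x - lattice_vec (\<lambda>i. \<lfloor>x $ i / (2 * pi)\<rfloor>)"
    by (simp add: vec_eq_iff frac_def right_diff_distrib)
qed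

lemma wrap_add_lattice [simp]: "wrap (x + lattice_vec z) = wrap x"
proof (simp add: vec_eq_iff, rule allI)
  fix i
  have "(x $ i + 2 * pi * of_int (z i)) / (2 * pi) = x $ i / (2 * pi) + of_int (z i)"
    by (simp add: add_divide_distrib)
  then show "frac ((x $ i + 2 * pi * of_int (z i)) / (2 * pi)) = frac (x $ i / (2 * pi))"
    by simp
qed

lemma wrap_minus_lattice [simp]: "wrap (x - lattice_vec z) = wrap x"
  using wrap_add_lattice[of "x - lattice_vec z" z] by simp

lemma wrap_wrap [simp]: "wrap (wrap x) = wrap x"
  using wrap_eq_minus_lattice[of x] wrap_minus_lattice by metis

lemma wrap_interior: "x \<in> interior Omega \<Longrightarrow> wrap x = x"
proof -
  assume "x \<in> interior Omega"
  then have x: "0 < x $ i" "x $ i < 2 * pi" for i by (auto simp: interior_Omega_iff)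
  have "frac (x $ i / (2 * pi)) = x $ i / (2 * pi)" for i
    using x[of i] by (simp add: frac_eq)
  then show "wrap x = x" by (simp add: vec_eq_iff)
qed

text \<open>A boundary point of the cell has a coordinate 0 or 2 pi, and wrapping turns this
  coordinate into 0. Hence functions vanishing off \<open>interior Omega\<close> are compatible with
  wrapping.\<close>

lemma wrap_interior_iff: "x \<in> Omega \<Longrightarrow> wrap x \<in> interior Omega \<longleftrightarrow> x \<in> interior Omega"
proof
  assume x: "x \<in> Omega" and w: "wrap x \<in> interior Omega"
  show "x \<in> interior Omega"
    unfolding interior_Omega_iff
  proof
    fix i
    have "frac (x $ i / (2 * pi)) \<noteq> 0" 
    proof
      assume z: "frac (x $ i / (2 * pi)) = 0"
      have "0 < wrap x $ i" using w unfolding interior_Omega_iff by blast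
      then show False unfolding wrap_nth z by simp
    qed
    then have "x $ i \<noteq> 0" "x $ i \<noteq> 2 * pi" by auto
    then show "0 < x $ i \<and> x $ i < 2 * pi" using x by (auto simp: Omega_iff order.strict_iff_order)
  qed
qed (simp add: wrap_interior)

lemma negligible_Omega_minus_interior: "negligible (Omega - interior Omega :: (real ^ 'n::finite) set)"
proof -
  have "frontier (Omega :: (real ^ 'n) set) = Omega - interior Omega"
    by (simp add: frontier_def Omega_def)
  then show ?thesis using negligible_convex_frontier[of "Omega :: (real ^ 'n) set"] by (simp add: Omega_def)
qed

lemma AE_Omega_interior: "AE x in lebesgue_on (Omega :: (real ^ 'n::finite) set). x \<in> interior Omega"
proof (subst AE_restrict_space_iff)
  show "AE x in lebesgue. x \<in> Omega \<longrightarrow> x \<in> interior (Omega :: (real ^ 'n) set)"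
    by (rule AE_I'[of "Omega - interior Omega"])
       (use negligible_Omega_minus_interior in \<open>auto simp: negligible_iff_null_sets\<close>)
qed simp

text \<open>The bad points lie in the union of the countably many lattice translates of one null
  set.\<close>

lemma AE_wrap:
  fixes P :: "real ^ 'n::finite \<Rightarrow> bool"
  assumes "AE x in lebesgue_on Omega. P x"
  shows "AE x in lebesgue. P (wrap x)"
proof -
  have ae: "AE x in lebesgue. x \<in> Omega \<longrightarrow> P x" using assms by (simp add: AE_restrict_space_iff)
  obtain N where N: "\<And>x. x \<in> space lebesgue - N \<Longrightarrow> x \<in> Omega \<longrightarrow> P x" "N \<in> null_sets lebesgue"
    by (rule AE_E3[OF ae]) (rule that)
  have "negligible (\<Union>z. (+) (lattice_vec z) ` N)"
    using N(2) by (intro negligible_countable_Union) (auto simp: negligible_iff_null_sets[symmetric] intro: negligible_translation)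
  moreover have "{x. \<not> P (wrap x)} \<subseteq> (\<Union>z. (+) (lattice_vec z) ` N)"
  proof
    fix x assume "x \<in> {x. \<not> P (wrap x)}"
    then have "wrap x \<in> N" using N(1)[of "wrap x"] wrap_in_Omega by auto
    moreover obtain z where "wrap x = x - lattice_vec z" using wrap_eq_minus_lattice by blast
    then have "x = lattice_vec z + wrap x" by simp
    ultimately show "x \<in> (\<Union>z. (+) (lattice_vec z) ` N)" by blast
  qed
  ultimately show ?thesis
    by (intro AE_I'[of "\<Union>z. (+) (lattice_vec z) ` N"]) (auto simp: negligible_iff_null_sets)
qed

section \<open>Square integrable functions\<close>

lemma lebesgue_on_subset_integrable:
  fixes f :: "real ^ 'n::finite \<Rightarrow> 'b::euclidean_space"
  assumes "integrable (lebesgue_on S) f" "T \<subseteq> S" "T \<in> sets lebesgue" "S \<in> sets lebesgue"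
  shows "integrable (lebesgue_on T) f"
proof -
  have "set_integrable lebesgue S f" using assms by (simp add: integrable_restrict_space set_integrable_def)
  then have "set_integrable lebesgue T f" using assms by (intro set_integrable_subset[of _ S f T])
  then show ?thesis using assms by (simp add: integrable_restrict_space set_integrable_def)
qed

lemma square_integrable_integrable:
  fixes f :: "real ^ 'n::finite \<Rightarrow> 'b::euclidean_space"
  assumes "square_integrable_on f S" "S \<in> lmeasurable"
  shows "integrable (lebesgue_on S) f"
proof -
  have "integrable (lebesgue_on S) (\<lambda>x. 1 + (norm (f x))\<^sup>2)"
    using assms integrable_bounded_lebesgue_on[of "\<lambda>_. 1::real" S 1] by (simp add: square_integrable_on_def)
  then show ?thesis
  proof (rule Bochner_Integration.integrable_bound)
    show "AE x in lebesgue_on S. norm (f x) \<le> norm (1 + (norm (f x))\<^sup>2)"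
    proof (rule AE_I2)
      fix x
      have "0 \<le> (norm (f x) - 1)\<^sup>2" by simp
      then have "2 * norm (f x) \<le> 1 + (norm (f x))\<^sup>2" by (simp add: power2_diff)
      then show "norm (f x) \<le> norm (1 + (norm (f x))\<^sup>2)" by simp (smt (verit) norm_ge_zero zero_le_power2)
    qed
  qed (use assms in \<open>auto simp: square_integrable_on_def\<close>)
qed

lemma square_integrable_add:
  fixes f g :: "real ^ 'n::finite \<Rightarrow> 'b::euclidean_space"
  assumes "square_integrable_on f S" "square_integrable_on g S"
  shows "square_integrable_on (\<lambda>x. f x + g x) S"
  unfolding square_integrable_on_def
proof
  show m: "(\<lambda>x. f x + g x) \<in> borel_measurable (lebesgue_on S)"
    using assms by (intro borel_measurable_add) (simp_all add: square_integrable_on_def)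
  have "integrable (lebesgue_on S) (\<lambda>x. 2 * (norm (f x))\<^sup>2 + 2 * (norm (g x))\<^sup>2)"
    using assms by (simp add: square_integrable_on_def)
  then show "integrable (lebesgue_on S) (\<lambda>x. (norm (f x + g x))\<^sup>2)"
  proof (rule Bochner_Integration.integrable_bound)
    show "AE x in lebesgue_on S. norm ((norm (f x + g x))\<^sup>2) \<le> norm (2 * (norm (f x))\<^sup>2 + 2 * (norm (g x))\<^sup>2)"
    proof (rule AE_I2)
      fix x
      have "(norm (f x + g x))\<^sup>2 \<le> (norm (f x) + norm (g x))\<^sup>2" by (simp add: norm_triangle_ineq power_mono)
      also have "\<dots> \<le> 2 * (norm (f x))\<^sup>2 + 2 * (norm (g x))\<^sup>2" using sum_squares_bound[of "norm (f x)" "norm (g x)"] by (simp add: power2_sum)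
      finally show "norm ((norm (f x + g x))\<^sup>2) \<le> norm (2 * (norm (f x))\<^sup>2 + 2 * (norm (g x))\<^sup>2)" by simp
    qed
  qed (use m in measurable)
qed

lemma square_integrable_bound:
  fixes f :: "real ^ 'n::finite \<Rightarrow> 'b::euclidean_space" and g :: "real ^ 'n \<Rightarrow> 'c::euclidean_space"
  assumes "square_integrable_on f S" "g \<in> borel_measurable (lebesgue_on S)" "\<And>x. x \<in> S \<Longrightarrow> norm (g x) \<le> B * norm (f x)"
  shows "square_integrable_on g S"
  unfolding square_integrable_on_def
proof
  show "g \<in> borel_measurable (lebesgue_on S)" by fact
  have "integrable (lebesgue_on S) (\<lambda>x. B\<^sup>2 * (norm (f x))\<^sup>2)"
    using assms by (simp add: square_integrable_on_def)
  then show "integrable (lebesgue_on S) (\<lambda>x. (norm (g x))\<^sup>2)"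
  proof (rule Bochner_Integration.integrable_bound)
    show "AE x in lebesgue_on S. norm ((norm (g x))\<^sup>2) \<le> norm (B\<^sup>2 * (norm (f x))\<^sup>2)"
      using assms(3) by (auto intro!: AE_I2 simp: power_mult_distrib[symmetric] intro: power_mono)
  qed (use assms in measurable)
qed

text \<open>Carries the gradient explicitly, since \<open>grad w\<close> is an arbitrary choice and
  does not respect sums or products pointwise. The weak gradient inside the cell follows from that
  of the periodic extension. Results return to \<open>grad\<close>, almost everywhere, through
  \<open>periodic_gradient_imp_H1P\<close>.\<close>

definition periodic_gradient :: "(real ^ 'n::finite \<Rightarrow> complex) \<Rightarrow> (real ^ 'n \<Rightarrow> complex ^ 'n) \<Rightarrow> bool" where
  "periodic_gradient w g \<longleftrightarrow> square_integrable_on w Omega \<and> square_integrable_on g Omega \<and>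
     has_weak_gradient_on (w \<circ> wrap) (g \<circ> wrap) UNIV"

lemma H1P_periodic_gradient:
  assumes "w \<in> H1P"
  shows "periodic_gradient w (grad w)"
proof -
  have "square_integrable_on w Omega" "has_weak_gradient_on (w \<circ> wrap) (grad w \<circ> wrap) UNIV"
    "\<exists>g. square_integrable_on g Omega \<and> has_weak_gradient_on w g (interior Omega)"
    using assms by (auto simp: H1P_def H1_def)
  moreover from someI_ex[OF this(3)] have "square_integrable_on (grad w) Omega"
    unfolding grad_def by blast
  ultimately show ?thesis by (simp add: periodic_gradient_def)
qed

text \<open>Wrapping is the identity in the open cell, so for test functions supported there the
  integral identity on the whole space is the one on the cell.\<close>

lemma periodic_gradient_interior:
  assumes "periodic_gradient w g"
  shows "has_weak_gradient_on w g (interior (Omega :: (real ^ 'n::finite) set))"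
  unfolding has_weak_gradient_on_def
proof (intro conjI allI impI)
  have wg: "has_weak_gradient_on (w \<circ> wrap) (g \<circ> wrap) UNIV" using assms by (simp add: periodic_gradient_def)
  {
    fix K :: "(real ^ 'n) set" assume K: "compact K \<and> K \<subseteq> interior Omega"
    then have "integrable (lebesgue_on K) (w \<circ> wrap)" "integrable (lebesgue_on K) (g \<circ> wrap)"
      using wg by (auto simp: has_weak_gradient_on_def)
    moreover have "wrap x = x" if "x \<in> K" for x using K that wrap_interior by blast
    ultimately show "integrable (lebesgue_on K) w" "integrable (lebesgue_on K) g"
      using Bochner_Integration.integrable_cong[of "lebesgue_on K" "lebesgue_on K" "w \<circ> wrap" w]
        Bochner_Integration.integrable_cong[of "lebesgue_on K" "lebesgue_on K" "g \<circ> wrap" g] by simp_all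
  }
  fix \<theta> :: "real ^ 'n \<Rightarrow> real" and \<theta>' i
  let ?K = "closure {x. \<theta> x \<noteq> 0}"
  assume *: "(\<forall>x. (\<theta> has_derivative (\<lambda>h. \<theta>' x \<bullet> h)) (at x)) \<and> continuous_on UNIV \<theta>' \<and>
     compact ?K \<and> ?K \<subseteq> interior Omega"
  then have C: "C1 \<theta> \<theta>'" by (simp add: C1_def)
  have z: "\<theta> x = 0" if "x \<notin> ?K" for x using that closure_subset[of "{x. \<theta> x \<noteq> 0}"] by auto
  have z': "\<theta>' x = 0" if "x \<notin> ?K" for x by (rule C1_zero_outside[where S="?K", OF C z closed_closure that])
  have t: "(LINT x|lebesgue_on UNIV. \<theta>' x $ i *\<^sub>R (w \<circ> wrap) x) = - (LINT x|lebesgue_on UNIV. \<theta> x *\<^sub>R (g \<circ> wrap) x $ i)"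
    by (rule has_weak_gradient_on_test[OF wg C, where K="?K"]; (rule z | use * in blast))
  have e: "(LINT x|lebesgue_on (interior Omega). f x) = (LINT x|lebesgue_on UNIV. h x)"
    if "\<And>x. x \<notin> ?K \<Longrightarrow> h x = 0" "\<And>x. x \<in> interior Omega \<Longrightarrow> f x = h x" for f h :: "real ^ 'n \<Rightarrow> complex"
  proof -
    have "(LINT x|lebesgue_on (interior Omega). f x) = (LINT x|lebesgue_on (interior Omega). h x)"
      by (rule Bochner_Integration.integral_cong) (use that in auto)
    also have "\<dots> = (LINT x|lebesgue. h x)"
      by (rule integral_lebesgue_on_support) (use * that in auto)
    finally show ?thesis by (simp add: lebesgue_on_UNIV_eq)
  qed
  have "(LINT x|lebesgue_on (interior Omega). \<theta>' x $ i *\<^sub>R w x) = (LINT x|lebesgue_on UNIV. \<theta>' x $ i *\<^sub>R (w \<circ> wrap) x)"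
  proof (rule e)
    show "\<theta>' x $ i *\<^sub>R (w \<circ> wrap) x = 0" if "x \<notin> ?K" for x
      using z'[OF that] by simp
    show "\<theta>' x $ i *\<^sub>R w x = \<theta>' x $ i *\<^sub>R (w \<circ> wrap) x" if "x \<in> interior Omega" for x
      using wrap_interior[OF that] by simp
  qed
  moreover have "(LINT x|lebesgue_on (interior Omega). \<theta> x *\<^sub>R g x $ i) = (LINT x|lebesgue_on UNIV. \<theta> x *\<^sub>R (g \<circ> wrap) x $ i)"
  proof (rule e)
    show "\<theta> x *\<^sub>R (g \<circ> wrap) x $ i = 0" if "x \<notin> ?K" for x
      using z[OF that] by simp
    show "\<theta> x *\<^sub>R g x $ i = \<theta> x *\<^sub>R (g \<circ> wrap) x $ i" if "x \<in> interior Omega" for x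
      using wrap_interior[OF that] by simp
  qed
  ultimately show "(LINT x|lebesgue_on (interior Omega). \<theta>' x $ i *\<^sub>R w x) = - (LINT x|lebesgue_on (interior Omega). \<theta> x *\<^sub>R g x $ i)"
    using t by simp
qed

lemma has_weak_gradient_on_cong_AE:
  fixes u :: "real ^ 'n::finite \<Rightarrow> 'b::euclidean_space"
  assumes wg: "has_weak_gradient_on u g UNIV" and h: "h \<in> borel_measurable lebesgue" "AE x in lebesgue. h x = g x"
  shows "has_weak_gradient_on u h UNIV"
proof -
  have li: "locally_integrable u" "locally_integrable g"
    using has_weak_gradient_on_UNIV_locally_integrable[OF wg] by auto
  note gm = locally_integrable_measurable[OF li(2)]
  have "locally_integrable h"
    unfolding locally_integrable_def
  proof (intro allI impI)
    fix K :: "(real ^ 'n) set" assume K: "compact K"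
    then have "K \<in> sets lebesgue" by (simp add: fmeasurableD lmeasurable_compact)
    then have "AE x in lebesgue_on K. h x = g x" using h(2) by (subst AE_restrict_space_iff) (auto elim: eventually_mono)
    moreover have "integrable (lebesgue_on K) g" using li(2) K by (simp add: locally_integrable_def)
    ultimately show "integrable (lebesgue_on K) h"
      using h(1) gm by (subst integrable_cong_AE[of h _ g]) (auto intro: measurable_restrict_space1)
  qed
  then show ?thesis
  proof (rule has_weak_gradient_on_UNIV_I[OF li(1)])
    fix \<theta> :: "real ^ 'n \<Rightarrow> real" and \<theta>' i R
    assume th: "pwC1 \<theta> \<theta>'" and R: "\<And>x. R < norm x \<Longrightarrow> \<theta> x = 0"
    have tm: "\<theta> \<in> borel_measurable lebesgue" using pwC1_borel_measurable[OF th] by (simp add: measurable_completion)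
    have "(LINT x|lebesgue. \<theta> x *\<^sub>R g x $ i) = (LINT x|lebesgue. \<theta> x *\<^sub>R h x $ i)"
    proof (rule integral_cong_AE)
      show "AE x in lebesgue. \<theta> x *\<^sub>R g x $ i = \<theta> x *\<^sub>R h x $ i" using h(2) by eventually_elim simp
    qed (intro borel_measurable_scaleR borel_measurable_vec_nth tm gm h)+
    then show "(LINT x|lebesgue. \<theta>' x $ i *\<^sub>R u x) = - (LINT x|lebesgue. \<theta> x *\<^sub>R h x $ i)"
      using weak_gradient_test_pwC1[OF wg th R] by simp
  qed
qed

text \<open>Composing a Lebesgue measurable function with a Borel map may destroy measurability.
  Here the preimage is a countable union of lattice translates of a Lebesgue set, and translations
  preserve those.\<close>

lemma measurable_comp_wrap:
  fixes h :: "real ^ 'n::finite \<Rightarrow> 'b::euclidean_space"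
  assumes "h \<in> borel_measurable (lebesgue_on Omega)"
  shows "h \<circ> wrap \<in> borel_measurable lebesgue"
proof -
  have wm: "(wrap :: real ^ 'n \<Rightarrow> _) \<in> borel_measurable borel"
    unfolding wrap_def frac_def by (intro borel_measurable_vec_lambda) measurable
  have "(h \<circ> wrap) -` A \<in> sets lebesgue" if A: "A \<in> sets borel" for A
  proof -
    \<comment> \<open>The fixed points of \<open>wrap\<close> form the half-open cell; restricting
      to them excludes boundary points of \<open>Omega\<close> whose values under \<open>h\<close>
      never occur in \<open>h \<circ> wrap\<close>.\<close>
    let ?C = "{x \<in> Omega. h x \<in> A} \<inter> {x. wrap x = x}"
    have "h -` A \<inter> space (lebesgue_on Omega) \<in> sets (lebesgue_on Omega)"
      using assms A by (rule measurable_sets)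
    moreover have "h -` A \<inter> space (lebesgue_on Omega) = {x \<in> Omega. h x \<in> A}" by auto
    ultimately have "{x \<in> Omega. h x \<in> A} \<in> sets lebesgue"
      by (simp add: sets_restrict_space_iff)
    moreover have "{x. wrap x = (x :: real ^ 'n)} \<in> sets borel" using wm by measurable
    ultimately have C: "?C \<in> sets lebesgue" by (intro sets.Int) auto
    have "(h \<circ> wrap) -` A = (\<Union>z. (+) (lattice_vec z) ` ?C)"
    proof (intro set_eqI iffI)
      fix x assume x: "x \<in> (h \<circ> wrap) -` A"
      obtain z where "wrap x = x - lattice_vec z" using wrap_eq_minus_lattice by blast
      then have "x = lattice_vec z + wrap x" by simp
      moreover have "wrap x \<in> ?C" using x wrap_in_Omega by simp
      ultimately show "x \<in> (\<Union>z. (+) (lattice_vec z) ` ?C)" by blast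
    next
      fix x assume "x \<in> (\<Union>z. (+) (lattice_vec z) ` ?C)"
      then obtain z y where "x = lattice_vec z + y" "y \<in> ?C" by blast
      then show "x \<in> (h \<circ> wrap) -` A" using wrap_add_lattice[of y z] by (simp add: add.commute)
    qed
    also have "\<dots> \<in> sets lebesgue"
      by (rule sets.countable_UN) (use lebesgue_sets_translation[OF C] in auto)
    finally show ?thesis .
  qed
  then show ?thesis by (intro measurableI) auto
qed

lemma weak_gradient_Omega_unique:
  fixes w :: "real ^ 'n::finite \<Rightarrow> complex"
  assumes "has_weak_gradient_on w g (interior Omega)" "square_integrable_on g Omega"
    and "has_weak_gradient_on w h (interior Omega)" "square_integrable_on h Omega"
  shows "AE x in lebesgue_on Omega. g x = h x"
proof -
  let ?U = "interior Omega :: (real ^ 'n) set"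
  have "AE x in lebesgue_on ?U. g x = h x"
  proof (rule weak_gradient_unique[OF _ _ assms(1) _ assms(3)])
    show "bounded ?U" "positivity_set ?U" by (simp_all add: interior_Omega bounded_box positivity_set_box)
    show "integrable (lebesgue_on ?U) g" "integrable (lebesgue_on ?U) h"
      by (rule lebesgue_on_subset_integrable[where S=Omega]; use assms interior_subset in \<open>auto intro: square_integrable_integrable\<close>)+
  qed
  then have "AE x in lebesgue. x \<in> ?U \<longrightarrow> g x = h x"
    by (subst (asm) AE_restrict_space_iff) auto
  then have "AE x in lebesgue_on Omega. x \<in> ?U \<longrightarrow> g x = h x"
    by (subst AE_restrict_space_iff) (auto elim: eventually_mono)
  with AE_Omega_interior show ?thesis by eventually_elim simp
qed

text \<open>Uniqueness inside the cell identifies the chosen \<open>grad w\<close> with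
  \<open>g\<close> up to a null set. The lattice translates of this null set are null, so the
  periodic extension of \<open>grad w\<close> is a weak gradient on the whole space as well.\<close>

lemma periodic_gradient_imp_H1P:
  fixes w :: "real ^ 'n::finite \<Rightarrow> complex"
  assumes pg: "periodic_gradient w g"
  shows "w \<in> H1P" "AE x in lebesgue_on Omega. grad w x = g x"
proof -
  have g: "square_integrable_on g Omega \<and> has_weak_gradient_on w g (interior Omega)"
    using pg periodic_gradient_interior[OF pg] by (simp add: periodic_gradient_def)
  from someI[of "\<lambda>g. square_integrable_on g Omega \<and> has_weak_gradient_on w g (interior Omega)", OF this]
  have gw: "square_integrable_on (grad w) Omega" "has_weak_gradient_on w (grad w) (interior Omega)"
    unfolding grad_def by blast+
  show ae: "AE x in lebesgue_on Omega. grad w x = g x"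
    by (rule weak_gradient_Omega_unique[OF gw(2,1)]) (use g in auto)
  have "has_weak_gradient_on (w \<circ> wrap) (grad w \<circ> wrap) UNIV"
  proof (rule has_weak_gradient_on_cong_AE)
    show "has_weak_gradient_on (w \<circ> wrap) (g \<circ> wrap) UNIV" using pg by (simp add: periodic_gradient_def)
    show "grad w \<circ> wrap \<in> borel_measurable lebesgue"
      using gw(1) by (intro measurable_comp_wrap) (simp add: square_integrable_on_def)
    show "AE x in lebesgue. (grad w \<circ> wrap) x = (g \<circ> wrap) x" using AE_wrap[OF ae] by simp
  qed
  then show "w \<in> H1P"
    using pg g by (auto simp: H1P_def H1_def periodic_gradient_def)
qed

section \<open>Algebra of periodic gradients\<close>

lemma periodic_gradient_add:
  assumes "periodic_gradient u g" "periodic_gradient v h"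
  shows "periodic_gradient (\<lambda>x. u x + v x) (\<lambda>x. g x + h x)"
  using assms has_weak_gradient_on_add[of "u \<circ> wrap" "g \<circ> wrap" "v \<circ> wrap" "h \<circ> wrap"]
  by (auto simp: periodic_gradient_def o_def intro!: square_integrable_add)

lemma periodic_gradient_cmult:
  fixes c :: complex
  assumes "periodic_gradient u g"
  shows "periodic_gradient (\<lambda>x. c * u x) (\<lambda>x. c *s g x)"
proof -
  have "has_weak_gradient_on (\<lambda>x. c * (u \<circ> wrap) x) (\<lambda>x. \<chi> i. c * (g \<circ> wrap) x $ i) UNIV"
    by (rule has_weak_gradient_on_linear) (use assms in \<open>auto simp: periodic_gradient_def o_def bounded_linear_mult_right\<close>)
  moreover have n: "norm (c *s v) \<le> norm c * norm v" for v :: "complex ^ 'n"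
    by (simp add: norm_vec_def norm_mult L2_set_right_distrib)
  have "square_integrable_on (\<lambda>x. c * u x) Omega"
    by (rule square_integrable_bound[where B="norm c" and f=u])
       (use assms in \<open>auto simp: periodic_gradient_def square_integrable_on_def norm_mult\<close>)
  moreover have "square_integrable_on (\<lambda>x. c *s g x) Omega"
  proof (rule square_integrable_bound[where B="norm c" and f=g])
    have "g \<in> borel_measurable (lebesgue_on Omega)" using assms by (simp add: periodic_gradient_def square_integrable_on_def)
    then show "(\<lambda>x. c *s g x) \<in> borel_measurable (lebesgue_on Omega)"
      unfolding vector_scalar_mult_def by (intro borel_measurable_vec_lambda borel_measurable_times borel_measurable_vec_nth) auto
  qed (use assms n in \<open>auto simp: periodic_gradient_def\<close>)
  ultimately show ?thesis by (simp add: periodic_gradient_def o_def vector_scalar_mult_def)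
qed

lemma periodic_gradient_mult:
  fixes f :: "real ^ 'n::finite \<Rightarrow> real"
  assumes u: "periodic_gradient u g" and f: "pwC1 f f'" "\<And>x. f (wrap x) = f x" "\<And>x. f' (wrap x) = f' x"
  shows "periodic_gradient (\<lambda>x. f x *\<^sub>R u x) (\<lambda>x. f x *\<^sub>R g x + outer (f' x) (u x))"
proof -
  have "has_weak_gradient_on (\<lambda>x. f x *\<^sub>R (u \<circ> wrap) x) (\<lambda>x. f x *\<^sub>R (g \<circ> wrap) x + outer (f' x) ((u \<circ> wrap) x)) UNIV"
    by (rule has_weak_gradient_on_mult[OF _ f(1)]) (use u in \<open>simp add: periodic_gradient_def o_def\<close>)
  moreover obtain L where L: "\<And>x. \<bar>f x\<bar> \<le> L" "\<And>x. norm (f' x) \<le> L" and meas: "f' \<in> borel_measurable borel"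
    using f unfolding pwC1_def by blast
  have fm: "f \<in> borel_measurable (lebesgue_on Omega)" "f' \<in> borel_measurable (lebesgue_on Omega)"
    using pwC1_borel_measurable[OF f(1)] meas by (auto intro: borel_imp_lebesgue_on)
  have um: "u \<in> borel_measurable (lebesgue_on Omega)" "g \<in> borel_measurable (lebesgue_on Omega)"
    "square_integrable_on u Omega" "square_integrable_on g Omega"
    using u by (auto simp: periodic_gradient_def square_integrable_on_def)
  have "square_integrable_on (\<lambda>x. f x *\<^sub>R u x) Omega"
    by (rule square_integrable_bound[where B=L, OF um(3)]) (use fm um L in \<open>auto intro: mult_right_mono\<close>)
  moreover have "square_integrable_on (\<lambda>x. f x *\<^sub>R g x + outer (f' x) (u x)) Omega"
  proof (rule square_integrable_add)
    show "square_integrable_on (\<lambda>x. f x *\<^sub>R g x) Omega"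
      by (rule square_integrable_bound[where B=L, OF um(4)]) (use fm um L in \<open>auto intro: mult_right_mono\<close>)
    show "square_integrable_on (\<lambda>x. outer (f' x) (u x)) Omega"
      by (rule square_integrable_bound[where B=L, OF um(3)])
         (use fm um L in \<open>auto intro: mult_right_mono borel_measurable_outer simp: norm_outer\<close>)
  qed
  ultimately show ?thesis by (simp add: periodic_gradient_def o_def f)
qed

lemma square_integrable_const:
  "square_integrable_on (\<lambda>x. d :: 'c::euclidean_space) (Omega :: (real ^ 'n::finite) set)"
  using integrable_bounded_lebesgue_on[of "\<lambda>_. (norm d)\<^sup>2" Omega "(norm d)\<^sup>2"]
  by (simp add: square_integrable_on_def)

lemma periodic_gradient_const: "periodic_gradient (\<lambda>x. c) (\<lambda>x. 0)"
  by (simp add: periodic_gradient_def o_def has_weak_gradient_on_const square_integrable_const)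

section \<open>Functions on periodic meshes\<close>

definition verts :: "(real ^ 'n::finite) set \<Rightarrow> (real ^ 'n) set" where
  "verts T = {v. v extreme_point_of T}"

text \<open>On a coarse mesh two vertices of one element can be identified by periodicity, so an
  element may have fewer nodes than vertices. Constraints and corrections are therefore indexed by
  nodes.\<close>

definition nodes :: "(real ^ 'n::finite) set \<Rightarrow> (real ^ 'n) set" where
  "nodes T = wrap ` verts T"

section \<open>Geometry of the elements\<close>

locale periodic_mesh =
  fixes \<T> :: "(real ^ 'n::finite) set set"
  assumes mesh: "periodic_simplicial_mesh \<T>"
begin

lemma finite_mesh: "finite \<T>"
  using mesh by (auto simp: periodic_simplicial_mesh_def triangulation_def)

lemma Union_mesh: "\<Union>\<T> = Omega"
  using mesh by (auto simp: periodic_simplicial_mesh_def)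

lemma mesh_subset: "T \<in> \<T> \<Longrightarrow> T \<subseteq> Omega"
  using Union_mesh by blast

lemma mesh_simplex: "T \<in> \<T> \<Longrightarrow> int CARD('n) simplex T"
  using mesh by (auto simp: periodic_simplicial_mesh_def)

lemma mesh_verts:
  assumes "T \<in> \<T>"
  shows "T = convex hull (verts T)" "finite (verts T)" "card (verts T) = CARD('n) + 1" "\<not> affine_dependent (verts T)"
proof -
  obtain C where C: "\<not> affine_dependent C" "int (card C) = int CARD('n) + 1" "T = convex hull C"
    using mesh_simplex[OF assms] unfolding simplex_def by auto
  have "verts T = C"
    using C by (simp add: verts_def extreme_point_of_convex_hull_affine_independent)
  then show "T = convex hull (verts T)" "finite (verts T)" "card (verts T) = CARD('n) + 1" "\<not> affine_dependent (verts T)"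
    using C aff_independent_finite by auto
qed

lemma mesh_compact: "T \<in> \<T> \<Longrightarrow> compact T"
  using mesh_verts finite_imp_compact_convex_hull by metis

lemma mesh_convex: "T \<in> \<T> \<Longrightarrow> convex T"
  using mesh_verts convex_convex_hull by metis

lemma mesh_lmeasurable: "T \<in> \<T> \<Longrightarrow> T \<in> lmeasurable"
  by (simp add: lmeasurable_compact mesh_compact)

lemma mesh_sets: "T \<in> \<T> \<Longrightarrow> T \<in> sets lebesgue"
  using mesh_lmeasurable by blast

lemma mesh_frontier_negligible: "T \<in> \<T> \<Longrightarrow> negligible (frontier T)"
  by (simp add: mesh_convex negligible_convex_frontier)

lemma mesh_interior_subset: "T \<in> \<T> \<Longrightarrow> interior T \<subseteq> interior Omega"
  by (simp add: interior_mono mesh_subset)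

lemma mesh_Int_face: "T \<in> \<T> \<Longrightarrow> T' \<in> \<T> \<Longrightarrow> (T \<inter> T') face_of T"
  using mesh by (auto simp: periodic_simplicial_mesh_def triangulation_def)

text \<open>The intersection is a face of both elements, and a face different from the whole element
  lies in its frontier, which is null for convex sets. As the elements are distinct, the face is
  proper in at least one of them.\<close>

lemma negligible_mesh_Int:
  assumes "T \<in> \<T>" "T' \<in> \<T>" "T \<noteq> T'"
  shows "negligible (T \<inter> T')"
proof -
  have *: "S \<inter> S' \<subseteq> frontier S" if "S \<in> \<T>" "S' \<in> \<T>" "S \<inter> S' \<noteq> S" for S S'
    using face_of_disjoint_interior[OF mesh_Int_face[OF that(1,2)] that(3)] mesh_compact[OF that(1)]
    by (auto simp: frontier_def compact_imp_closed)
  have "T \<inter> T' \<subseteq> frontier T \<union> frontier T'"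
  proof (cases "T \<inter> T' = T")
    case True
    then have "T' \<inter> T \<noteq> T'" using assms(3) by blast
    then show ?thesis using *[OF assms(2,1)] by blast
  qed (use *[OF assms(1,2)] in blast)
  moreover have "negligible (frontier T \<union> frontier T')" using mesh_frontier_negligible assms by simp
  ultimately show ?thesis by (rule negligible_subset[rotated])
qed

lemma mesh_interior_disjoint:
  assumes "T \<in> \<T>" "T' \<in> \<T>" "x \<in> interior T" "x \<in> interior T'"
  shows "T = T'"
proof (rule ccontr)
  assume "T \<noteq> T'"
  then have "negligible (interior T \<inter> interior T')"
    using negligible_subset[OF negligible_mesh_Int[OF assms(1,2)] Int_mono[OF interior_subset interior_subset]] by simp
  moreover have "open (interior T \<inter> interior T')" by (intro open_Int open_interior)
  ultimately have "interior T \<inter> interior T' = {}" using open_not_negligible by metis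
  then show False using assms by blast
qed

section \<open>Null sets and integrals element by element\<close>

lemma AE_mesh_interior: "AE x in lebesgue_on Omega. \<exists>T\<in>\<T>. x \<in> interior T"
proof (subst AE_restrict_space_iff)
  have "negligible (\<Union>T\<in>\<T>. frontier T)"
    using mesh_frontier_negligible finite_mesh by (intro negligible_Union) auto
  moreover have "{x. \<not> (x \<in> Omega \<longrightarrow> (\<exists>T\<in>\<T>. x \<in> interior T))} \<subseteq> (\<Union>T\<in>\<T>. frontier T)"
  proof
    fix x assume x: "x \<in> {x. \<not> (x \<in> Omega \<longrightarrow> (\<exists>T\<in>\<T>. x \<in> interior T))}"
    then obtain T where "T \<in> \<T>" "x \<in> T" using Union_mesh by auto
    moreover from this x have "x \<in> frontier T" using closure_subset[of T] by (auto simp: frontier_def)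
    ultimately show "x \<in> (\<Union>T\<in>\<T>. frontier T)" by blast
  qed
  ultimately show "AE x in lebesgue. x \<in> Omega \<longrightarrow> (\<exists>T\<in>\<T>. x \<in> interior T)"
    by (intro AE_I'[of "\<Union>T\<in>\<T>. frontier T"]) (auto simp: negligible_iff_null_sets)
qed simp

lemma AE_element_interior: "T \<in> \<T> \<Longrightarrow> AE x in lebesgue_on T. x \<in> interior T"
proof (subst AE_restrict_space_iff)
  assume T: "T \<in> \<T>"
  have "{x. \<not> (x \<in> T \<longrightarrow> x \<in> interior T)} \<subseteq> frontier T"
    using closure_subset[of T] by (auto simp: frontier_def)
  then show "AE x in lebesgue. x \<in> T \<longrightarrow> x \<in> interior T"
    using mesh_frontier_negligible[OF T]
    by (intro AE_I'[of "frontier T"]) (auto simp: negligible_iff_null_sets)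
qed (simp add: mesh_sets)

lemma AE_Omega_imp_element:
  assumes "AE x in lebesgue_on Omega. P x" "T \<in> \<T>"
  shows "AE x in lebesgue_on T. P x"
proof -
  have "AE x in lebesgue. x \<in> Omega \<longrightarrow> P x" using assms(1) by (simp add: AE_restrict_space_iff)
  then have "AE x in lebesgue. x \<in> T \<longrightarrow> P x" by eventually_elim (use mesh_subset[OF assms(2)] in blast)
  then show ?thesis using mesh_sets[OF assms(2)] by (simp add: AE_restrict_space_iff)
qed

lemma integrable_element:
  fixes f :: "real ^ 'n \<Rightarrow> 'b::euclidean_space"
  shows "integrable (lebesgue_on Omega) f \<Longrightarrow> T \<in> \<T> \<Longrightarrow> integrable (lebesgue_on T) f"
  by (rule lebesgue_on_subset_integrable[OF _ mesh_subset mesh_sets Omega_sets])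

lemma square_integrable_element:
  fixes f :: "real ^ 'n \<Rightarrow> 'b::euclidean_space"
  assumes "square_integrable_on f Omega" "T \<in> \<T>"
  shows "square_integrable_on f T"
  unfolding square_integrable_on_def
proof
  show "f \<in> borel_measurable (lebesgue_on T)"
    by (rule measurable_restrict_mono[OF _ mesh_subset[OF assms(2)]])
       (use assms(1) in \<open>simp add: square_integrable_on_def\<close>)
  show "integrable (lebesgue_on T) (\<lambda>x. (norm (f x))\<^sup>2)"
    by (rule integrable_element[OF _ assms(2)]) (use assms(1) in \<open>simp add: square_integrable_on_def\<close>)
qed

lemma integral_Omega_eq_sum:
  fixes f :: "real ^ 'n \<Rightarrow> 'b::euclidean_space"
  assumes f: "integrable (lebesgue_on Omega) f"
  shows "(LINT x|lebesgue_on Omega. f x) = (\<Sum>T\<in>\<T>. LINT x|lebesgue_on T. f x)"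
proof -
  have i: "integrable lebesgue (\<lambda>x. indicator T x *\<^sub>R f x)" if "T \<in> \<T>" for T
    using integrable_element[OF f that] mesh_sets[OF that] by (simp add: integrable_restrict_space)
  have "(LINT x|lebesgue_on Omega. f x) = (LINT x|lebesgue_on Omega. (\<Sum>T\<in>\<T>. indicator T x *\<^sub>R f x))"
  proof (rule integral_cong_AE)
    have N: "N \<in> null_sets lebesgue" if "N = (\<Union>(T, T')\<in>{(T, T') \<in> \<T> \<times> \<T>. T \<noteq> T'}. T \<inter> T')" for N
    proof -
      have "finite {(T, T') \<in> \<T> \<times> \<T>. T \<noteq> T'}"
        by (rule finite_subset[of _ "\<T> \<times> \<T>"]) (use finite_mesh in auto)
      then have "negligible N" unfolding that using negligible_mesh_Int by (intro negligible_Union) auto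
      then show ?thesis by (simp add: negligible_iff_null_sets)
    qed
    define P where "P x \<longleftrightarrow> (\<forall>T\<in>\<T>. \<forall>T'\<in>\<T>. T \<noteq> T' \<longrightarrow> x \<notin> T \<inter> T')" for x
    from N have "AE x in lebesgue. P x" unfolding P_def
      by (intro AE_I'[of "\<Union>(T, T')\<in>{(T, T') \<in> \<T> \<times> \<T>. T \<noteq> T'}. T \<inter> T'"]) auto
    then have "AE x in lebesgue_on Omega. P x"
      by (subst AE_restrict_space_iff) (auto elim!: eventually_mono)
    moreover have "AE x in lebesgue_on Omega. x \<in> Omega" by (rule AE_I2) simp
    ultimately show "AE x in lebesgue_on Omega. f x = (\<Sum>T\<in>\<T>. indicator T x *\<^sub>R f x)"
    proof eventually_elim
      case (elim x)
      then obtain T where T: "T \<in> \<T>" "x \<in> T" using Union_mesh by blast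
      have "(\<Sum>T'\<in>\<T>. indicator T' x *\<^sub>R f x) = (\<Sum>T'\<in>{T}. indicator T' x *\<^sub>R f x)"
        by (rule sum.mono_neutral_right) (use finite_mesh T elim(1)[unfolded P_def] in \<open>auto simp: indicator_def\<close>)
      then show ?case using T by simp
    qed
  next
    show "(\<lambda>x. \<Sum>T\<in>\<T>. indicator T x *\<^sub>R f x) \<in> borel_measurable (lebesgue_on Omega)"
      using i by (intro borel_measurable_sum measurable_restrict_space1) auto
  qed (use f in simp)
  also have "\<dots> = (LINT x|lebesgue. indicator Omega x *\<^sub>R (\<Sum>T\<in>\<T>. indicator T x *\<^sub>R f x))"
    by (simp add: integral_restrict_space)
  also have "\<dots> = (LINT x|lebesgue. (\<Sum>T\<in>\<T>. indicator T x *\<^sub>R f x))"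
  proof (rule Bochner_Integration.integral_cong)
    fix x
    show "indicator Omega x *\<^sub>R (\<Sum>T\<in>\<T>. indicator T x *\<^sub>R f x) = (\<Sum>T\<in>\<T>. indicator T x *\<^sub>R f x)"
    proof (cases "x \<in> Omega")
      case False
      then have "indicator T x *\<^sub>R f x = 0" if "T \<in> \<T>" for T using mesh_subset[OF that] by (auto simp: indicator_def)
      then have "(\<Sum>T\<in>\<T>. indicator T x *\<^sub>R f x) = 0" by (intro sum.neutral) auto
      then show ?thesis by simp
    qed simp
  qed simp
  also have "\<dots> = (\<Sum>T\<in>\<T>. LINT x|lebesgue. indicator T x *\<^sub>R f x)"
    using i by (rule Bochner_Integration.integral_sum)
  also have "\<dots> = (\<Sum>T\<in>\<T>. LINT x|lebesgue_on T. f x)"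
    using mesh_sets by (intro sum.cong refl) (simp add: integral_restrict_space)
  finally show ?thesis .
qed

text \<open>Only finitely many translated elements meet a segment, which makes the piecewise
  Lipschitz function globally Lipschitz.\<close>
lemma mesh_function_Lipschitz:
  fixes f :: "real ^ 'n \<Rightarrow> real"
  assumes lip: "\<And>T x y. T \<in> \<T> \<Longrightarrow> x \<in> T \<Longrightarrow> y \<in> T \<Longrightarrow> \<bar>f x - f y\<bar> \<le> L * norm (x - y)"
    and per: "\<And>x. x \<in> Omega \<Longrightarrow> f (wrap x) = f x" and L: "0 \<le> L"
  shows "L-lipschitz_on UNIV (\<lambda>x. f (wrap x))"
proof (rule lipschitz_onI[OF _ L])
  fix x y :: "real ^ 'n"
  define \<gamma> where "\<gamma> t = x + t *\<^sub>R (y - x)" for t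
  obtain R where R: "\<And>t. t \<in> {0..1} \<Longrightarrow> norm (\<gamma> t) \<le> R"
  proof
    fix t :: real assume t: "t \<in> {0..1}"
    have "norm (\<gamma> t) \<le> norm x + \<bar>t\<bar> * norm (y - x)" unfolding \<gamma>_def by (metis norm_scaleR norm_triangle_ineq)
    also have "\<bar>t\<bar> * norm (y - x) \<le> norm (y - x)" using t by (auto intro: mult_left_le_one_le)
    finally show "norm (\<gamma> t) \<le> norm x + norm (y - x)" by simp
  qed
  \<comment> \<open>Integer shifts that can occur along the segment: the coordinates of
    \<open>\<gamma> t\<close> divided by 2 pi are bounded by \<open>R\<close>, and the extra unit
    leaves room for rounding.\<close>
  define Zs where "Zs = (UNIV \<rightarrow>\<^sub>E {- \<lceil>R\<rceil> - 1..\<lceil>R\<rceil> + 1} :: ('n \<Rightarrow> int) set)"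
  have finZ: "finite Zs" unfolding Zs_def by (rule finite_PiE) auto
  let ?I = "Zs \<times> \<T>" and ?U = "\<lambda>(z, T). {t \<in> {0..1}. \<gamma> t - lattice_vec z \<in> T}"
  have "(L * norm (y - x))-lipschitz_on {0..1} (\<lambda>t. f (wrap (\<gamma> t)))"
  proof (rule lipschitz_on_closed_Union[where I="?I" and U="?U"])
    show "finite ?I" using finZ finite_mesh by simp
    show "0 \<le> L * norm (y - x)" using L by simp
    fix i assume i: "i \<in> ?I"
    obtain z T where zT: "i = (z, T)" "T \<in> \<T>" using i by auto
    have "continuous_on {0..1} (\<lambda>t. \<gamma> t - lattice_vec z)" unfolding \<gamma>_def by (intro continuous_intros)
    from continuous_closed_preimage[OF this _ compact_imp_closed[OF mesh_compact[OF zT(2)]]]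
    show "closed (?U i)" unfolding zT by (simp add: vimage_def Int_def)
    show "(L * norm (y - x))-lipschitz_on (?U i) (\<lambda>t. f (wrap (\<gamma> t)))"
    proof (rule lipschitz_onI)
      fix s t assume st: "s \<in> ?U i" "t \<in> ?U i"
      have e: "f (wrap (\<gamma> r)) = f (\<gamma> r - lattice_vec z)" if "r \<in> ?U i" for r
        using per[of "\<gamma> r - lattice_vec z"] mesh_subset[OF zT(2)] that zT by auto
      have "\<gamma> s - lattice_vec z - (\<gamma> t - lattice_vec z) = (s - t) *\<^sub>R (y - x)"
        by (simp add: \<gamma>_def algebra_simps)
      then have "\<bar>f (\<gamma> s - lattice_vec z) - f (\<gamma> t - lattice_vec z)\<bar> \<le> L * (\<bar>s - t\<bar> * norm (y - x))"
        using lip[OF zT(2), of "\<gamma> s - lattice_vec z" "\<gamma> t - lattice_vec z"] st zT by auto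
      then show "dist (f (wrap (\<gamma> s))) (f (wrap (\<gamma> t))) \<le> L * norm (y - x) * dist s t"
        unfolding e[OF st(1)] e[OF st(2)] by (simp add: dist_real_def algebra_simps)
    qed (use L in simp)
  next
    show "{0..1} \<subseteq> (\<Union>i\<in>?I. ?U i)"
    proof
      fix t :: real assume t: "t \<in> {0..1}"
      define z where "z i = \<lfloor>\<gamma> t $ i / (2 * pi)\<rfloor>" for i
      have w: "wrap (\<gamma> t) = \<gamma> t - lattice_vec z"
        by (simp add: vec_eq_iff frac_def right_diff_distrib z_def)
      then obtain T where T: "T \<in> \<T>" "\<gamma> t - lattice_vec z \<in> T"
        using wrap_in_Omega[of "\<gamma> t"] Union_mesh by auto
      have "z i \<in> {- \<lceil>R\<rceil> - 1..\<lceil>R\<rceil> + 1}" for i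
      proof -
        have "\<bar>\<gamma> t $ i\<bar> \<le> R" using R[OF t] component_le_norm_cart order_trans by blast
        moreover have "\<bar>\<gamma> t $ i / (2 * pi)\<bar> \<le> \<bar>\<gamma> t $ i\<bar>"
          using pi_gt3 by (simp add: abs_mult divide_le_eq mult_le_cancel_left1)
        ultimately have "\<gamma> t $ i / (2 * pi) \<le> R" "- R \<le> \<gamma> t $ i / (2 * pi)" by linarith+
        then show ?thesis unfolding z_def by (simp; linarith)
      qed
      then have "z \<in> Zs" by (auto simp: Zs_def)
      then show "t \<in> (\<Union>i\<in>?I. ?U i)" using t T by (intro UN_I[of "(z, T)"]) auto
    qed
  qed
  from lipschitz_onD[OF this, of 0 1]
  show "dist (f (wrap x)) (f (wrap y)) \<le> L * dist x y"
    by (simp add: \<gamma>_def dist_norm norm_minus_commute)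
qed

text \<open>Each point whose representative is interior to an element has a neighbourhood on which
  wrapping is one fixed lattice translation, so there the glued function is a translate of
  \<open>F T\<close>. The remaining points form a closed null set; Lipschitz continuity across it
  comes from \<open>mesh_function_Lipschitz\<close>.\<close>

lemma mesh_function_pwC1:
  fixes f :: "real ^ 'n \<Rightarrow> real"
  assumes F: "\<And>T. T \<in> \<T> \<Longrightarrow> C1 (F T) (F' T)" "\<And>T x. T \<in> \<T> \<Longrightarrow> norm (F' T x) \<le> L"
      "\<And>T x. T \<in> \<T> \<Longrightarrow> x \<in> T \<Longrightarrow> f x = F T x"
    and per: "\<And>x. x \<in> Omega \<Longrightarrow> f (wrap x) = f x" and bound: "\<And>x. x \<in> Omega \<Longrightarrow> \<bar>f x\<bar> \<le> L"
  shows "\<exists>f'. pwC1 (\<lambda>x. f (wrap x)) f' \<and> (\<forall>x. f' (wrap x) = f' x) \<and> (\<forall>T\<in>\<T>. \<forall>x\<in>interior T. f' x = F' T x)"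
proof -
  \<comment> \<open>Off the element interiors the value 0 is a default; after wrapping it is met
    only on the exceptional null set.\<close>
  define g where "g y = (if \<exists>T\<in>\<T>. y \<in> interior T then F' (SOME T. T \<in> \<T> \<and> y \<in> interior T) y else 0)" for y
  have g: "g y = F' T y" if "T \<in> \<T>" "y \<in> interior T" for T y
  proof -
    have "(SOME T. T \<in> \<T> \<and> y \<in> interior T) = T"
      by (rule some_equality) (use that mesh_interior_disjoint in auto)
    then show ?thesis using that by (auto simp: g_def)
  qed
  define Q where "Q = {x. \<exists>T\<in>\<T>. wrap x \<in> interior T}"
  have g0: "g (wrap x) = 0" if "x \<notin> Q" for x using that by (auto simp: Q_def g_def)
  have L: "0 \<le> L" using bound[OF wrap_in_Omega] abs_ge_zero order_trans by blast
  have lipF: "L-lipschitz_on UNIV (F T)" if "T \<in> \<T>" for T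
  proof (rule bounded_derivative_imp_lipschitz[where f'="\<lambda>x h. F' T x \<bullet> h", OF _ _ _ L])
    show "onorm (\<lambda>h. F' T x \<bullet> h) \<le> L" for x
      by (rule onorm_le) (metis Cauchy_Schwarz_ineq2 F(2) that mult_right_mono norm_ge_zero order_trans real_norm_def)
  qed (use F(1)[OF that] in \<open>auto simp: C1_def intro: has_derivative_at_withinI\<close>)
  have lip: "L-lipschitz_on UNIV (\<lambda>x. f (wrap x))"
    by (rule mesh_function_Lipschitz[where f=f, OF _ per L])
       (use lipschitz_onD[OF lipF] F(3) in \<open>auto simp: dist_norm\<close>)
  have local: "\<exists>T z. T \<in> \<T> \<and> x - lattice_vec z \<in> interior T" if x: "x \<in> Q" for x
  proof -
    obtain z where z: "wrap x = x - lattice_vec z" using wrap_eq_minus_lattice[of x] by metis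
    obtain T where "T \<in> \<T>" "wrap x \<in> interior T" using x unfolding Q_def by auto
    then show ?thesis unfolding z by metis
  qed
  have wrap_local: "wrap y = y - lattice_vec z" if "y - lattice_vec z \<in> interior T" "T \<in> \<T>" for y z T
    using wrap_interior[of "y - lattice_vec z"] mesh_interior_subset[OF that(2)] that(1) by auto
  have opn: "open {y. y - lattice_vec z \<in> interior T}" for z T
    using open_vimage[OF open_interior[of T], of "\<lambda>y. y - lattice_vec z"] by (simp add: vimage_def continuous_intros)
  have Q_eq: "Q = (\<Union>z. \<Union>T\<in>\<T>. {y. y - lattice_vec z \<in> interior T})"
    using local wrap_local by (fastforce simp: Q_def)
  have openO: "open Q" unfolding Q_eq using opn by blast
  have negO: "negligible (- Q)"
  proof -
    have "AE x in lebesgue. x \<in> Q" using AE_wrap[OF AE_mesh_interior] by (simp add: Q_def)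
    moreover have "- Q \<in> sets lebesgue"
      using openO by (intro sets_completionI_sets) (auto intro: borel_closed)
    ultimately have "- Q \<in> null_sets lebesgue"
      using AE_iff_null_sets[of "- Q" lebesgue] by simp
    then show ?thesis by (simp add: negligible_iff_null_sets)
  qed
  have der: "((\<lambda>x. f (wrap x)) has_derivative (\<lambda>h. g (wrap x) \<bullet> h)) (at x)"
    and cont: "isCont (\<lambda>x. g (wrap x)) x" if x: "x \<in> Q" for x
  proof -
    obtain T z where T: "T \<in> \<T>" "x - lattice_vec z \<in> interior T" using local[OF x] by blast
    have eqs: "f (wrap y) = F T (y - lattice_vec z)" "g (wrap y) = F' T (y - lattice_vec z)"
      if "y - lattice_vec z \<in> interior T" for y
      using wrap_local[OF that T(1)] F(3)[OF T(1)] g[OF T(1) that] that interior_subset by auto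
    have "((\<lambda>y. F T (y - lattice_vec z)) has_derivative (\<lambda>h. F' T (x - lattice_vec z) \<bullet> h)) (at x)"
    proof (rule has_derivative_compose[where f="\<lambda>y. y - lattice_vec z" and f'="\<lambda>h. h"])
      show "((\<lambda>y. y - lattice_vec z) has_derivative (\<lambda>h. h)) (at x)" by (auto intro!: derivative_eq_intros)
      show "(F T has_derivative (\<lambda>h. F' T (x - lattice_vec z) \<bullet> h)) (at (x - lattice_vec z))"
        using F(1)[OF T(1)] by (simp add: C1_def)
    qed
    then have "((\<lambda>x. f (wrap x)) has_derivative (\<lambda>h. F' T (x - lattice_vec z) \<bullet> h)) (at x)"
      by (rule has_derivative_transform_within_open[OF _ opn[of z T]]) (use T eqs in auto)
    then show "((\<lambda>x. f (wrap x)) has_derivative (\<lambda>h. g (wrap x) \<bullet> h)) (at x)"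
      using eqs(2)[OF T(2)] by simp
    have "isCont (\<lambda>y. F' T (y - lattice_vec z)) x"
    proof (rule isCont_o2[where f="\<lambda>y. y - lattice_vec z" and g="F' T"])
      show "isCont (F' T) (x - lattice_vec z)"
        using F(1)[OF T(1)] by (simp add: C1_def continuous_on_eq_continuous_at)
    qed (intro continuous_intros)
    moreover have "\<forall>\<^sub>F y in nhds x. F' T (y - lattice_vec z) = g (wrap y)"
      using opn[of z T] T(2) eqs(2) unfolding eventually_nhds
      by (intro exI[of _ "{y. y - lattice_vec z \<in> interior T}"]) auto
    ultimately show "isCont (\<lambda>x. g (wrap x)) x"
      using isCont_cong by metis
  qed
  have contO: "continuous_on Q (\<lambda>x. g (wrap x))"
    using cont by (intro continuous_at_imp_continuous_on) auto
  have meas: "(\<lambda>x. g (wrap x)) \<in> borel_measurable borel"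
  proof -
    have "(\<lambda>x. indicator Q x *\<^sub>R g (wrap x)) \<in> borel_measurable borel"
      using openO by (intro borel_measurable_continuous_on_indicator contO) auto
    moreover have "(\<lambda>x. indicator Q x *\<^sub>R g (wrap x)) = (\<lambda>x. g (wrap x))"
      using g0 by (auto simp: indicator_def)
    ultimately show ?thesis by simp
  qed
  have gb: "norm (g (wrap x)) \<le> L" for x
  proof (cases "x \<in> Q")
    case True
    then obtain T where "T \<in> \<T>" "wrap x \<in> interior T" by (auto simp: Q_def)
    then show ?thesis using g F(2) by simp
  qed (use g0 L in simp)
  have "pwC1 (\<lambda>x. f (wrap x)) (\<lambda>x. g (wrap x))"
    unfolding pwC1_def using meas lip gb bound[OF wrap_in_Omega] openO negO contO der
    by (intro conjI exI[of _ L] exI[of _ "- Q"]) auto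
  moreover have "\<forall>T\<in>\<T>. \<forall>x\<in>interior T. g (wrap x) = F' T x"
    using g wrap_interior mesh_interior_subset by (metis subsetD)
  ultimately show ?thesis by (intro exI[of _ "\<lambda>x. g (wrap x)"]) simp
qed

end

section \<open>Hat functions\<close>

lemma affine_const_on_hull:
  fixes b :: "'a::real_inner"
  assumes "\<And>v. v \<in> S \<Longrightarrow> a + b \<bullet> v = c" "x \<in> convex hull S"
  shows "a + b \<bullet> x = c"
proof -
  have "convex hull S \<subseteq> {x. b \<bullet> x = c - a}"
    by (rule hull_minimal[where S=convex, OF _ convex_hyperplane]) (use assms(1) in force)
  then show ?thesis using assms(2) by auto
qed

lemma affine_ge_on_hull:
  fixes b :: "'a::real_inner"
  assumes "\<And>v. v \<in> S \<Longrightarrow> c \<le> a + b \<bullet> v" "x \<in> convex hull S"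
  shows "c \<le> a + b \<bullet> x"
proof -
  have "convex hull S \<subseteq> {x. b \<bullet> x \<ge> c - a}"
    by (rule hull_minimal[where S=convex, OF _ convex_halfspace_ge]) (use assms(1) in force)
  then have "b \<bullet> x \<ge> c - a" using assms(2) by auto
  then show ?thesis by simp
qed

lemma affine_le_on_hull:
  fixes b :: "'a::real_inner"
  assumes "\<And>v. v \<in> S \<Longrightarrow> a + b \<bullet> v \<le> c" "x \<in> convex hull S"
  shows "a + b \<bullet> x \<le> c"
proof -
  have "- c \<le> - a + (- b) \<bullet> x"
    by (rule affine_ge_on_hull[OF _ assms(2)]) (use assms(1) in force)
  then show ?thesis by simp
qed

text \<open>Moving from the center by \<open>r / 2\<close> along \<open>b\<close> and against it
  changes the value by \<open>norm b * r\<close> in total, and the values stay in the unit interval.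
  Half the radius keeps both points inside the open ball.\<close>

lemma affine_gradient_le:
  fixes b :: "'a::real_inner"
  assumes "ball c r \<subseteq> T" "\<And>x. x \<in> T \<Longrightarrow> 0 \<le> a + b \<bullet> x \<and> a + b \<bullet> x \<le> 1" "0 < r"
  shows "norm b * r \<le> 1"
proof (cases "b = 0")
  case False
  define e where "e = (r / (2 * norm b)) *\<^sub>R b"
  have "norm e = r / 2" using False assms(3) by (simp add: e_def)
  then have "c + e \<in> ball c r" "c - e \<in> ball c r" using assms(3) by (auto simp: dist_norm)
  then have "a + b \<bullet> (c + e) \<le> 1" "0 \<le> a + b \<bullet> (c - e)" using assms by blast+
  then have "2 * (b \<bullet> e) \<le> 1" by (simp add: inner_diff_right inner_add_right)
  moreover have "2 * (b \<bullet> e) = norm b * r"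
    using False assms(3) by (simp add: e_def dot_square_norm power2_eq_square)
  ultimately show ?thesis by simp
qed simp

lemma periodic_gradient_cong:
  assumes "periodic_gradient w g" "\<And>x. x \<in> Omega \<Longrightarrow> w x = w' x"
  shows "periodic_gradient w' g"
proof -
  have "w \<circ> wrap = w' \<circ> wrap" using assms(2)[OF wrap_in_Omega] by auto
  moreover have "square_integrable_on w' Omega"
  proof -
    have "w' \<in> borel_measurable (lebesgue_on Omega) \<longleftrightarrow> w \<in> borel_measurable (lebesgue_on Omega)"
      by (rule measurable_cong) (use assms(2) in simp)
    moreover have "integrable (lebesgue_on Omega) (\<lambda>x. (norm (w' x))\<^sup>2) \<longleftrightarrow> integrable (lebesgue_on Omega) (\<lambda>x. (norm (w x))\<^sup>2)"
      by (rule Bochner_Integration.integrable_cong) (use assms(2) in simp_all)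
    ultimately show ?thesis using assms(1) by (simp add: periodic_gradient_def square_integrable_on_def)
  qed
  ultimately show ?thesis using assms(1) by (simp add: periodic_gradient_def)
qed

context periodic_mesh
begin

lemma affine_mesh_function_pwC1:
  fixes f :: "real ^ 'n \<Rightarrow> real"
  assumes aff: "\<And>T x. T \<in> \<T> \<Longrightarrow> x \<in> T \<Longrightarrow> f x = a T + b T \<bullet> x"
    and per: "\<And>x. x \<in> Omega \<Longrightarrow> f (wrap x) = f x" and bound: "\<And>x. x \<in> Omega \<Longrightarrow> \<bar>f x\<bar> \<le> 1"
  shows "\<exists>f'. pwC1 (\<lambda>x. f (wrap x)) f' \<and> (\<forall>x. f' (wrap x) = f' x) \<and> (\<forall>T\<in>\<T>. \<forall>x\<in>interior T. f' x = b T)"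
proof (rule mesh_function_pwC1[where F="\<lambda>T x. a T + b T \<bullet> x" and F'="\<lambda>T x. b T" and L="1 + (\<Sum>T\<in>\<T>. norm (b T))"])
  show "norm (b T) \<le> 1 + (\<Sum>T\<in>\<T>. norm (b T))" if "T \<in> \<T>" for T
    using member_le_sum[OF that, of "\<lambda>T. norm (b T)"] finite_mesh by simp
  show "\<bar>f x\<bar> \<le> 1 + (\<Sum>T\<in>\<T>. norm (b T))" if "x \<in> Omega" for x
    using bound[OF that] sum_nonneg[of \<T> "\<lambda>T. norm (b T)"] by simp
qed (use assms in \<open>auto intro: C1_affine\<close>)

lemma verts_subset: "T \<in> \<T> \<Longrightarrow> verts T \<subseteq> T"
  by (auto simp: verts_def extreme_point_of_def)

lemma verts_mesh_vertices: "T \<in> \<T> \<Longrightarrow> verts T \<subseteq> mesh_vertices \<T>"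
  by (auto simp: verts_def mesh_vertices_def)

lemma nodes_mesh_nodes: "T \<in> \<T> \<Longrightarrow> nodes T \<subseteq> mesh_nodes \<T>"
  using verts_mesh_vertices by (auto simp: nodes_def mesh_nodes_def)

lemma mesh_nodes_eq: "mesh_nodes \<T> = (\<Union>T\<in>\<T>. nodes T)"
  by (auto simp: nodes_def mesh_nodes_def mesh_vertices_def verts_def)

lemma finite_nodes: "T \<in> \<T> \<Longrightarrow> finite (nodes T)"
  by (simp add: nodes_def mesh_verts)

lemma card_nodes: "T \<in> \<T> \<Longrightarrow> card (nodes T) \<le> CARD('n) + 1"
  using card_image_le[OF mesh_verts(2), of T wrap] mesh_verts(3) by (simp add: nodes_def)

lemma nodes_nonempty: "T \<in> \<T> \<Longrightarrow> nodes T \<noteq> {}"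
  using mesh_verts(3) by (force simp: nodes_def)

lemma finite_mesh_nodes: "finite (mesh_nodes \<T>)"
  unfolding mesh_nodes_eq using finite_mesh finite_nodes by blast

end

locale nodal_mesh = periodic_mesh \<T> for \<T> :: "(real ^ 'n::finite) set set" +
  fixes \<phi> :: "real ^ 'n \<Rightarrow> real ^ 'n \<Rightarrow> complex"
  assumes nodal: "nodal_basis \<T> \<phi>"
begin

definition hat :: "real ^ 'n \<Rightarrow> real ^ 'n \<Rightarrow> real" where
  "hat p x = Re (\<phi> p x)"

lemma phi_H1P: "p \<in> mesh_nodes \<T> \<Longrightarrow> \<phi> p \<in> H1P"
  using nodal by (simp add: nodal_basis_def P1_space_def)

lemma phi_vertex: "p \<in> mesh_nodes \<T> \<Longrightarrow> T \<in> \<T> \<Longrightarrow> v \<in> verts T \<Longrightarrow> \<phi> p v = (if wrap v = p then 1 else 0)"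
  using nodal verts_mesh_vertices[of T] unfolding nodal_basis_def by (metis subsetD)

lemma hat_vertex: "p \<in> mesh_nodes \<T> \<Longrightarrow> T \<in> \<T> \<Longrightarrow> v \<in> verts T \<Longrightarrow> hat p v = (if wrap v = p then 1 else 0)"
  by (simp add: hat_def phi_vertex)

text \<open>The imaginary part of \<open>\<phi> p\<close> is affine on the element and vanishes at
  its vertices, hence on their convex hull; so \<open>\<phi> p\<close> is real there although its
  coefficients are complex.\<close>

lemma hat_affine_ex:
  assumes "p \<in> mesh_nodes \<T>" "T \<in> \<T>"
  shows "\<exists>a b. \<forall>x\<in>T. hat p x = a + b \<bullet> x \<and> \<phi> p x = complex_of_real (hat p x)"
proof -
  obtain a b where ab: "\<And>x. x \<in> T \<Longrightarrow> \<phi> p x = a + (\<Sum>i\<in>UNIV. b $ i * complex_of_real (x $ i))"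
    using nodal assms by (force simp: nodal_basis_def P1_space_def)
  have re: "hat p x = Re a + (\<chi> i. Re (b $ i)) \<bullet> x" if "x \<in> T" for x
    using ab[OF that] by (simp add: hat_def inner_vec_def)
  have im: "Im (\<phi> p x) = Im a + (\<chi> i. Im (b $ i)) \<bullet> x" if "x \<in> T" for x
    using ab[OF that] by (simp add: inner_vec_def)
  have "Im (\<phi> p x) = 0" if "x \<in> T" for x
  proof -
    have "Im a + (\<chi> i. Im (b $ i)) \<bullet> x = 0"
    proof (rule affine_const_on_hull)
      show "x \<in> convex hull (verts T)" using that mesh_verts(1)[OF assms(2)] by simp
      fix v assume v: "v \<in> verts T"
      then have "v \<in> T" using verts_subset[OF assms(2)] by blast
      from im[OF this] phi_vertex[OF assms v] show "Im a + (\<chi> i. Im (b $ i)) \<bullet> v = 0"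
        by (simp split: if_splits)
    qed
    then show ?thesis using im[OF that] by simp
  qed
  then have "\<phi> p x = complex_of_real (hat p x)" if "x \<in> T" for x
    using that by (simp add: hat_def complex_eq_iff)
  with re show ?thesis by blast
qed

definition hat_offset :: "real ^ 'n \<Rightarrow> (real ^ 'n) set \<Rightarrow> real" where
  "hat_offset p T = (SOME a. \<exists>b. \<forall>x\<in>T. hat p x = a + b \<bullet> x \<and> \<phi> p x = complex_of_real (hat p x))"

definition hat_slope :: "real ^ 'n \<Rightarrow> (real ^ 'n) set \<Rightarrow> real ^ 'n" where
  "hat_slope p T = (SOME b. \<forall>x\<in>T. hat p x = hat_offset p T + b \<bullet> x \<and> \<phi> p x = complex_of_real (hat p x))"

lemma hat_affine:
  assumes "p \<in> mesh_nodes \<T>" "T \<in> \<T>" "x \<in> T"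
  shows "hat p x = hat_offset p T + hat_slope p T \<bullet> x" "\<phi> p x = complex_of_real (hat p x)"
proof -
  have "\<exists>b. \<forall>x\<in>T. hat p x = hat_offset p T + b \<bullet> x \<and> \<phi> p x = complex_of_real (hat p x)"
    unfolding hat_offset_def by (rule someI_ex[OF hat_affine_ex[OF assms(1,2)]])
  then have "\<forall>x\<in>T. hat p x = hat_offset p T + hat_slope p T \<bullet> x \<and> \<phi> p x = complex_of_real (hat p x)"
    unfolding hat_slope_def by (rule someI_ex)
  then show "hat p x = hat_offset p T + hat_slope p T \<bullet> x" "\<phi> p x = complex_of_real (hat p x)"
    using assms(3) by blast+
qed

lemma phi_eq_hat: "p \<in> mesh_nodes \<T> \<Longrightarrow> x \<in> Omega \<Longrightarrow> \<phi> p x = complex_of_real (hat p x)"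
  using hat_affine(2) Union_mesh by blast

definition hat_sum :: "(real ^ 'n) set \<Rightarrow> real ^ 'n \<Rightarrow> real" where
  "hat_sum M x = (\<Sum>p\<in>M. hat p x)"

definition hat_sum_slope :: "(real ^ 'n) set \<Rightarrow> (real ^ 'n) set \<Rightarrow> real ^ 'n" where
  "hat_sum_slope M T = (\<Sum>p\<in>M. hat_slope p T)"

lemma hat_sum_affine:
  assumes "M \<subseteq> mesh_nodes \<T>" "T \<in> \<T>" "x \<in> T"
  shows "hat_sum M x = (\<Sum>p\<in>M. hat_offset p T) + hat_sum_slope M T \<bullet> x"
proof -
  have "hat_sum M x = (\<Sum>p\<in>M. hat_offset p T + hat_slope p T \<bullet> x)"
    unfolding hat_sum_def by (rule sum.cong) (use assms hat_affine(1) in auto)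
  then show ?thesis by (simp add: sum.distrib inner_sum_left hat_sum_slope_def)
qed

lemma hat_sum_vertex:
  assumes "M \<subseteq> mesh_nodes \<T>" "T \<in> \<T>" "v \<in> verts T"
  shows "hat_sum M v = (if wrap v \<in> M then 1 else 0)"
proof -
  have "hat_sum M v = (\<Sum>p\<in>M. if wrap v = p then 1 else 0)"
    unfolding hat_sum_def by (rule sum.cong) (use assms hat_vertex in auto)
  then show ?thesis using finite_subset[OF assms(1) finite_mesh_nodes] by (simp add: sum.delta)
qed

lemma hat_sum_bounds:
  assumes "M \<subseteq> mesh_nodes \<T>" "T \<in> \<T>" "x \<in> T"
  shows "0 \<le> hat_sum M x" "hat_sum M x \<le> 1"
proof -
  have x: "x \<in> convex hull (verts T)" using assms mesh_verts(1) by blast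
  have v: "(\<Sum>p\<in>M. hat_offset p T) + hat_sum_slope M T \<bullet> v = (if wrap v \<in> M then 1 else 0)" if "v \<in> verts T" for v
    using hat_sum_affine[OF assms(1,2), of v] hat_sum_vertex[OF assms(1,2) that] verts_subset[OF assms(2)] that by auto
  show "0 \<le> hat_sum M x" unfolding hat_sum_affine[OF assms]
    by (rule affine_ge_on_hull[OF _ x]) (simp add: v)
  show "hat_sum M x \<le> 1" unfolding hat_sum_affine[OF assms]
    by (rule affine_le_on_hull[OF _ x]) (simp add: v)
qed

lemma hat_sum_const:
  assumes "M \<subseteq> mesh_nodes \<T>" "T \<in> \<T>" "x \<in> T"
  shows "nodes T \<subseteq> M \<Longrightarrow> hat_sum M x = 1" "nodes T \<inter> M = {} \<Longrightarrow> hat_sum M x = 0"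
proof -
  have x: "x \<in> convex hull (verts T)" using assms mesh_verts(1) by blast
  have v: "(\<Sum>p\<in>M. hat_offset p T) + hat_sum_slope M T \<bullet> v = (if wrap v \<in> M then 1 else 0)" if "v \<in> verts T" for v
    using hat_sum_affine[OF assms(1,2), of v] hat_sum_vertex[OF assms(1,2) that] verts_subset[OF assms(2)] that by auto
  show "hat_sum M x = 1" if "nodes T \<subseteq> M"
    unfolding hat_sum_affine[OF assms]
    by (rule affine_const_on_hull[OF _ x]) (use v that in \<open>auto simp: nodes_def\<close>)
  show "hat_sum M x = 0" if "nodes T \<inter> M = {}"
    unfolding hat_sum_affine[OF assms]
    by (rule affine_const_on_hull[OF _ x]) (use v that in \<open>auto simp: nodes_def\<close>)
qed

lemma hat_eq_hat_sum: "hat p x = hat_sum {p} x"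
  by (simp add: hat_sum_def)

lemma hat_bounds:
  assumes "p \<in> mesh_nodes \<T>" "x \<in> Omega"
  shows "0 \<le> hat p x" "hat p x \<le> 1"
proof -
  obtain T where "T \<in> \<T>" "x \<in> T" using assms(2) Union_mesh by blast
  then show "0 \<le> hat p x" "hat p x \<le> 1"
    using hat_sum_bounds[of "{p}" T x] assms(1) by (simp_all add: hat_eq_hat_sum)
qed

lemma hat_eq_0:
  assumes "p \<in> mesh_nodes \<T>" "T \<in> \<T>" "x \<in> T" "p \<notin> nodes T"
  shows "hat p x = 0"
  using hat_sum_const(2)[of "{p}" T x] assms by (simp add: hat_eq_hat_sum)

text \<open>The element of the point and the translated element of its representative intersect in a
  common face, on which both affine functions are determined by the nodal values.\<close>
lemma hat_wrap:
  assumes p: "p \<in> mesh_nodes \<T>" and x: "x \<in> Omega"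
  shows "hat p (wrap x) = hat p x"
proof -
  obtain z where z: "wrap x = x - lattice_vec z" using wrap_eq_minus_lattice by metis
  obtain T where T: "T \<in> \<T>" "x \<in> T" using x Union_mesh by blast
  obtain T' where T': "T' \<in> \<T>" "wrap x \<in> T'" using wrap_in_Omega Union_mesh by blast
  let ?S = "(+) (lattice_vec z) ` T'"
  let ?F = "T \<inter> ?S"
  have faces: "?F face_of T" "?F face_of ?S"
    using mesh T(1) T'(1) unfolding periodic_simplicial_mesh_def by (metis lattice_vec_nth)+
  have "compact ?F" using mesh_compact T(1) T'(1) by (intro compact_Int compact_translation) auto
  moreover have "convex ?F" using mesh_convex T(1) T'(1) by (intro convex_Int convex_translation) auto
  ultimately have hull: "?F = convex hull {v. v extreme_point_of ?F}" by (rule Krein_Milman_Minkowski)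
  have "x = lattice_vec z + wrap x" using z by simp
  then have "x \<in> ?F" using T T' by blast
  then have xh: "x \<in> convex hull {v. v extreme_point_of ?F}" using hull by simp
  define a where "a = hat_offset p T - hat_offset p T' + hat_slope p T' \<bullet> lattice_vec z"
  have d: "hat p y - hat p (y - lattice_vec z) = a + (hat_slope p T - hat_slope p T') \<bullet> y" if "y \<in> ?F" for y
  proof -
    have "y \<in> T" "y - lattice_vec z \<in> T'" using that by auto
    then show ?thesis using hat_affine(1)[OF p T(1), of y] hat_affine(1)[OF p T'(1), of "y - lattice_vec z"]
      by (simp add: a_def inner_diff_left inner_diff_right)
  qed
  have "a + (hat_slope p T - hat_slope p T') \<bullet> x = 0"
  proof (rule affine_const_on_hull[OF _ xh])
    fix v assume "v \<in> {v. v extreme_point_of ?F}"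
    then have v: "v extreme_point_of ?F" by simp
    then have "v \<in> ?F" by (simp add: extreme_point_of_def)
    have vT: "v \<in> verts T" using v extreme_point_of_face[OF faces(1)] by (simp add: verts_def)
    have "v extreme_point_of ?S" using v extreme_point_of_face[OF faces(2)] by simp
    moreover have "v = lattice_vec z + (v - lattice_vec z)" by simp
    ultimately have vT': "v - lattice_vec z \<in> verts T'"
      unfolding verts_def using extreme_point_of_translation_eq[of "lattice_vec z" "v - lattice_vec z" T'] by simp
    have "hat p v - hat p (v - lattice_vec z) = 0"
      unfolding hat_vertex[OF p T(1) vT] hat_vertex[OF p T'(1) vT'] by simp
    then show "a + (hat_slope p T - hat_slope p T') \<bullet> v = 0" using d[OF \<open>v \<in> ?F\<close>] by simp
  qed
  then show ?thesis using d[OF \<open>x \<in> ?F\<close>] z by simp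
qed

lemma hat_sum_wrap: "M \<subseteq> mesh_nodes \<T> \<Longrightarrow> x \<in> Omega \<Longrightarrow> hat_sum M (wrap x) = hat_sum M x"
  unfolding hat_sum_def by (rule sum.cong) (auto simp: hat_wrap)

lemma hat_sum_pwC1:
  assumes "M \<subseteq> mesh_nodes \<T>"
  shows "\<exists>f'. pwC1 (\<lambda>x. hat_sum M (wrap x)) f' \<and> (\<forall>x. f' (wrap x) = f' x) \<and>
    (\<forall>T\<in>\<T>. \<forall>x\<in>interior T. f' x = hat_sum_slope M T)"
proof (rule affine_mesh_function_pwC1[where f="hat_sum M" and a="\<lambda>T. \<Sum>p\<in>M. hat_offset p T" and b="hat_sum_slope M"])
  show "hat_sum M x = (\<Sum>p\<in>M. hat_offset p T) + hat_sum_slope M T \<bullet> x" if "T \<in> \<T>" "x \<in> T" for T x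
    using hat_sum_affine[OF assms that] .
  show "hat_sum M (wrap x) = hat_sum M x" if "x \<in> Omega" for x using hat_sum_wrap[OF assms that] .
  show "\<bar>hat_sum M x\<bar> \<le> 1" if x: "x \<in> Omega" for x
  proof -
    obtain T where "T \<in> \<T>" "x \<in> T" using x Union_mesh by blast
    then show ?thesis using hat_sum_bounds[OF assms, of T x] by simp
  qed
qed

lemma periodic_gradient_hat_sum_mult:
  assumes M: "M \<subseteq> mesh_nodes \<T>" and u: "periodic_gradient u g"
  shows "\<exists>h. periodic_gradient (\<lambda>x. hat_sum M x *\<^sub>R u x) h \<and>
    (\<forall>T\<in>\<T>. \<forall>x\<in>interior T. h x = hat_sum M x *\<^sub>R g x + outer (hat_sum_slope M T) (u x))"
proof -
  obtain f' where f': "pwC1 (\<lambda>x. hat_sum M (wrap x)) f'" "\<And>x. f' (wrap x) = f' x"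
    "\<And>T x. T \<in> \<T> \<Longrightarrow> x \<in> interior T \<Longrightarrow> f' x = hat_sum_slope M T"
    using hat_sum_pwC1[OF M] by auto
  have "periodic_gradient (\<lambda>x. hat_sum M (wrap x) *\<^sub>R u x) (\<lambda>x. hat_sum M (wrap x) *\<^sub>R g x + outer (f' x) (u x))"
    by (rule periodic_gradient_mult[OF u f'(1) _ f'(2)]) simp
  then have "periodic_gradient (\<lambda>x. hat_sum M x *\<^sub>R u x) (\<lambda>x. hat_sum M (wrap x) *\<^sub>R g x + outer (f' x) (u x))"
    by (rule periodic_gradient_cong) (simp add: hat_sum_wrap[OF M])
  moreover have "hat_sum M (wrap x) *\<^sub>R g x + outer (f' x) (u x) = hat_sum M x *\<^sub>R g x + outer (hat_sum_slope M T) (u x)"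
    if "T \<in> \<T>" "x \<in> interior T" for T x
    using f'(3)[OF that] hat_sum_wrap[OF M, of x] mesh_interior_subset[OF that(1)] interior_subset[of Omega] that(2) by auto
  ultimately show ?thesis by blast
qed

text \<open>Obtained as the product of the hat function, viewed as a multiplier, with the constant
  function 1.\<close>

lemma periodic_gradient_phi:
  assumes p: "p \<in> mesh_nodes \<T>"
  shows "\<exists>h. periodic_gradient (\<phi> p) h \<and> (\<forall>T\<in>\<T>. \<forall>x\<in>interior T. h x = outer (hat_slope p T) 1)"
proof -
  have sub: "{p} \<subseteq> mesh_nodes \<T>" using p by simp
  from periodic_gradient_hat_sum_mult[OF sub periodic_gradient_const[of 1]]
  obtain h where h': "periodic_gradient (\<lambda>x. hat_sum {p} x *\<^sub>R (1::complex)) h \<and>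
    (\<forall>T\<in>\<T>. \<forall>x\<in>interior T. h x = hat_sum {p} x *\<^sub>R 0 + outer (hat_sum_slope {p} T) 1)"
    by (rule exE)
  note h = conjunct1[OF h'] conjunct2[OF h']
  have "periodic_gradient (\<phi> p) h"
    by (rule periodic_gradient_cong[OF h(1)]) (use phi_eq_hat[OF p] in \<open>simp add: hat_eq_hat_sum scaleR_conv_of_real\<close>)
  then show ?thesis using h(2) by (intro exI[of _ h]) (simp add: hat_sum_slope_def)
qed

end

section \<open>Bumps dual to the hat functions\<close>

lemma integral_lebesgue_reflection:
  fixes f :: "real ^ 'n::finite \<Rightarrow> real"
  assumes f: "f \<in> borel_measurable borel"
  shows "(LINT x|lebesgue. f (a - x)) = (LINT x|lebesgue. f x)"
proof -
  have "lborel = density (distr lborel borel (\<lambda>x::real ^ 'n. a + (-1) *\<^sub>R x)) (\<lambda>_. \<bar>-1::real\<bar> ^ DIM(real ^ 'n))"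
    by (rule lborel_affine) simp
  also have "\<dots> = distr lborel borel (\<lambda>x::real ^ 'n. a - x)"
    by (simp add: density_1 one_ennreal_def[symmetric])
  finally have "lborel = distr lborel borel (\<lambda>x::real ^ 'n. a - x)" .
  then have "(LINT x|lborel. f x) = (LINT x|distr lborel borel (\<lambda>x. a - x). f x)" by simp
  also have "\<dots> = (LINT x|lborel. f (a - x))"
    by (rule integral_distr) (use f in auto)
  finally show ?thesis using f by (simp add: integral_completion)
qed

text \<open>Radial about \<open>a\<close>, hence invariant under reflection at \<open>a\<close>; the
  outer square makes it \<open>C1\<close> across the sphere of radius \<open>s\<close>. Its height
  \<open>s ^ 4\<close> cancels once the bump is normalized by its integral.\<close>

definition bump :: "real ^ 'n::finite \<Rightarrow> real \<Rightarrow> real ^ 'n \<Rightarrow> real" where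
  "bump a s y = (max 0 (s\<^sup>2 - (norm (y - a))\<^sup>2))\<^sup>2"

definition bump_grad :: "real ^ 'n::finite \<Rightarrow> real \<Rightarrow> real ^ 'n \<Rightarrow> real ^ 'n" where
  "bump_grad a s y = (2 * max 0 (s\<^sup>2 - (norm (y - a))\<^sup>2)) *\<^sub>R ((-2) *\<^sub>R (y - a))"

lemma bump_C1: "C1 (bump a s) (bump_grad a s)"
proof -
  have u: "C1 (\<lambda>y. s\<^sup>2 - (norm (y - a))\<^sup>2) (\<lambda>y. (-2) *\<^sub>R (y - a))"
    unfolding C1_def power2_norm_eq_inner
    by (auto intro!: derivative_eq_intros continuous_intros simp: inner_commute inner_diff_left inner_diff_right algebra_simps)
  have c: "continuous_on UNIV (\<lambda>t::real. 2 * max 0 t)" by (intro continuous_intros)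
  show ?thesis
    using C1_compose[OF u has_real_derivative_max_0_sqr c] unfolding bump_def[abs_def] bump_grad_def[abs_def] .
qed

lemma bump_nonneg: "0 \<le> bump a s y"
  by (simp add: bump_def)

lemma bump_eq_0: "s \<le> norm (y - a) \<Longrightarrow> 0 \<le> s \<Longrightarrow> bump a s y = 0"
  by (simp add: bump_def)

lemma bump_le: "bump a s y \<le> s ^ 4"
proof -
  have "max 0 (s\<^sup>2 - (norm (y - a))\<^sup>2) \<le> s\<^sup>2" by simp
  then have "(max 0 (s\<^sup>2 - (norm (y - a))\<^sup>2))\<^sup>2 \<le> (s\<^sup>2)\<^sup>2" by (intro power_mono) auto
  then show ?thesis by (simp add: bump_def)
qed

lemma norm_bump_grad_le:
  assumes "0 < s"
  shows "norm (bump_grad a s y) \<le> 4 * s ^ 3"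
proof (cases "norm (y - a) \<le> s")
  case True
  have "max 0 (s\<^sup>2 - (norm (y - a))\<^sup>2) \<le> s\<^sup>2" by simp
  then have "max 0 (s\<^sup>2 - (norm (y - a))\<^sup>2) * norm (y - a) \<le> s\<^sup>2 * s" using True by (intro mult_mono) auto
  then show ?thesis by (simp add: bump_grad_def power2_eq_square power3_eq_cube)
next
  case False
  then have "s\<^sup>2 \<le> (norm (y - a))\<^sup>2" using assms by (intro power_mono) auto
  then show ?thesis using assms by (simp add: bump_grad_def max_def)
qed

lemma bump_borel_measurable: "bump a s \<in> borel_measurable borel"
  using C1_continuous[OF bump_C1] by (rule borel_measurable_continuous_onI)

lemma integrable_bump_mult:
  fixes f :: "real ^ 'n::finite \<Rightarrow> real"
  assumes "continuous_on UNIV f" "0 \<le> s"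
  shows "integrable lebesgue (\<lambda>y. bump a s y * f y)"
proof -
  have c: "continuous_on UNIV (\<lambda>y. bump a s y * f y)" by (intro continuous_intros assms C1_continuous[OF bump_C1])
  have "bounded ((\<lambda>y. bump a s y * f y) ` cball a s)"
    by (intro compact_imp_bounded compact_continuous_image continuous_on_subset[OF c]) auto
  then obtain B where "\<forall>x\<in>cball a s. norm (bump a s x * f x) \<le> B"
    unfolding bounded_iff by blast
  then have B: "\<bar>bump a s y * f y\<bar> \<le> B" if "y \<in> cball a s" for y using that by simp
  have z: "bump a s y * f y = 0" if "y \<notin> cball a s" for y
    using that assms(2) by (simp add: bump_eq_0 dist_norm norm_minus_commute)
  have "\<bar>bump a s y * f y\<bar> \<le> max 0 B" for y
    by (cases "y \<in> cball a s"; use B[of y] z[of y] in force)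
  moreover have "bump a s y * f y = 0" if "norm a + s < norm y" for y
    by (rule z) (use that norm_triangle_ineq2[of y a] in \<open>auto simp: dist_norm norm_minus_commute\<close>)
  moreover have "(\<lambda>y. bump a s y * f y) \<in> borel_measurable borel" using c by (rule borel_measurable_continuous_onI)
  ultimately have "integrable lebesgue (\<lambda>y. (bump a s y * f y) *\<^sub>R (1::real))"
    by (intro integrable_compact_support_scaleR[OF locally_integrable_const, where L="max 0 B" and R="norm a + s"])
  then show ?thesis by simp
qed

definition bump_mass :: "'n::finite itself \<Rightarrow> real \<Rightarrow> real" where
  "bump_mass n s = (LINT y|lebesgue. bump (0 :: real ^ 'n) s y)"

lemma bump_integral: "(LINT y|lebesgue. bump (a :: real ^ 'n::finite) s y) = bump_mass TYPE('n) s"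
  using integral_lebesgue_translation[OF bump_borel_measurable[of 0 s], of "- a"]
  by (simp add: bump_mass_def bump_def)

text \<open>Reflection at \<open>a\<close> preserves the bump and changes the sign of
  \<open>b \<bullet> (y - a)\<close>, so the linear part integrates to zero and only the value at
  \<open>a\<close> remains.\<close>

lemma bump_integral_affine:
  fixes a :: "real ^ 'n::finite"
  assumes "0 \<le> s"
  shows "(LINT y|lebesgue. bump a s y * (\<alpha> + b \<bullet> y)) = bump_mass TYPE('n) s * (\<alpha> + b \<bullet> a)"
proof -
  have i1: "integrable lebesgue (\<lambda>y. bump a s y * (b \<bullet> (y - a)))" "integrable lebesgue (\<lambda>y. bump a s y * 1)"
    by (intro integrable_bump_mult assms continuous_intros)+
  have m: "(\<lambda>y. bump a s y * (b \<bullet> (y - a))) \<in> borel_measurable borel"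
    using bump_borel_measurable[of a s] by measurable
  have sym: "bump a s (2 *\<^sub>R a - y) = bump a s y" for y
  proof -
    have "2 *\<^sub>R a - y - a = - (y - a)" by (simp add: scaleR_2)
    then show ?thesis unfolding bump_def by (metis norm_minus_cancel)
  qed
  have "(LINT y|lebesgue. bump a s y * (b \<bullet> (y - a))) = (LINT y|lebesgue. bump a s (2 *\<^sub>R a - y) * (b \<bullet> (2 *\<^sub>R a - y - a)))"
    by (rule integral_lebesgue_reflection[OF m, symmetric])
  also have "\<dots> = (LINT y|lebesgue. - (bump a s y * (b \<bullet> (y - a))))"
    unfolding sym by (simp add: scaleR_2 inner_diff_right inner_add_right algebra_simps)
  finally have z: "(LINT y|lebesgue. bump a s y * (b \<bullet> (y - a))) = 0" by simp
  have "(LINT y|lebesgue. bump a s y * (\<alpha> + b \<bullet> y)) =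
      (LINT y|lebesgue. (\<alpha> + b \<bullet> a) * (bump a s y * 1) + bump a s y * (b \<bullet> (y - a)))"
    by (rule Bochner_Integration.integral_cong) (simp_all add: inner_diff_right algebra_simps)
  also have "\<dots> = (\<alpha> + b \<bullet> a) * (LINT y|lebesgue. bump a s y)"
    using i1 z by simp
  finally show ?thesis by (simp add: bump_integral)
qed

text \<open>On the ball of half the radius the bump is at least
  \<open>(3 / 4 * s\<^sup>2)\<^sup>2\<close>, which exceeds \<open>s ^ 4 / 2\<close>. With
  \<open>n\<close> the dimension, the denominator \<open>2 ^ (n + 1)\<close> collects this one half
  and the halved radius.\<close>

lemma bump_mass_ge:
  assumes "0 < s"
  shows "s ^ 4 * s ^ CARD('n) * (unit_ball_vol (real CARD('n)) / 2 ^ (CARD('n::finite) + 1)) \<le> bump_mass TYPE('n) s"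
proof -
  let ?B = "ball 0 (s / 2) :: (real ^ 'n) set"
  have "(LINT y|lebesgue. indicator ?B y * (s ^ 4 / 2)) \<le> (LINT y|lebesgue. bump (0 :: real ^ 'n) s y)"
  proof (rule integral_mono)
    show "integrable lebesgue (\<lambda>y. indicator ?B y * (s ^ 4 / 2))"
      using emeasure_lborel_ball_finite[of "0 :: real ^ 'n" "s / 2"]
      by (intro integrable_mult_left) (simp add: integrable_indicator_iff less_top)
    show "integrable lebesgue (bump (0 :: real ^ 'n) s)"
      using integrable_bump_mult[of "\<lambda>_. 1" s 0] assms by simp
    fix y :: "real ^ 'n"
    show "indicator ?B y * (s ^ 4 / 2) \<le> bump 0 s y"
    proof (cases "y \<in> ?B")
      case True
      then have "(norm y)\<^sup>2 \<le> (s / 2)\<^sup>2" by (intro power_mono) auto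
      then have "3 / 4 * s\<^sup>2 \<le> s\<^sup>2 - (norm (y - 0))\<^sup>2" by (simp add: power_divide)
      then have "3 / 4 * s\<^sup>2 \<le> max 0 (s\<^sup>2 - (norm (y - 0))\<^sup>2)" by (rule max.coboundedI2)
      then have "(3 / 4 * s\<^sup>2)\<^sup>2 \<le> bump 0 s y" unfolding bump_def by (intro power_mono) auto
      moreover have "s ^ 4 / 2 \<le> (3 / 4 * s\<^sup>2)\<^sup>2" by (simp add: power_mult_distrib power_divide)
      ultimately show ?thesis using True by simp
    qed (simp add: bump_nonneg)
  qed
  moreover have "(LINT y|lebesgue. indicator ?B y * (s ^ 4 / 2)) = measure lebesgue ?B * (s ^ 4 / 2)"
    by simp
  moreover have "measure lebesgue ?B = unit_ball_vol (real CARD('n)) * (s / 2) ^ CARD('n)"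
    using content_ball[of "s / 2" "0 :: real ^ 'n"] assms by simp
  ultimately show ?thesis by (simp add: bump_mass_def power_divide field_simps)
qed

lemma C1_linear_combination:
  assumes "C1 f f'" "C1 g g'"
  shows "C1 (\<lambda>x. a * f x + b * g x) (\<lambda>x. a *\<^sub>R f' x + b *\<^sub>R g' x)"
proof -
  have "((\<lambda>x. a * f x + b * g x) has_derivative (\<lambda>h. (a *\<^sub>R f' x + b *\<^sub>R g' x) \<bullet> h)) (at x)" for x
  proof -
    have "(f has_derivative (\<lambda>h. f' x \<bullet> h)) (at x)" "(g has_derivative (\<lambda>h. g' x \<bullet> h)) (at x)"
      using assms by (auto simp: C1_def)
    from has_derivative_add[OF has_derivative_mult_right[OF this(1), of a] has_derivative_mult_right[OF this(2), of b]]
    show ?thesis by (simp add: inner_add_left)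
  qed
  moreover have "continuous_on UNIV (\<lambda>x. a *\<^sub>R f' x + b *\<^sub>R g' x)"
    using assms by (intro continuous_intros) (auto simp: C1_def)
  ultimately show ?thesis by (simp add: C1_def)
qed

text \<open>\<open>K\<close> is uniform in \<open>T\<close>, \<open>r\<close> and \<open>v\<close>,
  so it can depend on the dimension only. The powers of \<open>r\<close> are those of a function of
  integral one on the scale \<open>r\<close> and of its gradient. At a vertex \<open>v\<close>,
  integration against \<open>w\<close> is the functional dual to the hat functions on
  \<open>T\<close>.\<close>

definition dual_bump_bound :: "'n::finite itself \<Rightarrow> real \<Rightarrow> bool" where
  "dual_bump_bound _ K \<longleftrightarrow> (\<forall>(T :: (real ^ 'n::finite) set) c r v.
     convex T \<and> T \<in> sets lebesgue \<and> ball c r \<subseteq> T \<and> 0 < r \<and> v \<in> T \<longrightarrow>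
     (\<exists>w w'. C1 w w' \<and> (\<forall>y. y \<notin> interior T \<longrightarrow> w y = 0) \<and> (\<forall>y. \<bar>w y\<bar> \<le> K / r ^ CARD('n)) \<and>
        (\<forall>y. norm (w' y) \<le> K / r ^ (CARD('n) + 1)) \<and>
        (\<forall>\<alpha> b. (LINT y|lebesgue_on T. w y * (\<alpha> + b \<bullet> y)) = \<alpha> + b \<bullet> v)))"

text \<open>The mean of an affine function with respect to a symmetric bump is its value at the center. So, with
  \<open>m = (v + c) / 2\<close>, the combination \<open>2 \<beta>\<^sub>m - \<beta>\<^sub>c\<close> of normalized bumps evaluates affine functions at \<open>v\<close>.\<close>
lemma dual_bump: "\<exists>K>0. dual_bump_bound TYPE('n::finite) K"
proof -
  let ?n = "CARD('n)"
  define k where "k = unit_ball_vol (real ?n) / 2 ^ (?n + 1)"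
  have k: "0 < k" by (simp add: k_def unit_ball_vol_pos)
  \<comment> \<open>Dictated by the gradient bound \<open>12 / (s ^ (n + 1) * k)\<close> at
    \<open>s = r / 2\<close>, with \<open>n\<close> the dimension; the bound of the values is
    smaller.\<close>
  define K where "K = 24 * 2 ^ ?n / k"
  have K: "0 < K" using k by (simp add: K_def)
  show ?thesis
    unfolding dual_bump_bound_def
  proof (intro exI[of _ K] conjI K allI impI)
    fix T :: "(real ^ 'n) set" and c r v
    assume *: "convex T \<and> T \<in> sets lebesgue \<and> ball c r \<subseteq> T \<and> 0 < r \<and> v \<in> T"
    define s where "s = r / 2"
    have s: "0 < s" using * by (simp add: s_def)
    define J where "J = bump_mass TYPE('n) s"
    have Jge: "s ^ 4 * s ^ ?n * k \<le> J" unfolding J_def k_def by (rule bump_mass_ge[OF s])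
    have J: "0 < J" using Jge k s by (smt (verit) mult_pos_pos zero_less_power)
    define m where "m = (1 / 2) *\<^sub>R (v + c)"
    \<comment> \<open>This ball is the image of \<open>ball c r\<close> under the contraction by one
      half towards \<open>v\<close>, which convexity keeps inside \<open>T\<close>; hence the radius
      \<open>r / 2\<close>.\<close>
    have b1: "ball m s \<subseteq> T"
    proof
      fix y assume "y \<in> ball m s"
      then have y: "norm (y - m) < s" by (simp add: dist_norm norm_minus_commute)
      have "2 *\<^sub>R y - v - c = 2 *\<^sub>R (y - m)" by (simp add: m_def algebra_simps)
      then have "norm (2 *\<^sub>R y - v - c) < r" using y by (simp add: s_def)
      then have "2 *\<^sub>R y - v \<in> ball c r" by (simp add: dist_norm norm_minus_commute)
      then have "2 *\<^sub>R y - v \<in> T" using * by blast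
      then have "(1 / 2) *\<^sub>R v + (1 / 2) *\<^sub>R (2 *\<^sub>R y - v) \<in> T"
        using * by (intro convexD[of T]) auto
      then show "y \<in> T" by (simp add: algebra_simps)
    qed
    have b2: "ball c s \<subseteq> T" using * by (auto simp: s_def)
    have int: "ball m s \<subseteq> interior T" "ball c s \<subseteq> interior T"
      using b1 b2 interior_maximal[OF _ open_ball] by metis+
    define w where "w y = (2 / J) * bump m s y + (- 1 / J) * bump c s y" for y
    define w' where "w' y = (2 / J) *\<^sub>R bump_grad m s y + (- 1 / J) *\<^sub>R bump_grad c s y" for y
    have C: "C1 w w'"
      using C1_linear_combination[OF bump_C1 bump_C1] unfolding w_def[abs_def] w'_def[abs_def] .
    have z: "w y = 0" if "y \<notin> interior T" for y
    proof -
      have "y \<notin> ball m s" "y \<notin> ball c s" using that int by auto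
      then show ?thesis using s by (simp add: w_def bump_eq_0 dist_norm norm_minus_commute)
    qed
    have bw: "\<bar>w y\<bar> \<le> K / r ^ ?n" for y
    proof -
      have "\<bar>w y\<bar> \<le> (2 / J) * s ^ 4 + (1 / J) * s ^ 4"
        using bump_le[of m s y] bump_le[of c s y] bump_nonneg[of m s y] bump_nonneg[of c s y] J
        unfolding w_def by (intro order_trans[OF abs_triangle_ineq] add_mono)
          (auto simp: abs_mult intro!: divide_right_mono)
      also have "\<dots> = 3 * s ^ 4 / J" by (simp add: field_simps)
      also have "\<dots> \<le> 3 * s ^ 4 / (s ^ 4 * s ^ ?n * k)"
        using Jge s k J by (intro divide_left_mono) auto
      also have "\<dots> = 3 / (s ^ ?n * k)" using s by (simp add: field_simps)
      also have "\<dots> = 3 * 2 ^ ?n / k / r ^ ?n" using * k by (simp add: s_def power_divide field_simps)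
      also have "\<dots> \<le> K / r ^ ?n" unfolding K_def using * k by (intro divide_right_mono) auto
      finally show ?thesis .
    qed
    have bw': "norm (w' y) \<le> K / r ^ (?n + 1)" for y
    proof -
      have "norm (w' y) \<le> (2 / J) * (4 * s ^ 3) + (1 / J) * (4 * s ^ 3)"
        using norm_bump_grad_le[OF s, of m y] norm_bump_grad_le[OF s, of c y] J
        unfolding w'_def by (intro order_trans[OF norm_triangle_ineq] add_mono)
          (auto intro!: divide_right_mono)
      also have "\<dots> = 12 * s ^ 3 / J" by (simp add: field_simps)
      also have "\<dots> \<le> 12 * s ^ 3 / (s ^ 4 * s ^ ?n * k)"
        using Jge s k J by (intro divide_left_mono) auto
      also have "\<dots> = 12 / (s ^ (?n + 1) * k)" using s by (simp add: field_simps eval_nat_numeral)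
      also have "\<dots> = K / r ^ (?n + 1)" using * k by (simp add: K_def s_def power_divide field_simps)
      finally show ?thesis .
    qed
    have aff: "(LINT y|lebesgue_on T. w y * (\<alpha> + b \<bullet> y)) = \<alpha> + b \<bullet> v" for \<alpha> b
    proof -
      have i: "integrable lebesgue (\<lambda>y. bump a s y * (\<alpha> + b \<bullet> y))" for a
        using s by (intro integrable_bump_mult continuous_intros) simp
      have "(LINT y|lebesgue_on T. w y * (\<alpha> + b \<bullet> y)) = (LINT y|lebesgue. w y * (\<alpha> + b \<bullet> y))"
        by (rule integral_lebesgue_on_support) (use * z interior_subset in \<open>auto simp: subset_iff\<close>)
      also have "\<dots> = (LINT y|lebesgue. (2 / J) * (bump m s y * (\<alpha> + b \<bullet> y)) + (- 1 / J) * (bump c s y * (\<alpha> + b \<bullet> y)))"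
        by (rule Bochner_Integration.integral_cong) (simp_all only: w_def distrib_right mult.assoc)
      also have "\<dots> = (2 / J) * (LINT y|lebesgue. bump m s y * (\<alpha> + b \<bullet> y)) + (- 1 / J) * (LINT y|lebesgue. bump c s y * (\<alpha> + b \<bullet> y))"
        using integrable_mult_right[OF i, of "2 / J" m] integrable_mult_right[OF i, of "- 1 / J" c] i
        by (subst Bochner_Integration.integral_add) simp_all
      also have "\<dots> = 2 * (\<alpha> + b \<bullet> m) - (\<alpha> + b \<bullet> c)"
        unfolding bump_integral_affine[OF less_imp_le[OF s]] J_def[symmetric] using J by (simp add: field_simps)
      also have "\<dots> = \<alpha> + b \<bullet> v" by (simp add: m_def inner_add_right add_divide_distrib)
      finally show ?thesis .
    qed
    show "\<exists>w w'. C1 w w' \<and> (\<forall>y. y \<notin> interior T \<longrightarrow> w y = 0) \<and> (\<forall>y. \<bar>w y\<bar> \<le> K / r ^ ?n) \<and>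
        (\<forall>y. norm (w' y) \<le> K / r ^ (?n + 1)) \<and>
        (\<forall>\<alpha> b. (LINT y|lebesgue_on T. w y * (\<alpha> + b \<bullet> y)) = \<alpha> + b \<bullet> v)"
      using C z bw bw' aff by blast
  qed
qed

section \<open>The energy and its minimizers\<close>

lemma borel_measurable_lebesgue_null_support:
  fixes f :: "real ^ 'n::finite \<Rightarrow> 'b::euclidean_space"
  assumes N: "negligible N" and f: "\<And>x. x \<notin> N \<Longrightarrow> f x = 0"
  shows "f \<in> borel_measurable lebesgue"
proof (rule measurableI)
  fix A :: "'b set"
  have s: "Q \<in> sets lebesgue" if "Q \<subseteq> N" for Q
    using negligible_subset[OF N that] by (rule negligible_imp_sets)
  show "f -` A \<inter> space lebesgue \<in> sets lebesgue"
  proof (cases "0 \<in> A")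
    case True
    then have "f -` A \<inter> space lebesgue = UNIV - {x \<in> N. f x \<notin> A}" using f by auto
    moreover have "UNIV - {x \<in> N. f x \<notin> A} \<in> sets lebesgue"
      using s[of "{x \<in> N. f x \<notin> A}"] by (intro sets.Diff) auto
    ultimately show ?thesis by simp
  next
    case False
    have "x \<in> N" if "f x \<in> A" for x using f[of x] that False by (cases "x \<in> N") auto
    then have "f -` A \<inter> space lebesgue = {x \<in> N. f x \<in> A}" by auto
    then show ?thesis using s[of "{x \<in> N. f x \<in> A}"] by simp
  qed
qed auto

text \<open>Only partial derivatives are given, no total derivative. Replacing the coordinates of
  \<open>x\<close> by those of \<open>y\<close> one at a time stays inside the box and costs one
  mean value estimate in one variable each.\<close>

lemma coordinate_difference_bound:
  fixes f :: "real ^ 'n::finite \<Rightarrow> real"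
  assumes der: "\<And>x i. x \<in> box a b \<Longrightarrow> ((\<lambda>t. f (x + t *\<^sub>R axis i 1)) has_real_derivative d i x) (at 0)"
    and bound: "\<And>x i. x \<in> box a b \<Longrightarrow> \<bar>d i x\<bar> \<le> B i"
    and xy: "x \<in> box a b" "y \<in> box a b"
  shows "\<bar>f y - f x\<bar> \<le> (\<Sum>i\<in>UNIV. B i * \<bar>y $ i - x $ i\<bar>)"
proof -
  define z where "z I = (\<chi> j. if j \<in> I then y $ j else x $ j)" for I
  have zbox: "z I + t *\<^sub>R axis i 1 \<in> box a b" if "i \<notin> I" "t \<in> closed_segment 0 (y $ i - x $ i)" for I i t
  proof -
    have "x $ i + t \<in> closed_segment (x $ i) (y $ i)"
      using that(2) closed_segment_translation_eq[of "x $ i" t 0 "y $ i - x $ i"] by simp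
    moreover have "a $ i < x $ i" "x $ i < b $ i" "a $ i < y $ i" "y $ i < b $ i"
      using xy by (simp_all add: mem_box_cart)
    ultimately have "a $ i < x $ i + t \<and> x $ i + t < b $ i"
      by (auto simp: closed_segment_eq_real_ivl split: if_splits)
    then show ?thesis
      using xy that(1) by (auto simp: mem_box_cart z_def axis_def)
  qed
  have "\<bar>f (z I) - f x\<bar> \<le> (\<Sum>i\<in>I. B i * \<bar>y $ i - x $ i\<bar>)" if "finite I" for I
    using that
  proof (induction I rule: finite_induct)
    case empty
    have "z {} = x" by (simp add: z_def vec_eq_iff)
    then show ?case by simp
  next
    case (insert i I)
    let ?c = "y $ i - x $ i"
    have zi: "z (insert i I) = z I + ?c *\<^sub>R axis i 1"
      using insert(2) by (auto simp: z_def vec_eq_iff axis_def)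
    have "norm (f (z I + ?c *\<^sub>R axis i 1) - f (z I + 0 *\<^sub>R axis i 1)) \<le> B i * norm (?c - 0)"
    proof (rule field_differentiable_bound[where S="closed_segment 0 ?c" and f="\<lambda>t. f (z I + t *\<^sub>R axis i 1)"
          and f'="\<lambda>t. d i (z I + t *\<^sub>R axis i 1)"])
      fix t assume t: "t \<in> closed_segment 0 ?c"
      have "((\<lambda>h. f (z I + t *\<^sub>R axis i 1 + h *\<^sub>R axis i 1)) has_real_derivative d i (z I + t *\<^sub>R axis i 1)) (at 0)"
        by (rule der[OF zbox[OF insert(2) t]])
      then have "((\<lambda>h. f (z I + (h + t) *\<^sub>R axis i 1)) has_real_derivative d i (z I + t *\<^sub>R axis i 1)) (at 0)"
        by (simp add: scaleR_add_left add_ac)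
      then have "((\<lambda>t. f (z I + t *\<^sub>R axis i 1)) has_real_derivative d i (z I + t *\<^sub>R axis i 1)) (at t)"
        using DERIV_shift[of "\<lambda>t. f (z I + t *\<^sub>R axis i 1)" "d i (z I + t *\<^sub>R axis i 1)" 0 t] by (simp add: add.commute)
      then show "((\<lambda>t. f (z I + t *\<^sub>R axis i 1)) has_real_derivative d i (z I + t *\<^sub>R axis i 1)) (at t within closed_segment 0 ?c)"
        by (rule has_field_derivative_at_within)
      show "norm (d i (z I + t *\<^sub>R axis i 1)) \<le> B i"
        using bound[OF zbox[OF insert(2) t]] by simp
    qed auto
    then have "\<bar>f (z (insert i I)) - f (z I)\<bar> \<le> B i * \<bar>?c\<bar>" by (simp add: zi)
    then show ?case using insert by simp
  qed
  from this[of UNIV] show ?thesis by (simp add: z_def)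
qed

text \<open>The bounds of the first derivatives make \<open>V\<close> Lipschitz in the open cell,
  hence continuous there; the boundary of the cell is null, so the values on it are harmless for
  Lebesgue measurability.\<close>

lemma admissible_potential_measurable:
  fixes V :: "real ^ 'n::finite \<Rightarrow> real"
  assumes V: "admissible_potential Vmin Vmax C \<delta> V"
  shows "V \<in> borel_measurable (lebesgue_on Omega)"
proof -
  let ?U = "interior Omega :: (real ^ 'n) set"
  obtain D where D: "\<And>x. x \<in> ?U \<Longrightarrow> D (\<lambda>_. 0) x = V x"
    "\<And>x s i. x \<in> ?U \<Longrightarrow> ((\<lambda>t. D s (x + t *\<^sub>R axis i 1)) has_real_derivative D (s(i := Suc (s i))) x) (at 0)"
    "\<And>x s. x \<in> ?U \<Longrightarrow> \<bar>D s x\<bar> \<le> C s / \<delta> ^ (\<Sum>i\<in>UNIV. s i)"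
    using V unfolding admissible_potential_def by blast
  define s1 where "s1 i = (\<lambda>_. 0)(i := Suc 0)" for i :: 'n
  define B where "B i = C (s1 i) / \<delta> ^ (\<Sum>j\<in>UNIV. s1 i j)" for i
  have lip: "\<bar>V y - V x\<bar> \<le> (\<Sum>i\<in>UNIV. \<bar>B i\<bar>) * dist y x" if "x \<in> ?U" "y \<in> ?U" for x y
  proof -
    have "\<bar>D (\<lambda>_. 0) y - D (\<lambda>_. 0) x\<bar> \<le> (\<Sum>i\<in>UNIV. B i * \<bar>y $ i - x $ i\<bar>)"
    proof (rule coordinate_difference_bound[where d="\<lambda>i. D (s1 i)"])
      show "x \<in> box 0 (\<chi> i. 2 * pi)" "y \<in> box 0 (\<chi> i. 2 * pi)" using that by (simp_all add: interior_Omega)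
      fix z :: "real ^ 'n" and i assume "z \<in> box 0 (\<chi> i. 2 * pi)"
      then have z: "z \<in> ?U" by (simp add: interior_Omega)
      show "((\<lambda>t. D (\<lambda>_. 0) (z + t *\<^sub>R axis i 1)) has_real_derivative D (s1 i) z) (at 0)"
        using D(2)[OF z, of "\<lambda>_. 0" i] by (simp add: s1_def)
      show "\<bar>D (s1 i) z\<bar> \<le> B i" using D(3)[OF z, of "s1 i"] by (simp add: B_def)
    qed
    also have "\<dots> \<le> (\<Sum>i\<in>UNIV. \<bar>B i\<bar> * dist y x)"
    proof (rule sum_mono)
      fix i
      have "\<bar>y $ i - x $ i\<bar> \<le> dist y x" using component_le_norm_cart[of "y - x" i] by (simp add: dist_norm)
      then show "B i * \<bar>y $ i - x $ i\<bar> \<le> \<bar>B i\<bar> * dist y x" by (intro mult_mono) auto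
    qed
    finally show ?thesis using D(1) that by (simp add: sum_distrib_right)
  qed
  have "continuous_on ?U V"
  proof (rule lipschitz_on_continuous_on[OF lipschitz_onI])
    show "dist (V x) (V y) \<le> (\<Sum>i\<in>UNIV. \<bar>B i\<bar>) * dist x y" if "x \<in> ?U" "y \<in> ?U" for x y
      using lip[OF that(2,1)] by (simp add: dist_real_def)
  qed (simp add: sum_nonneg)
  then have "(\<lambda>x. indicator ?U x *\<^sub>R V x) \<in> borel_measurable borel"
    by (intro borel_measurable_continuous_on_indicator) auto
  then have m1: "(\<lambda>x. indicator ?U x *\<^sub>R V x) \<in> borel_measurable lebesgue" by (simp add: measurable_completion)
  have m2: "(\<lambda>x. indicator (Omega - ?U) x *\<^sub>R V x) \<in> borel_measurable lebesgue"
    by (rule borel_measurable_lebesgue_null_support[OF negligible_Omega_minus_interior]) auto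
  have "(\<lambda>x. indicator ?U x *\<^sub>R V x + indicator (Omega - ?U) x *\<^sub>R V x) \<in> borel_measurable lebesgue"
    using m1 m2 by (rule borel_measurable_add)
  moreover have "(\<lambda>x. indicator ?U x *\<^sub>R V x + indicator (Omega - ?U) x *\<^sub>R V x) = (\<lambda>x. indicator Omega x *\<^sub>R V x)"
    using interior_subset[of Omega] by (intro ext) (auto simp: indicator_def of_bool_def)
  ultimately show ?thesis
    using borel_measurable_restrict_space_iff[of Omega lebesgue V] by simp
qed

section \<open>Integrability of products of square integrable functions\<close>

lemma integrable_norm_mult:
  fixes f :: "real ^ 'n::finite \<Rightarrow> 'b::euclidean_space" and g :: "real ^ 'n \<Rightarrow> 'c::euclidean_space"
  assumes "square_integrable_on f S" "square_integrable_on g S"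
  shows "integrable (lebesgue_on S) (\<lambda>x. norm (f x) * norm (g x))"
proof (rule Bochner_Integration.integrable_bound)
  show "integrable (lebesgue_on S) (\<lambda>x. (norm (f x))\<^sup>2 + (norm (g x))\<^sup>2)"
    using assms by (simp add: square_integrable_on_def)
  show "(\<lambda>x. norm (f x) * norm (g x)) \<in> borel_measurable (lebesgue_on S)"
  proof -
    have [measurable]: "f \<in> borel_measurable (lebesgue_on S)" "g \<in> borel_measurable (lebesgue_on S)"
      using assms by (simp_all add: square_integrable_on_def)
    show ?thesis by measurable
  qed
  show "AE x in lebesgue_on S. norm (norm (f x) * norm (g x)) \<le> norm ((norm (f x))\<^sup>2 + (norm (g x))\<^sup>2)"
  proof (rule AE_I2)
    fix x
    have "0 \<le> norm (f x) * norm (g x)" "2 * (norm (f x) * norm (g x)) \<le> (norm (f x))\<^sup>2 + (norm (g x))\<^sup>2"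
      using sum_squares_bound[of "norm (f x)" "norm (g x)"] by (simp_all add: mult.assoc)
    then have "norm (f x) * norm (g x) \<le> (norm (f x))\<^sup>2 + (norm (g x))\<^sup>2" by linarith
    then show "norm (norm (f x) * norm (g x)) \<le> norm ((norm (f x))\<^sup>2 + (norm (g x))\<^sup>2)" by simp
  qed
qed

lemma integrable_norm_mult_bound:
  fixes f :: "real ^ 'n::finite \<Rightarrow> 'b::euclidean_space" and g :: "real ^ 'n \<Rightarrow> 'c::euclidean_space"
    and h :: "real ^ 'n \<Rightarrow> 'd::euclidean_space"
  assumes "square_integrable_on f S" "square_integrable_on g S" "h \<in> borel_measurable (lebesgue_on S)"
    and "\<And>x. x \<in> S \<Longrightarrow> norm (h x) \<le> B * (norm (f x) * norm (g x))"
  shows "integrable (lebesgue_on S) h"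
proof (rule Bochner_Integration.integrable_bound)
  show "integrable (lebesgue_on S) (\<lambda>x. B * (norm (f x) * norm (g x)))"
    using integrable_norm_mult[OF assms(1,2)] by simp
  show "AE x in lebesgue_on S. norm (h x) \<le> norm (B * (norm (f x) * norm (g x)))"
  proof (rule AE_I2)
    fix x assume "x \<in> space (lebesgue_on S)"
    then have "norm (h x) \<le> B * (norm (f x) * norm (g x))" using assms(4) by simp
    then show "norm (h x) \<le> norm (B * (norm (f x) * norm (g x)))" by simp
  qed
qed (rule assms)

lemma integrable_inner:
  fixes f g :: "real ^ 'n::finite \<Rightarrow> 'b::euclidean_space"
  assumes "square_integrable_on f S" "square_integrable_on g S"
  shows "integrable (lebesgue_on S) (\<lambda>x. f x \<bullet> g x)"
  by (rule integrable_norm_mult_bound[OF assms, where B=1])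
     (use assms Cauchy_Schwarz_ineq2 in \<open>auto simp: square_integrable_on_def intro!: borel_measurable_inner\<close>)

lemma integrable_mult_cnj:
  fixes v w :: "real ^ 'n::finite \<Rightarrow> complex"
  assumes "square_integrable_on v S" "square_integrable_on w S"
  shows "integrable (lebesgue_on S) (\<lambda>x. v x * cnj (w x))"
proof (rule integrable_norm_mult_bound[OF assms, where B=1])
  have "(\<lambda>x. cnj (w x)) \<in> borel_measurable (lebesgue_on S)"
    by (rule borel_measurable_continuous_on[where g=w])
       (use assms(2) in \<open>auto intro!: continuous_intros simp: square_integrable_on_def\<close>)
  then show "(\<lambda>x. v x * cnj (w x)) \<in> borel_measurable (lebesgue_on S)"
    using assms(1) by (intro borel_measurable_times) (simp_all add: square_integrable_on_def)
qed (simp add: norm_mult)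

lemma inner_complex_eq_Re: "v \<bullet> w = Re (v * cnj w)"
  by (simp add: inner_complex_def)

lemma H1P_square_integrable:
  assumes "w \<in> H1P"
  shows "square_integrable_on w Omega" "square_integrable_on (grad w) Omega"
  using H1P_periodic_gradient[OF assms] by (auto simp: periodic_gradient_def)

text \<open>The real part of the energy form, written with real inner products. Perturbing a
  minimizer by real multiples of a direction gives information on exactly this real part.\<close>

definition energy :: "real \<Rightarrow> (real ^ 'n::finite \<Rightarrow> real) \<Rightarrow> (real ^ 'n \<Rightarrow> complex) \<Rightarrow> (real ^ 'n \<Rightarrow> complex) \<Rightarrow> real" where
  "energy \<epsilon> V v w = (LINT x|lebesgue_on Omega. \<epsilon>\<^sup>2 / 2 * (grad v x \<bullet> grad w x) + V x * (v x \<bullet> w x))"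

locale bounded_potential =
  fixes V :: "real ^ 'n::finite \<Rightarrow> real" and Vmax :: real
  assumes V_bounds: "\<And>x. x \<in> Omega \<Longrightarrow> 0 \<le> V x \<and> V x \<le> Vmax"
    and V_measurable: "V \<in> borel_measurable (lebesgue_on Omega)"
begin

lemma integrable_V_inner:
  fixes v w :: "real ^ 'n \<Rightarrow> complex"
  assumes "square_integrable_on v Omega" "square_integrable_on w Omega"
  shows "integrable (lebesgue_on Omega) (\<lambda>x. V x * (v x \<bullet> w x))"
proof (rule integrable_norm_mult_bound[OF assms, where B=Vmax])
  show "(\<lambda>x. V x * (v x \<bullet> w x)) \<in> borel_measurable (lebesgue_on Omega)"
    using assms V_measurable by (intro borel_measurable_times borel_measurable_inner) (simp_all add: square_integrable_on_def)
  show "norm (V x * (v x \<bullet> w x)) \<le> Vmax * (norm (v x) * norm (w x))" if "x \<in> Omega" for x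
    using V_bounds[OF that] Cauchy_Schwarz_ineq2[of "v x" "w x"]
    by (simp add: abs_mult mult_mono)
qed

lemma integrable_energy:
  assumes "v \<in> H1P" "w \<in> H1P"
  shows "integrable (lebesgue_on Omega) (\<lambda>x. \<epsilon>\<^sup>2 / 2 * (grad v x \<bullet> grad w x) + V x * (v x \<bullet> w x))"
  by (intro Bochner_Integration.integrable_add integrable_mult_right integrable_V_inner integrable_inner
      H1P_square_integrable assms)

lemma Re_energy_form:
  assumes v: "v \<in> H1P" and w: "w \<in> H1P"
  shows "Re (energy_form \<epsilon> V v w) = energy \<epsilon> V v w"
proof -
  note sv = H1P_square_integrable[OF v] and sw = H1P_square_integrable[OF w]
  have m: "v \<in> borel_measurable (lebesgue_on Omega)" "grad v \<in> borel_measurable (lebesgue_on Omega)"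
    "w \<in> borel_measurable (lebesgue_on Omega)" "grad w \<in> borel_measurable (lebesgue_on Omega)"
    using sv sw by (auto simp: square_integrable_on_def)
  have cm: "(\<lambda>x. cnj (f x)) \<in> borel_measurable M" if "f \<in> borel_measurable M" for f and M :: "'a measure"
    by (rule borel_measurable_continuous_on[OF _ that]) (intro continuous_intros)
  have i1: "integrable (lebesgue_on Omega) (\<lambda>x. \<Sum>i\<in>UNIV. grad v x $ i * cnj (grad w x $ i))"
  proof (intro Bochner_Integration.integrable_sum)
    fix i
    show "integrable (lebesgue_on Omega) (\<lambda>x. grad v x $ i * cnj (grad w x $ i))"
    proof (rule integrable_norm_mult_bound[OF sv(2) sw(2), where B=1])
      show "(\<lambda>x. grad v x $ i * cnj (grad w x $ i)) \<in> borel_measurable (lebesgue_on Omega)"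
        by (intro borel_measurable_times cm borel_measurable_vec_nth m)
      show "norm (grad v x $ i * cnj (grad w x $ i)) \<le> 1 * (norm (grad v x) * norm (grad w x))" for x
        by (simp add: norm_mult mult_mono Finite_Cartesian_Product.norm_nth_le)
    qed
  qed
  have i2: "integrable (lebesgue_on Omega) (\<lambda>x. complex_of_real (V x) * v x * cnj (w x))"
  proof (rule integrable_norm_mult_bound[OF sv(1) sw(1), where B=Vmax])
    have "(\<lambda>x. complex_of_real (V x)) \<in> borel_measurable (lebesgue_on Omega)"
      by (rule borel_measurable_continuous_on[OF _ V_measurable]) (intro continuous_intros)
    then show "(\<lambda>x. complex_of_real (V x) * v x * cnj (w x)) \<in> borel_measurable (lebesgue_on Omega)"
      by (intro borel_measurable_times cm m)
    show "norm (complex_of_real (V x) * v x * cnj (w x)) \<le> Vmax * (norm (v x) * norm (w x))" if "x \<in> Omega" for x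
      using V_bounds[OF that] by (simp add: norm_mult mult.assoc mult_right_mono)
  qed
  have "Re (energy_form \<epsilon> V v w) = \<epsilon>\<^sup>2 / 2 * Re (LINT x|lebesgue_on Omega. (\<Sum>i\<in>UNIV. grad v x $ i * cnj (grad w x $ i)))
     + Re (LINT x|lebesgue_on Omega. complex_of_real (V x) * v x * cnj (w x))"
  proof -
    have "Re (complex_of_real c * z) = c * Re z" for c z by simp
    then show ?thesis unfolding energy_form_def L2inner_def plus_complex.sel by (simp only:)
  qed
  also have "Re (LINT x|lebesgue_on Omega. (\<Sum>i\<in>UNIV. grad v x $ i * cnj (grad w x $ i))) = (LINT x|lebesgue_on Omega. grad v x \<bullet> grad w x)"
    using integral_Re[OF i1] by (simp add: inner_vec_def inner_complex_eq_Re)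
  also have "Re (LINT x|lebesgue_on Omega. complex_of_real (V x) * v x * cnj (w x)) = (LINT x|lebesgue_on Omega. V x * (v x \<bullet> w x))"
  proof -
    have "Re (complex_of_real (V x) * v x * cnj (w x)) = V x * (v x \<bullet> w x)" for x
      by (simp add: inner_complex_def algebra_simps)
    then show ?thesis using integral_Re[OF i2] by simp
  qed
  finally show ?thesis
    unfolding energy_def using integrable_V_inner[OF sv(1) sw(1)] integrable_inner[OF sv(2) sw(2)]
    by simp
qed

section \<open>Variation of the constrained minimizer\<close>

lemma quadratic_nonneg_imp_linear_eq_0:
  fixes b c :: real
  assumes "\<And>t. 0 \<le> 2 * t * b + t\<^sup>2 * c"
  shows "b = 0"
proof (rule ccontr)
  assume b: "b \<noteq> 0"
  \<comment> \<open>\<open>k\<close> dominates \<open>c\<close> and is positive also for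
    \<open>c = 0\<close>; at \<open>t = - b / k\<close> the negative linear term is twice the upper
    bound of the quadratic one.\<close>
  define k where "k = 1 + \<bar>c\<bar>"
  define t where "t = - b / k"
  have k: "0 < k" "c \<le> k" by (auto simp: k_def)
  have "t\<^sup>2 * c \<le> t\<^sup>2 * k" using k by (intro mult_left_mono) auto
  moreover have "t\<^sup>2 * k = b\<^sup>2 / k" "2 * t * b = - 2 * (b\<^sup>2 / k)"
    using k by (simp_all add: t_def power2_eq_square)
  moreover have "0 < b\<^sup>2 / k" using b k by simp
  ultimately have "2 * t * b + t\<^sup>2 * c < 0" by linarith
  with assms[of t] show False by linarith
qed

text \<open>Euler equation of the constrained minimum: \<open>\<psi> + t w\<close> satisfies the
  same constraints for all real \<open>t\<close>, so its energy, a quadratic polynomial in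
  \<open>t\<close>, is minimal at 0.\<close>

lemma energy_orthogonal:
  assumes \<psi>: "multiscale_basis_function \<T> \<phi> \<epsilon> V p \<psi>" and w: "w \<in> H1P"
    and \<phi>: "\<And>q. q \<in> mesh_nodes \<T> \<Longrightarrow> square_integrable_on (\<phi> q) Omega"
    and w0: "\<And>q. q \<in> mesh_nodes \<T> \<Longrightarrow> L2inner w (\<phi> q) = 0"
  shows "energy \<epsilon> V \<psi> w = 0"
proof (rule quadratic_nonneg_imp_linear_eq_0)
  fix t :: real
  have \<psi>H: "\<psi> \<in> H1P" and \<psi>0: "\<And>q. q \<in> mesh_nodes \<T> \<Longrightarrow> L2inner \<psi> (\<phi> q) = (if p = q then 1 else 0)"
    and min: "\<And>u. u \<in> H1P \<Longrightarrow> (\<And>q. q \<in> mesh_nodes \<T> \<Longrightarrow> L2inner u (\<phi> q) = (if p = q then 1 else 0)) \<Longrightarrow>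
      Re (energy_form \<epsilon> V \<psi> \<psi>) \<le> Re (energy_form \<epsilon> V u u)"
    using \<psi> unfolding multiscale_basis_function_def is_arg_min_def by (auto simp: not_less)
  define u where "u x = \<psi> x + complex_of_real t * w x" for x
  have pg: "periodic_gradient u (\<lambda>x. grad \<psi> x + complex_of_real t *s grad w x)"
    unfolding u_def by (intro periodic_gradient_add periodic_gradient_cmult H1P_periodic_gradient \<psi>H w)
  have uH: "u \<in> H1P" and ug: "AE x in lebesgue_on Omega. grad u x = grad \<psi> x + t *\<^sub>R grad w x"
  proof -
    have "complex_of_real t *s v = t *\<^sub>R v" for v :: "complex ^ 'n"
      by (simp add: vec_eq_iff complex_eq_iff)
    then show "u \<in> H1P" "AE x in lebesgue_on Omega. grad u x = grad \<psi> x + t *\<^sub>R grad w x"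
      using periodic_gradient_imp_H1P[OF pg] by simp_all
  qed
  note s\<psi> = H1P_square_integrable[OF \<psi>H] and sw = H1P_square_integrable[OF w]
  have iL: "integrable (lebesgue_on Omega) (\<lambda>x. v x * cnj (\<phi> q x))"
    if "square_integrable_on v Omega" "q \<in> mesh_nodes \<T>" for v q
    by (rule integrable_mult_cnj[OF that(1) \<phi>[OF that(2)]])
  have "L2inner u (\<phi> q) = (if p = q then 1 else 0)" if q: "q \<in> mesh_nodes \<T>" for q
  proof -
    have "L2inner u (\<phi> q) = (LINT x|lebesgue_on Omega. \<psi> x * cnj (\<phi> q x) + complex_of_real t * (w x * cnj (\<phi> q x)))"
      by (simp add: L2inner_def u_def algebra_simps)
    also have "\<dots> = L2inner \<psi> (\<phi> q) + complex_of_real t * L2inner w (\<phi> q)"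
      using iL[OF s\<psi>(1) q] iL[OF sw(1) q] by (simp add: L2inner_def)
    finally show ?thesis using \<psi>0[OF q] w0[OF q] by simp
  qed
  then have "energy \<epsilon> V \<psi> \<psi> \<le> energy \<epsilon> V u u"
    using min[OF uH] by (simp add: Re_energy_form \<psi>H uH)
  have sq: "(a + t *\<^sub>R b) \<bullet> (a + t *\<^sub>R b) = a \<bullet> a + 2 * t * (a \<bullet> b) + t\<^sup>2 * (b \<bullet> b)"
    for a b :: "'x::real_inner"
    by (simp add: inner_add_left inner_add_right inner_commute[of b a] power2_eq_square algebra_simps)
  note \<open>energy \<epsilon> V \<psi> \<psi> \<le> energy \<epsilon> V u u\<close>
  also have "energy \<epsilon> V u u = (LINT x|lebesgue_on Omega.
      (\<epsilon>\<^sup>2 / 2 * (grad \<psi> x \<bullet> grad \<psi> x) + V x * (\<psi> x \<bullet> \<psi> x)) +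
      2 * t * (\<epsilon>\<^sup>2 / 2 * (grad \<psi> x \<bullet> grad w x) + V x * (\<psi> x \<bullet> w x)) +
      t\<^sup>2 * (\<epsilon>\<^sup>2 / 2 * (grad w x \<bullet> grad w x) + V x * (w x \<bullet> w x)))"
    unfolding energy_def
  proof (rule integral_cong_AE)
    show "AE x in lebesgue_on Omega. \<epsilon>\<^sup>2 / 2 * (grad u x \<bullet> grad u x) + V x * (u x \<bullet> u x) =
      (\<epsilon>\<^sup>2 / 2 * (grad \<psi> x \<bullet> grad \<psi> x) + V x * (\<psi> x \<bullet> \<psi> x)) +
      2 * t * (\<epsilon>\<^sup>2 / 2 * (grad \<psi> x \<bullet> grad w x) + V x * (\<psi> x \<bullet> w x)) +
      t\<^sup>2 * (\<epsilon>\<^sup>2 / 2 * (grad w x \<bullet> grad w x) + V x * (w x \<bullet> w x))"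
      using ug
    proof eventually_elim
      case (elim x)
      have "u x = \<psi> x + t *\<^sub>R w x" by (simp add: u_def scaleR_conv_of_real)
      then show ?case unfolding elim by (simp only: sq) (simp add: algebra_simps)
    qed
  qed (intro borel_measurable_integrable integrable_energy Bochner_Integration.integrable_add integrable_mult_right uH \<psi>H w)+
  also have "\<dots> = energy \<epsilon> V \<psi> \<psi> + 2 * t * energy \<epsilon> V \<psi> w + t\<^sup>2 * energy \<epsilon> V w w"
  proof -
    have lin: "(LINT x|lebesgue_on Omega. a x + 2 * t * b x + t\<^sup>2 * c x) =
       (LINT x|lebesgue_on Omega. a x) + 2 * t * (LINT x|lebesgue_on Omega. b x) + t\<^sup>2 * (LINT x|lebesgue_on Omega. c x)"
      if "integrable (lebesgue_on Omega) a" "integrable (lebesgue_on Omega) b" "integrable (lebesgue_on Omega) c"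
      for a b c :: "real ^ 'n \<Rightarrow> real"
      using that by simp
    show ?thesis
      unfolding energy_def
      by (rule lin[OF integrable_energy[OF \<psi>H \<psi>H] integrable_energy[OF \<psi>H w] integrable_energy[OF w w]])
  qed
  finally show "0 \<le> 2 * t * energy \<epsilon> V \<psi> w + t\<^sup>2 * energy \<epsilon> V w w" by simp
qed

end

section \<open>Geometric decay over layers\<close>

text \<open>Merges the decay \<open>E * \<theta> ^ m\<close> with a possibly large constant and the
  fixed gain \<open>\<theta>'\<close> into one pure power. For \<open>m \<le> 2 * N\<close> the
  fixed gain suffices, because the slow target rate has not yet fallen below \<open>\<mu>\<close>;
  beyond, at least half of the exponent remains after \<open>\<mu> ^ N\<close> has absorbed
  \<open>E\<close>.\<close>

lemma geometric_decay_rate: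
  fixes \<theta> \<theta>' E :: real
  assumes "0 \<le> \<theta>" "\<theta> < 1" "0 \<le> \<theta>'" "\<theta>' < 1" "0 \<le> E"
  shows "\<exists>\<beta>. 0 < \<beta> \<and> \<beta> < 1 \<and> (\<forall>m\<ge>1. min \<theta>' (E * \<theta> ^ m) \<le> (\<beta> ^ m)\<^sup>2)"
proof -
  \<comment> \<open>The lower bound \<open>1 / 2\<close> keeps the base positive when both rates are
    0.\<close>
  define \<mu> where "\<mu> = max (1 / 2) (max \<theta> \<theta>')"
  have mu: "0 < \<mu>" "\<mu> < 1" "\<theta> \<le> \<mu>" "\<theta>' \<le> \<mu>" using assms by (auto simp: \<mu>_def)
  have "(\<lambda>n. E * \<mu> ^ n) \<longlonglongrightarrow> E * 0"
    using mu by (intro tendsto_mult_left LIMSEQ_power_zero) auto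
  then have "\<forall>\<^sub>F n in sequentially. E * \<mu> ^ n < 1"
    by (intro order_tendstoD(2)) auto
  then obtain N0 where N0: "\<And>n. n \<ge> N0 \<Longrightarrow> E * \<mu> ^ n < 1" by (auto simp: eventually_sequentially)
  \<comment> \<open>The successor keeps \<open>N\<close> positive, since it becomes a denominator in
    the exponent.\<close>
  define N where "N = Suc N0"
  have N: "E * \<mu> ^ N < 1" "1 \<le> N" using N0[of N] by (auto simp: N_def)
  define \<beta> where "\<beta> = \<mu> powr (1 / (4 * real N))"
  have pw: "(\<beta> ^ m)\<^sup>2 = \<mu> powr (real m / (2 * real N))" for m
  proof -
    have "(\<beta> ^ m)\<^sup>2 = \<beta> ^ (2 * m)" by (simp add: power_mult[symmetric] mult.commute)
    also have "\<dots> = \<beta> powr (real (2 * m))" using mu by (subst powr_realpow) (auto simp: \<beta>_def)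
    also have "\<dots> = \<mu> powr (real m / (2 * real N))" unfolding \<beta>_def powr_powr using N by (simp add: field_simps)
    finally show ?thesis .
  qed
  have "min \<theta>' (E * \<theta> ^ m) \<le> (\<beta> ^ m)\<^sup>2" for m
  proof (cases "m \<le> 2 * N")
    case True
    have "\<theta>' \<le> \<mu> powr 1" using mu by simp
    also have "\<dots> \<le> \<mu> powr (real m / (2 * real N))"
      using mu True N by (intro powr_mono') (auto simp: divide_le_eq)
    finally show ?thesis unfolding pw by linarith
  next
    case False
    have "E * \<theta> ^ m \<le> E * \<mu> ^ m" using mu assms by (intro mult_left_mono power_mono) auto
    also have "\<dots> = (E * \<mu> ^ N) * \<mu> ^ (m - N)" using False by (simp add: power_add[symmetric])
    also have "\<dots> \<le> 1 * \<mu> ^ (m - N)" using N mu by (intro mult_right_mono) auto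
    also have "\<dots> = \<mu> powr real (m - N)" using mu by (simp add: powr_realpow)
    also have "\<dots> \<le> \<mu> powr (real m / (2 * real N))"
    proof (rule powr_mono')
      have "real m / (2 * real N) \<le> real m / 2" using N by (intro divide_left_mono) auto
      also have "\<dots> \<le> real (m - N)" using False by (simp add: of_nat_diff)
      finally show "real m / (2 * real N) \<le> real (m - N)" .
    qed (use mu in auto)
    finally show ?thesis unfolding pw by linarith
  qed
  moreover have "0 < \<beta>" "\<beta> < 1"
    unfolding \<beta>_def using mu N powr_less_mono2[of "1 / (4 * real N)" \<mu> 1] by auto
  ultimately show ?thesis by blast
qed

text \<open>Double counting: after exchanging the sums, each \<open>G\<close> is counted once for
  every neighbour in \<open>A\<close>, at most \<open>c\<close> times.\<close>

lemma sum_neighbours_le: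
  fixes g :: "'a \<Rightarrow> real"
  assumes "finite S" "A \<subseteq> S" "B \<subseteq> S" "\<And>T. T \<in> S \<Longrightarrow> 0 \<le> g T"
    and "\<And>G. G \<in> S \<Longrightarrow> real (card {T \<in> S. E T G}) \<le> c"
    and "\<And>T G. T \<in> A \<Longrightarrow> G \<in> S \<Longrightarrow> E T G \<Longrightarrow> G \<in> B"
  shows "(\<Sum>T\<in>A. \<Sum>G\<in>{G \<in> S. E T G}. g G) \<le> c * (\<Sum>G\<in>B. g G)"
proof -
  have fin: "finite A" "finite B" using finite_subset[OF assms(2,1)] finite_subset[OF assms(3,1)] by auto
  have "(\<Sum>T\<in>A. \<Sum>G\<in>{G \<in> S. E T G}. g G) = (\<Sum>T\<in>A. \<Sum>G\<in>B. if E T G then g G else 0)"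
  proof (rule sum.cong[OF refl])
    fix T assume T: "T \<in> A"
    have "{G \<in> S. E T G} = {G \<in> B. E T G}" using assms(3,6) T by blast
    then show "(\<Sum>G\<in>{G \<in> S. E T G}. g G) = (\<Sum>G\<in>B. if E T G then g G else 0)"
      using fin by (simp add: sum.inter_filter)
  qed
  also have "\<dots> = (\<Sum>G\<in>B. \<Sum>T\<in>A. if E T G then g G else 0)" by (rule sum.swap)
  also have "\<dots> \<le> (\<Sum>G\<in>B. c * g G)"
  proof (rule sum_mono)
    fix G assume G: "G \<in> B"
    have "(\<Sum>T\<in>A. if E T G then g G else 0) = (\<Sum>T\<in>{T \<in> A. E T G}. g G)"
      by (rule sum.inter_filter[OF fin(1), symmetric])
    also have "\<dots> = real (card {T \<in> A. E T G}) * g G" by simp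
    also have "\<dots> \<le> c * g G"
    proof (rule mult_right_mono)
      have "card {T \<in> A. E T G} \<le> card {T \<in> S. E T G}" using assms(1,2) by (intro card_mono) auto
      then show "real (card {T \<in> A. E T G}) \<le> c" using assms(3,5) G by (meson of_nat_le_iff order_trans subsetD)
    qed (use assms(3,4) G in auto)
    finally show "(\<Sum>T\<in>A. if E T G then g G else 0) \<le> c * g G" .
  qed
  also have "\<dots> = c * (\<Sum>G\<in>B. g G)" by (simp add: sum_distrib_left)
  finally show ?thesis .
qed

text \<open>In the application, \<open>S\<close> is the mesh, \<open>E\<close> its adjacency, \<open>A m\<close> the \<open>m\<close>-th layer around the support of a hat
  function, \<open>X\<close> the set of elements on which this hat function is not constant, and \<open>g\<close>, \<open>l\<close> are the squares of
  the norms of the gradient and, scaled by the mesh size, of the function.\<close>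
definition layered_sums ::
    "real \<Rightarrow> real \<Rightarrow> real \<Rightarrow> 'a set \<Rightarrow> ('a \<Rightarrow> real) \<Rightarrow> ('a \<Rightarrow> real) \<Rightarrow> ('a \<Rightarrow> 'a \<Rightarrow> bool) \<Rightarrow> (nat \<Rightarrow> 'a set) \<Rightarrow> 'a set \<Rightarrow> bool" where
  "layered_sums C Cp c S g l E A X \<longleftrightarrow>
    finite S \<and> (\<forall>T\<in>S. 0 \<le> g T \<and> 0 \<le> l T) \<and> (\<forall>T\<in>S. E T T) \<and> (\<forall>T G. E T G \<longrightarrow> E G T) \<and>
    (\<forall>G\<in>S. real (card {T \<in> S. E T G}) \<le> c) \<and>
    A 0 \<subseteq> S \<and> (\<forall>m. A (Suc m) = {G \<in> S. \<exists>T\<in>A m. E T G}) \<and> X \<subseteq> A 0 \<and>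
    (\<forall>T\<in>(S - A 0) \<union> X. l T \<le> Cp * (\<Sum>G\<in>{G \<in> S. E T G}. g G)) \<and>
    (\<Sum>T\<in>S - A 0. g T) \<le> C * (\<Sum>T\<in>X. g T + l T) \<and>
    (\<forall>m. (\<Sum>T\<in>S - A (Suc m). g T) \<le> C * (\<Sum>T\<in>A (Suc m) - A m. g T + l T))"

text \<open>The sums \<open>e m\<close> of \<open>g + l\<close> outside the \<open>m\<close>-th layer satisfy \<open>e (m + 1) \<le> D (e m - e (m + 1))\<close>, hence
  decay geometrically, but only up to a constant factor. The constant 1 for the small values of \<open>m\<close>
  comes from the separate bound of the sum outside the first layer.\<close>
lemma layer_decay:
  fixes C Cp c :: real
  assumes "0 \<le> C" "0 \<le> Cp" "0 \<le> c"
  shows "\<exists>\<beta>. 0 < \<beta> \<and> \<beta> < 1 \<and> (\<forall>S (g :: 'a \<Rightarrow> real) l E A X m. layered_sums C Cp c S g l E A X \<longrightarrow>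
    (\<Sum>T\<in>S - A m. g T) \<le> (\<beta> ^ m)\<^sup>2 * (\<Sum>T\<in>S. g T))"
proof -
  \<comment> \<open>With \<open>R\<close> the sum over the ring, the \<open>g\<close> part outside
    the next layer is at most \<open>C * R\<close>, and the \<open>l\<close> part at most
    \<open>Cp * c\<close> times the sum of that \<open>g\<close> part and \<open>R\<close>;
    \<open>D\<close> is the total factor.\<close>
  define D where "D = (1 + Cp * c) * C + Cp * c"
  \<comment> \<open>Factor of the starting estimate once \<open>l\<close> on \<open>X\<close> is
    replaced by \<open>g\<close> on \<open>A 1\<close>.\<close>
  define D' where "D' = C * (1 + Cp * c)"
  have D: "0 \<le> D" "0 \<le> D'" using assms by (auto simp: D_def D'_def)
  obtain \<beta> where \<beta>: "0 < \<beta>" "\<beta> < 1"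
    "\<And>m. m \<ge> 1 \<Longrightarrow> min (D' / (1 + D')) ((1 + Cp * c) * (D / (1 + D)) ^ m) \<le> (\<beta> ^ m)\<^sup>2"
    using geometric_decay_rate[of "D / (1 + D)" "D' / (1 + D')" "1 + Cp * c"] D assms by auto
  show ?thesis
    unfolding layered_sums_def
  proof (intro exI[of _ \<beta>] conjI \<beta> allI impI, elim conjE)
    fix S and g l :: "'a \<Rightarrow> real" and E A X m
    assume fin: "finite S" and pos: "\<forall>T\<in>S. 0 \<le> g T \<and> 0 \<le> l T" and refl: "\<forall>T\<in>S. E T T"
      and sym: "\<forall>T G. E T G \<longrightarrow> E G T" and card: "\<forall>G\<in>S. real (card {T \<in> S. E T G}) \<le> c"
      and A0: "A 0 \<subseteq> S" and ASuc: "\<forall>m. A (Suc m) = {G \<in> S. \<exists>T\<in>A m. E T G}" and X: "X \<subseteq> A 0"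
      and P: "\<forall>T\<in>(S - A 0) \<union> X. l T \<le> Cp * (\<Sum>G\<in>{G \<in> S. E T G}. g G)"
      and I0: "(\<Sum>T\<in>S - A 0. g T) \<le> C * (\<Sum>T\<in>X. g T + l T)"
      and Im: "\<forall>m. (\<Sum>T\<in>S - A (Suc m). g T) \<le> C * (\<Sum>T\<in>A (Suc m) - A m. g T + l T)"
    have AS: "A k \<subseteq> S" for k using A0 ASuc by (cases k) auto
    have Amono: "A k \<subseteq> A (Suc k)" for k using ASuc AS[of k] refl by auto
    have A0k: "A 0 \<subseteq> A k" for k by (induction k) (use Amono in auto)
    have finA: "finite (A k)" for k using AS fin finite_subset by blast
    let ?G = "\<Sum>T\<in>S. g T"
    have G0: "0 \<le> ?G" using pos by (intro sum_nonneg) auto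
    define e where "e k = (\<Sum>T\<in>S - A k. g T + l T)" for k
    \<comment> \<open>Summed form of the bound of \<open>l\<close> by \<open>g\<close> on
      neighbours; the overlap constant \<open>c\<close> is paid here, and \<open>B\<close> has to
      contain the neighbours of \<open>Q\<close>.\<close>
    have nb: "(\<Sum>T\<in>Q. l T) \<le> Cp * c * (\<Sum>G\<in>B. g G)"
      if "Q \<subseteq> (S - A 0) \<union> X" "B \<subseteq> S" "\<And>T G. T \<in> Q \<Longrightarrow> G \<in> S \<Longrightarrow> E T G \<Longrightarrow> G \<in> B" for Q B
    proof -
      have "(\<Sum>T\<in>Q. l T) \<le> (\<Sum>T\<in>Q. Cp * (\<Sum>G\<in>{G \<in> S. E T G}. g G))"
        using P that(1) by (intro sum_mono) auto
      also have "\<dots> = Cp * (\<Sum>T\<in>Q. \<Sum>G\<in>{G \<in> S. E T G}. g G)" by (simp add: sum_distrib_left)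
      also have "\<dots> \<le> Cp * (c * (\<Sum>G\<in>B. g G))"
      proof (rule mult_left_mono[OF sum_neighbours_le])
        show "Q \<subseteq> S" using that(1) A0 X by blast
      qed (use fin that pos card assms in auto)
      finally show ?thesis by (simp add: mult.assoc)
    qed
    have e0: "e 0 \<le> (1 + Cp * c) * ?G"
    proof -
      have "(\<Sum>T\<in>S - A 0. l T) \<le> Cp * c * ?G" by (rule nb) auto
      moreover have "(\<Sum>T\<in>S - A 0. g T) \<le> ?G" using fin pos by (intro sum_mono2) auto
      ultimately show ?thesis by (simp add: e_def sum.distrib algebra_simps)
    qed
    have step: "e (Suc k) \<le> D * (e k - e (Suc k))" for k
    proof -
      let ?R = "\<Sum>T\<in>A (Suc k) - A k. g T + l T" and ?g = "\<Sum>T\<in>S - A (Suc k). g T"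
      have split: "(\<Sum>T\<in>S - A k. f T) = (\<Sum>T\<in>S - A (Suc k). f T) + (\<Sum>T\<in>A (Suc k) - A k. f T)" for f :: "'a \<Rightarrow> real"
      proof -
        have "S - A k = (S - A (Suc k)) \<union> (A (Suc k) - A k)" using Amono[of k] AS[of "Suc k"] by blast
        then show ?thesis using fin finA by (simp only:) (rule sum.union_disjoint; auto)
      qed
      have R: "?R = e k - e (Suc k)" using split[of "\<lambda>T. g T + l T"] by (simp add: e_def)
      \<comment> \<open>By symmetry of \<open>E\<close>, the neighbours of an element outside layer
        \<open>k + 1\<close> are outside layer \<open>k\<close>: one ring is lost, and its
        \<open>g\<close> sum is part of \<open>?R\<close>.\<close>
      have "(\<Sum>T\<in>S - A (Suc k). l T) \<le> Cp * c * (\<Sum>T\<in>S - A k. g T)"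
      proof (rule nb)
        show "S - A (Suc k) \<subseteq> (S - A 0) \<union> X" using A0k by blast
        show "G \<in> S - A k" if "T \<in> S - A (Suc k)" "G \<in> S" "E T G" for T G
          using that sym ASuc by auto
      qed auto
      also have "(\<Sum>T\<in>S - A k. g T) \<le> ?g + ?R"
        unfolding split using pos AS[of "Suc k"] by (intro add_left_mono sum_mono) auto
      finally have l: "(\<Sum>T\<in>S - A (Suc k). l T) \<le> Cp * c * (?g + ?R)"
        using assms by (simp add: mult_left_mono)
      have g: "?g \<le> C * ?R" using Im by blast
      have "e (Suc k) = ?g + (\<Sum>T\<in>S - A (Suc k). l T)" by (simp add: e_def sum.distrib)
      also have "\<dots> \<le> (1 + Cp * c) * ?g + Cp * c * ?R" using l by (simp add: algebra_simps)
      also have "\<dots> \<le> (1 + Cp * c) * (C * ?R) + Cp * c * ?R"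
        using g assms by (intro add_right_mono mult_left_mono) auto
      also have "\<dots> = D * ?R" by (simp add: D_def algebra_simps)
      finally show ?thesis unfolding R .
    qed
    have ek: "e k \<le> (D / (1 + D)) ^ k * e 0" for k
    proof (induction k)
      case (Suc k)
      have "e (Suc k) \<le> D / (1 + D) * e k" using step[of k] D by (simp add: field_simps)
      also have "\<dots> \<le> D / (1 + D) * ((D / (1 + D)) ^ k * e 0)"
        using Suc D by (intro mult_left_mono) auto
      finally show ?case by simp
    qed simp
    have bound1: "(\<Sum>T\<in>S - A k. g T) \<le> (1 + Cp * c) * (D / (1 + D)) ^ k * ?G" for k
    proof -
      have "(\<Sum>T\<in>S - A k. g T) \<le> e k" unfolding e_def using pos by (intro sum_mono) auto
      also have "\<dots> \<le> (D / (1 + D)) ^ k * ((1 + Cp * c) * ?G)"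
        using ek[of k] e0 D by (meson divide_nonneg_nonneg add_nonneg_nonneg mult_left_mono order_trans zero_le_one zero_le_power)
      finally show ?thesis by (simp add: mult_ac)
    qed
    \<comment> \<open>Hole filling without a constant in front: the sum outside \<open>A 1\<close>
      is at most \<open>D'\<close> times the sum over \<open>A 1\<close>, which is the total minus
      it; solving gives the factor \<open>D' / (1 + D')\<close>.\<close>
    have bound2: "(\<Sum>T\<in>S - A k. g T) \<le> D' / (1 + D') * ?G" if "1 \<le> k" for k
    proof -
      let ?g = "\<Sum>T\<in>A 1. g T"
      have A1: "A 1 \<subseteq> A k" using that
      proof (induction k rule: dec_induct)
        case (step n) then show ?case using Amono[of n] by blast
      qed simp
      have "(\<Sum>T\<in>X. l T) \<le> Cp * c * ?g"
      proof (rule nb)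
        show "A 1 \<subseteq> S" by (rule AS)
        show "G \<in> A 1" if "T \<in> X" "G \<in> S" "E T G" for T G using that X ASuc by auto
      qed simp
      moreover have "(\<Sum>T\<in>X. g T) \<le> ?g"
        using finA X Amono[of 0] AS[of 1] pos by (intro sum_mono2) auto
      ultimately have "(\<Sum>T\<in>X. g T + l T) \<le> (1 + Cp * c) * ?g" by (simp add: sum.distrib algebra_simps)
      then have "C * (\<Sum>T\<in>X. g T + l T) \<le> D' * ?g"
        using mult_left_mono[OF _ assms(1)] by (simp add: D'_def mult.assoc)
      then have i: "(\<Sum>T\<in>S - A 0. g T) \<le> D' * ?g" using I0 by linarith
      have "(\<Sum>T\<in>S - A 1. g T) \<le> (\<Sum>T\<in>S - A 0. g T)" using fin pos Amono[of 0] by (intro sum_mono2) auto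
      moreover have "?g = ?G - (\<Sum>T\<in>S - A 1. g T)" using fin AS[of 1] by (simp add: sum_diff)
      ultimately have "(\<Sum>T\<in>S - A 1. g T) \<le> D' * (?G - (\<Sum>T\<in>S - A 1. g T))" using i by simp
      then have "(\<Sum>T\<in>S - A 1. g T) \<le> D' / (1 + D') * ?G" using D by (simp add: field_simps)
      moreover have "(\<Sum>T\<in>S - A k. g T) \<le> (\<Sum>T\<in>S - A 1. g T)" using fin pos A1 by (intro sum_mono2) auto
      ultimately show ?thesis by linarith
    qed
    show "(\<Sum>T\<in>S - A m. g T) \<le> (\<beta> ^ m)\<^sup>2 * ?G"
    proof (cases "m = 0")
      case True
      have "(\<Sum>T\<in>S - A 0. g T) \<le> ?G" using fin pos by (intro sum_mono2) auto
      then show ?thesis using True by simp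
    next
      case False
      then have m: "1 \<le> m" by simp
      have "(\<Sum>T\<in>S - A m. g T) \<le> min (D' / (1 + D')) ((1 + Cp * c) * (D / (1 + D)) ^ m) * ?G"
        using bound1[of m] bound2[OF m] G0 by (simp add: min_def)
      also have "\<dots> \<le> (\<beta> ^ m)\<^sup>2 * ?G" using \<beta>(3)[OF m] G0 by (intro mult_right_mono) auto
      finally show ?thesis .
    qed
  qed
qed

section \<open>The estimate outside a layer\<close>

lemma periodic_gradient_sum:
  assumes "finite I" "\<And>i. i \<in> I \<Longrightarrow> periodic_gradient (u i) (h i)"
  shows "periodic_gradient (\<lambda>x. \<Sum>i\<in>I. u i x) (\<lambda>x. \<Sum>i\<in>I. h i x)"
  using assms
proof (induction I rule: finite_induct)
  case empty
  then show ?case using periodic_gradient_const[of 0] by simp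
next
  case (insert i I)
  then show ?case using periodic_gradient_add[of "u i" "h i" "\<lambda>x. \<Sum>i\<in>I. u i x" "\<lambda>x. \<Sum>i\<in>I. h i x"] by simp
qed

text \<open>Cauchy-Schwarz against the constant 1, obtained from the nonnegativity of the integral
  of \<open>(f x - t)\<^sup>2\<close> with \<open>t\<close> the mean of \<open>f\<close>.\<close>

lemma integral_square_le:
  fixes f :: "real ^ 'n::finite \<Rightarrow> real"
  assumes T: "T \<in> lmeasurable" "0 < measure lebesgue T"
    and f: "integrable (lebesgue_on T) f" "integrable (lebesgue_on T) (\<lambda>x. (f x)\<^sup>2)"
  shows "(LINT x|lebesgue_on T. f x)\<^sup>2 \<le> measure lebesgue T * (LINT x|lebesgue_on T. (f x)\<^sup>2)"
proof -
  let ?m = "measure lebesgue T" and ?I = "LINT x|lebesgue_on T. f x"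
  define t where "t = ?I / ?m"
  have c: "integrable (lebesgue_on T) (\<lambda>x. t\<^sup>2)" "(LINT x|lebesgue_on T. t\<^sup>2) = t\<^sup>2 * ?m"
    using T(1) integrable_bounded_lebesgue_on[of "\<lambda>_. t\<^sup>2" T "t\<^sup>2"] by (simp_all add: measure_restrict_space fmeasurableD)
  have "0 \<le> (LINT x|lebesgue_on T. (f x - t)\<^sup>2)" by simp
  also have "\<dots> = (LINT x|lebesgue_on T. (f x)\<^sup>2 - (2 * t) * f x + t\<^sup>2)"
    by (rule Bochner_Integration.integral_cong) (simp_all add: power2_diff)
  also have "\<dots> = (LINT x|lebesgue_on T. (f x)\<^sup>2) - (2 * t) * ?I + t\<^sup>2 * ?m"
    using f c by simp
  also have "\<dots> = (LINT x|lebesgue_on T. (f x)\<^sup>2) - ?I\<^sup>2 / ?m"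
    using T(2) by (simp add: t_def power2_eq_square)
  finally show ?thesis using T(2) by (simp add: field_simps)
qed

lemma affine_const_gradient:
  fixes b :: "'a::real_inner"
  assumes "ball c r \<subseteq> T" "0 < r" "\<And>x. x \<in> T \<Longrightarrow> a + b \<bullet> x = k"
  shows "b = 0"
proof (rule ccontr)
  assume b: "b \<noteq> 0"
  define e where "e = (r / (2 * norm b)) *\<^sub>R b"
  have "norm e = r / 2" using b assms(2) by (simp add: e_def)
  then have "c + e \<in> ball c r" "c \<in> ball c r" using assms(2) by (auto simp: dist_norm)
  then have "a + b \<bullet> (c + e) = k" "a + b \<bullet> c = k" using assms by blast+
  then have "b \<bullet> e = 0" by (simp add: inner_add_right)
  then show False using b assms(2) by (simp add: e_def)
qed

lemma content_le_diameter:
  fixes T :: "(real ^ 'n::finite) set"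
  assumes "bounded T" "T \<in> lmeasurable" "diameter T \<le> H" "0 < H"
  shows "measure lebesgue T \<le> unit_ball_vol (real CARD('n)) * H ^ CARD('n)"
proof (cases "T = {}")
  case False
  then obtain x where x: "x \<in> T" by blast
  have "T \<subseteq> cball x H"
    using diameter_bounded_bound[OF assms(1) x] assms(3) by (force intro: order_trans)
  then have "measure lebesgue T \<le> measure lebesgue (cball x H)"
    using assms(2) by (intro measure_mono_fmeasurable) auto
  also have "\<dots> = unit_ball_vol (real CARD('n)) * H ^ CARD('n)"
    using content_cball[of H x] assms(4) by simp
  finally show ?thesis .
qed (use assms in simp)

context nodal_mesh
begin

text \<open>Vanishing off the open element makes the bump vanish on the boundary of the cell, so its
  restriction to the cell extends periodically without a jump. In the interior of any other element
  it is zero, and with it the gradient.\<close>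

lemma periodic_gradient_element_bump:
  assumes T: "T \<in> \<T>" and w: "C1 w w'" "\<And>y. y \<notin> interior T \<Longrightarrow> w y = 0" "\<And>y. \<bar>w y\<bar> \<le> B" "\<And>y. norm (w' y) \<le> B'"
  shows "\<exists>h. periodic_gradient (\<lambda>x. complex_of_real (w x) * c) h \<and>
    (\<forall>T'\<in>\<T>. \<forall>x\<in>interior T'. h x = (if T' = T then outer (w' x) c else 0))"
proof -
  have per: "w (wrap x) = w x" if x: "x \<in> Omega" for x
  proof (cases "x \<in> interior Omega")
    case False
    then have "wrap x \<notin> interior Omega" using wrap_interior_iff[OF x] by simp
    then show ?thesis using False w(2) mesh_interior_subset[OF T] by (metis subsetD)
  qed (simp add: wrap_interior)
  have "\<exists>f'. pwC1 (\<lambda>x. w (wrap x)) f' \<and> (\<forall>x. f' (wrap x) = f' x) \<and> (\<forall>T\<in>\<T>. \<forall>x\<in>interior T. f' x = w' x)"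
    by (rule mesh_function_pwC1[where F="\<lambda>_. w" and F'="\<lambda>_. w'" and L="max B B'"])
       (use w per in \<open>auto intro: max.coboundedI1 max.coboundedI2\<close>)
  then obtain f' where f': "pwC1 (\<lambda>x. w (wrap x)) f'" "\<And>x. f' (wrap x) = f' x"
    "\<And>T x. T \<in> \<T> \<Longrightarrow> x \<in> interior T \<Longrightarrow> f' x = w' x" by auto
  have "periodic_gradient (\<lambda>x. w (wrap x) *\<^sub>R c) (\<lambda>x. w (wrap x) *\<^sub>R 0 + outer (f' x) c)"
    by (rule periodic_gradient_mult[OF periodic_gradient_const f'(1) _ f'(2)]) simp
  then have "periodic_gradient (\<lambda>x. complex_of_real (w x) * c) (\<lambda>x. w (wrap x) *\<^sub>R 0 + outer (f' x) c)"
    by (rule periodic_gradient_cong) (simp add: per scaleR_conv_of_real)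
  moreover have "w (wrap x) *\<^sub>R 0 + outer (f' x) c = (if T' = T then outer (w' x) c else 0)"
    if T': "T' \<in> \<T>" "x \<in> interior T'" for T' x
  proof (cases "T' = T")
    case False
    have z: "w y = 0" if "y \<notin> - interior T'" for y
    proof (rule w(2))
      show "y \<notin> interior T" using that mesh_interior_disjoint[OF T T'(1)] False by blast
    qed
    have "w' x = 0"
      by (rule C1_zero_outside[where S="- interior T'", OF w(1) z]) (use T'(2) in auto)
    then show ?thesis using False f'(3)[OF T'] by (simp add: vec_eq_iff)
  qed (use f'(3)[OF T'] in simp)
  ultimately show ?thesis by (intro exI conjI ballI)
qed

text \<open>Only \<open>T\<close> contributes, and there \<open>\<phi> l\<close> is real and affine;
  the pairing is therefore \<open>c\<close> times the nodal value of \<open>\<phi> l\<close> at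
  \<open>v\<close>.\<close>

lemma L2inner_element_bump:
  assumes T: "T \<in> \<T>" and l: "l \<in> mesh_nodes \<T>" and w: "\<And>y. y \<notin> interior T \<Longrightarrow> w y = 0"
    and v: "v \<in> verts T" "\<And>\<alpha> b. (LINT y|lebesgue_on T. w y * (\<alpha> + b \<bullet> y)) = \<alpha> + b \<bullet> v"
  shows "L2inner (\<lambda>x. complex_of_real (w x) * c) (\<phi> l) = (if wrap v = l then c else 0)"
proof -
  have z: "w y = 0" if "y \<notin> T" for y using w interior_subset that by blast
  have "L2inner (\<lambda>x. complex_of_real (w x) * c) (\<phi> l) = (LINT x|lebesgue. complex_of_real (w x) * c * cnj (\<phi> l x))"
    unfolding L2inner_def by (rule integral_lebesgue_on_support) (use z mesh_subset[OF T] in auto)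
  also have "\<dots> = (LINT x|lebesgue_on T. complex_of_real (w x) * c * cnj (\<phi> l x))"
    by (rule integral_lebesgue_on_support[symmetric]) (use z mesh_sets[OF T] in auto)
  also have "\<dots> = (LINT x|lebesgue_on T. complex_of_real (w x * (hat_offset l T + hat_slope l T \<bullet> x)) * c)"
    by (rule Bochner_Integration.integral_cong) (use hat_affine[OF l T] in \<open>simp_all add: mult_ac\<close>)
  also have "\<dots> = complex_of_real (hat_offset l T + hat_slope l T \<bullet> v) * c"
    by (simp only: integral_mult_left_zero integral_complex_of_real v(2))
  also have "hat_offset l T + hat_slope l T \<bullet> v = hat l v"
    using hat_affine(1)[OF l T] verts_subset[OF T] v(1) by auto
  finally show ?thesis using hat_vertex[OF l T v(1)] by simp
qed

text \<open>One dual bump for each pair of an element of \<open>X\<close> and one of its nodes,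
  weighted by \<open>d\<close>. Bumps of different elements do not overlap, so the estimates are
  local; on one element there are at most \<open>n + 1\<close> of them, with \<open>n\<close> the
  dimension.\<close>

lemma correction_exists:
  assumes K: "dual_bump_bound TYPE('n) K" and X: "X \<subseteq> \<T>"
    and r: "0 < r" "\<And>T. T \<in> \<T> \<Longrightarrow> \<exists>c. ball c r \<subseteq> T"
    and d: "\<And>T k. T \<in> X \<Longrightarrow> k \<in> nodes T \<Longrightarrow> norm (d k T) \<le> P T"
  shows "\<exists>b h. periodic_gradient b h \<and>
    (\<forall>l\<in>mesh_nodes \<T>. L2inner b (\<phi> l) = (\<Sum>T\<in>X. if l \<in> nodes T then d l T else 0)) \<and>
    (\<forall>T\<in>\<T> - X. \<forall>x\<in>interior T. b x = 0 \<and> h x = 0) \<and>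
    (\<forall>T\<in>X. \<forall>x\<in>interior T. norm (b x) \<le> real (CARD('n) + 1) * (K / r ^ CARD('n)) * P T \<and>
       norm (h x) \<le> real (CARD('n) + 1) * (K / r ^ (CARD('n) + 1)) * P T)"
proof -
  \<comment> \<open>For every node of the element one vertex representing it is selected; identified
    vertices share a single bump, since \<open>\<phi> l\<close> takes the same value at
    them.\<close>
  define Q where "Q T k w w' \<longleftrightarrow> C1 w w' \<and> (\<forall>y. y \<notin> interior T \<longrightarrow> w y = 0) \<and> (\<forall>y. \<bar>w y\<bar> \<le> K / r ^ CARD('n)) \<and>
        (\<forall>y. norm (w' y) \<le> K / r ^ (CARD('n) + 1)) \<and>
        (\<exists>v\<in>verts T. wrap v = k \<and> (\<forall>\<alpha> b. (LINT y|lebesgue_on T. w y * (\<alpha> + b \<bullet> y)) = \<alpha> + b \<bullet> v))"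
    for T k and w :: "real ^ 'n \<Rightarrow> real" and w'
  have "\<exists>w w'. Q T k w w'" if T: "T \<in> X" and k: "k \<in> nodes T" for T k
  proof -
    have TT: "T \<in> \<T>" using X T by blast
    obtain v where v: "v \<in> verts T" "wrap v = k" using k by (auto simp: nodes_def)
    obtain c where c: "ball c r \<subseteq> T" using r(2)[OF TT] by blast
    have vT: "v \<in> T" using verts_subset[OF TT] v(1) by blast
    have "convex T \<and> T \<in> sets lebesgue \<and> ball c r \<subseteq> T \<and> 0 < r \<and> v \<in> T"
      using mesh_convex[OF TT] mesh_sets[OF TT] c r(1) vT by simp
    from K[unfolded dual_bump_bound_def, rule_format, OF this] show ?thesis unfolding Q_def using v by blast
  qed
  then have "\<forall>T k. \<exists>w w'. T \<in> X \<and> k \<in> nodes T \<longrightarrow> Q T k w w'" by blast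
  then obtain W W' where W: "\<And>T k. T \<in> X \<Longrightarrow> k \<in> nodes T \<Longrightarrow> Q T k (W T k) (W' T k)" by metis
  have finX: "finite X" using X finite_mesh finite_subset by blast
  have finN: "finite (nodes T)" if "T \<in> X" for T using finite_nodes X that by blast
  define u where "u T k x = complex_of_real (W T k x) * d k T" for T k x
  define R where "R T k h \<longleftrightarrow> periodic_gradient (u T k) h \<and>
     (\<forall>T'\<in>\<T>. \<forall>x\<in>interior T'. h x = (if T' = T then outer (W' T k x) (d k T) else 0))" for T k h
  have "\<exists>h. R T k h" if "T \<in> X" "k \<in> nodes T" for T k
  proof -
    have "T \<in> \<T>" using X that by blast
    from periodic_gradient_element_bump[OF this, of "W T k" "W' T k" "K / r ^ CARD('n)" "K / r ^ (CARD('n) + 1)" "d k T"]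
    show ?thesis using W[OF that] unfolding Q_def R_def u_def[abs_def] by blast
  qed
  then have "\<forall>T k. \<exists>h. T \<in> X \<and> k \<in> nodes T \<longrightarrow> R T k h" by blast
  then obtain hh where hh: "\<And>T k. T \<in> X \<Longrightarrow> k \<in> nodes T \<Longrightarrow> R T k (hh T k)" by metis
  define b where "b x = (\<Sum>T\<in>X. \<Sum>k\<in>nodes T. u T k x)" for x
  define h where "h x = (\<Sum>T\<in>X. \<Sum>k\<in>nodes T. hh T k x)" for x
  have pg: "periodic_gradient b h"
    unfolding b_def[abs_def] h_def[abs_def]
    by (intro periodic_gradient_sum finX finN) (use hh in \<open>auto simp: R_def\<close>)
  have L: "L2inner b (\<phi> l) = (\<Sum>T\<in>X. if l \<in> nodes T then d l T else 0)" if l: "l \<in> mesh_nodes \<T>" for l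
  proof -
    have i: "integrable (lebesgue_on Omega) (\<lambda>x. u T k x * cnj (\<phi> l x))" if "T \<in> X" "k \<in> nodes T" for T k
    proof (rule integrable_mult_cnj)
      show "square_integrable_on (u T k) Omega" using hh[OF that] by (simp add: R_def periodic_gradient_def)
      show "square_integrable_on (\<phi> l) Omega" by (rule H1P_square_integrable(1)[OF phi_H1P[OF l]])
    qed
    have "L2inner b (\<phi> l) = (LINT x|lebesgue_on Omega. (\<Sum>T\<in>X. \<Sum>k\<in>nodes T. u T k x * cnj (\<phi> l x)))"
      by (simp add: L2inner_def b_def sum_distrib_right)
    also have "\<dots> = (\<Sum>T\<in>X. \<Sum>k\<in>nodes T. L2inner (u T k) (\<phi> l))"
      unfolding L2inner_def
      by (subst Bochner_Integration.integral_sum, (intro Bochner_Integration.integrable_sum i; assumption),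
          intro sum.cong refl Bochner_Integration.integral_sum i)
    also have "\<dots> = (\<Sum>T\<in>X. \<Sum>k\<in>nodes T. if k = l then d k T else 0)"
    proof (intro sum.cong refl)
      fix T k assume Tk: "T \<in> X" "k \<in> nodes T"
      then have TT: "T \<in> \<T>" using X by blast
      obtain v where v: "v \<in> verts T" "wrap v = k" "\<And>\<alpha> b. (LINT y|lebesgue_on T. W T k y * (\<alpha> + b \<bullet> y)) = \<alpha> + b \<bullet> v"
        using W[OF Tk] unfolding Q_def by blast
      show "L2inner (u T k) (\<phi> l) = (if k = l then d k T else 0)"
        unfolding u_def[abs_def] using L2inner_element_bump[OF TT l _ v(1,3)] W[OF Tk] v(2) unfolding Q_def by simp
    qed
    also have "\<dots> = (\<Sum>T\<in>X. if l \<in> nodes T then d l T else 0)"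
      using finN by (intro sum.cong refl) simp
    finally show ?thesis .
  qed
  have local: "b x = (if T0 \<in> X then \<Sum>k\<in>nodes T0. u T0 k x else 0)"
    "h x = (if T0 \<in> X then \<Sum>k\<in>nodes T0. hh T0 k x else 0)" if T0: "T0 \<in> \<T>" "x \<in> interior T0" for T0 x
  proof -
    have zu: "u T k x = 0" if "T \<in> X" "k \<in> nodes T" "T \<noteq> T0" for T k
    proof -
      have "x \<notin> interior T" using mesh_interior_disjoint[OF _ T0(1) _ T0(2), of T] that X by blast
      then show ?thesis using W[OF that(1,2)] by (simp add: Q_def u_def)
    qed
    have zh: "hh T k x = 0" if "T \<in> X" "k \<in> nodes T" "T \<noteq> T0" for T k
      using hh[OF that(1,2)] that(3) T0 unfolding R_def by auto
    have "b x = (\<Sum>T\<in>X. if T = T0 then \<Sum>k\<in>nodes T. u T k x else 0)"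
      unfolding b_def by (intro sum.cong refl) (simp add: zu)
    then show "b x = (if T0 \<in> X then \<Sum>k\<in>nodes T0. u T0 k x else 0)" using finX by simp
    have "h x = (\<Sum>T\<in>X. if T = T0 then \<Sum>k\<in>nodes T. hh T k x else 0)"
      unfolding h_def by (intro sum.cong refl) (simp add: zh)
    then show "h x = (if T0 \<in> X then \<Sum>k\<in>nodes T0. hh T0 k x else 0)" using finX by simp
  qed
  have bound: "norm (b x) \<le> real (CARD('n) + 1) * (K / r ^ CARD('n)) * P T \<and>
       norm (h x) \<le> real (CARD('n) + 1) * (K / r ^ (CARD('n) + 1)) * P T" if T: "T \<in> X" "x \<in> interior T" for T x
  proof -
    have TT: "T \<in> \<T>" using X T by blast
    have P0: "0 \<le> P T" using d[OF T(1)] nodes_nonempty[OF TT] norm_ge_zero order_trans by blast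
    obtain k0 where "k0 \<in> nodes T" using nodes_nonempty[OF TT] by blast
    from W[OF T(1) this] have K0: "0 \<le> K / r ^ CARD('n)" "0 \<le> K / r ^ (CARD('n) + 1)"
      unfolding Q_def using abs_ge_zero norm_ge_zero order_trans by metis+
    have card: "real (card (nodes T)) \<le> real (CARD('n) + 1)" using card_nodes[OF TT] by simp
    have "norm (b x) \<le> (\<Sum>k\<in>nodes T. norm (u T k x))" using local(1)[OF TT T(2)] T(1) norm_sum by simp
    also have "\<dots> \<le> (\<Sum>k\<in>nodes T. K / r ^ CARD('n) * P T)"
    proof (rule sum_mono)
      fix k assume k: "k \<in> nodes T"
      have "\<bar>W T k x\<bar> \<le> K / r ^ CARD('n)" using W[OF T(1) k] by (simp add: Q_def)
      then show "norm (u T k x) \<le> K / r ^ CARD('n) * P T"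
        unfolding u_def norm_mult norm_of_real using d[OF T(1) k] K0 by (intro mult_mono) auto
    qed
    also have "\<dots> = real (card (nodes T)) * (K / r ^ CARD('n) * P T)" by simp
    also have "\<dots> \<le> real (CARD('n) + 1) * (K / r ^ CARD('n) * P T)"
      using card K0 P0 by (intro mult_right_mono mult_nonneg_nonneg) auto
    finally have 1: "norm (b x) \<le> real (CARD('n) + 1) * (K / r ^ CARD('n)) * P T" by (simp only: mult.assoc)
    have "norm (h x) \<le> (\<Sum>k\<in>nodes T. norm (hh T k x))" using local(2)[OF TT T(2)] T(1) norm_sum by simp
    also have "\<dots> \<le> (\<Sum>k\<in>nodes T. K / r ^ (CARD('n) + 1) * P T)"
    proof (rule sum_mono)
      fix k assume k: "k \<in> nodes T"
      have "norm (W' T k x) \<le> K / r ^ (CARD('n) + 1)" using W[OF T(1) k] unfolding Q_def by blast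
      moreover have "hh T k x = outer (W' T k x) (d k T)" using hh[OF T(1) k] TT T(2) unfolding R_def by auto
      ultimately show "norm (hh T k x) \<le> K / r ^ (CARD('n) + 1) * P T"
        unfolding \<open>hh T k x = _\<close> norm_outer using d[OF T(1) k] K0 by (intro mult_mono) auto
    qed
    also have "\<dots> = real (card (nodes T)) * (K / r ^ (CARD('n) + 1) * P T)" by simp
    also have "\<dots> \<le> real (CARD('n) + 1) * (K / r ^ (CARD('n) + 1) * P T)"
      using card K0 P0 by (intro mult_right_mono mult_nonneg_nonneg) auto
    finally have 2: "norm (h x) \<le> real (CARD('n) + 1) * (K / r ^ (CARD('n) + 1)) * P T" by (simp only: mult.assoc)
    from 1 2 show ?thesis by blast
  qed
  show ?thesis
  proof (intro exI[of _ b] exI[of _ h] conjI pg)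
    show "\<forall>l\<in>mesh_nodes \<T>. L2inner b (\<phi> l) = (\<Sum>T\<in>X. if l \<in> nodes T then d l T else 0)" using L by blast
    show "\<forall>T\<in>\<T> - X. \<forall>x\<in>interior T. b x = 0 \<and> h x = 0" using local by auto
  qed (use bound in blast)
qed

end

context periodic_mesh
begin

text \<open>The indicator of \<open>S\<close> is at most the sum of the indicators of the elements
  in \<open>F\<close>; overlaps only increase the right-hand side.\<close>

lemma integral_le_sum_elements:
  fixes f :: "real ^ 'n \<Rightarrow> real"
  assumes f: "integrable (lebesgue_on Omega) f" "\<And>x. 0 \<le> f x"
    and F: "F \<subseteq> \<T>" and S: "S \<in> sets lebesgue" "S \<subseteq> \<Union>F"
  shows "(LINT x|lebesgue_on S. f x) \<le> (\<Sum>T\<in>F. LINT x|lebesgue_on T. f x)"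
proof -
  have finF: "finite F" using F finite_mesh finite_subset by blast
  have SO: "S \<subseteq> Omega" using S(2) F Union_mesh by blast
  have iT: "integrable lebesgue (\<lambda>x. indicator T x *\<^sub>R f x)" if "T \<in> F" for T
  proof -
    have T: "T \<in> \<T>" using F that by blast
    show ?thesis using integrable_element[OF f(1) T] mesh_sets[OF T] by (simp add: integrable_restrict_space)
  qed
  have iS: "integrable lebesgue (\<lambda>x. indicator S x *\<^sub>R f x)"
    using lebesgue_on_subset_integrable[OF f(1) SO S(1) Omega_sets] S(1) by (simp add: integrable_restrict_space)
  have "(LINT x|lebesgue_on S. f x) = (LINT x|lebesgue. indicator S x *\<^sub>R f x)"
    using S(1) by (simp add: integral_restrict_space)
  also have "\<dots> \<le> (LINT x|lebesgue. (\<Sum>T\<in>F. indicator T x *\<^sub>R f x))"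
  proof (rule integral_mono[OF iS Bochner_Integration.integrable_sum[OF iT]])
    fix x
    have nn: "0 \<le> (\<Sum>T\<in>F. indicator T x *\<^sub>R f x)" using f(2) by (intro sum_nonneg) (simp add: indicator_def)
    show "indicator S x *\<^sub>R f x \<le> (\<Sum>T\<in>F. indicator T x *\<^sub>R f x)"
    proof (cases "x \<in> S")
      case True
      then obtain T where T: "T \<in> F" "x \<in> T" using S(2) by blast
      have "indicator T x *\<^sub>R f x \<le> (\<Sum>T\<in>F. indicator T x *\<^sub>R f x)"
        by (rule member_le_sum[OF T(1)]) (use finF f(2) in \<open>auto simp: indicator_def\<close>)
      then show ?thesis using True T(2) by simp
    qed (use nn in simp)
  qed
  also have "\<dots> = (\<Sum>T\<in>F. LINT x|lebesgue. indicator T x *\<^sub>R f x)"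
    by (rule Bochner_Integration.integral_sum[OF iT])
  also have "\<dots> = (\<Sum>T\<in>F. LINT x|lebesgue_on T. f x)"
    using F mesh_sets by (intro sum.cong refl) (auto simp: integral_restrict_space)
  finally show ?thesis .
qed

lemma nbhd_closed: "closed (nbhd \<T> S)"
  unfolding nbhd_def using finite_mesh mesh_compact compact_imp_closed by (intro closed_Union) auto

end

section \<open>Setting and constants of the layer estimate\<close>

lemma L2norm_nonneg: "0 \<le> L2norm S f"
  by (simp add: L2norm_def)

lemma L2norm_square: "(L2norm S f)\<^sup>2 = (LINT x|lebesgue_on S. (norm (f x))\<^sup>2)"
  by (simp add: L2norm_def)

text \<open>\<open>r\<close> and \<open>H\<close> are a common inner radius and a common diameter
  bound of the elements. With both as parameters it is visible that the layer constant sees the mesh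
  through \<open>H / r\<close> and, next to the potential, through \<open>H\<^sup>2\<close>.\<close>

locale multiscale_setting = nodal_mesh \<T> \<phi> + bounded_potential V Vmax
  for \<T> :: "(real ^ 'n::finite) set set" and \<phi> and V and Vmax +
  fixes \<epsilon> :: real and p :: "real ^ 'n" and \<psi> :: "real ^ 'n \<Rightarrow> complex" and r H K :: real
  assumes eps: "0 < \<epsilon>" and psi: "multiscale_basis_function \<T> \<phi> \<epsilon> V p \<psi>" and p: "p \<in> mesh_nodes \<T>"
    and r: "0 < r" "\<And>T. T \<in> \<T> \<Longrightarrow> \<exists>c. ball c r \<subseteq> T"
    and H: "0 < H" "\<And>T. T \<in> \<T> \<Longrightarrow> diameter T \<le> H"
    and K: "0 < K" "dual_bump_bound TYPE('n) K"
begin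

definition gr :: "(real ^ 'n) set \<Rightarrow> real" where
  "gr T = (LINT x|lebesgue_on T. (norm (grad \<psi> x))\<^sup>2)"

definition ls :: "(real ^ 'n) set \<Rightarrow> real" where
  "ls T = (LINT x|lebesgue_on T. (norm (\<psi> x))\<^sup>2) / H\<^sup>2"

lemma gr_nonneg: "0 \<le> gr T"
  by (simp add: gr_def)

lemma ls_nonneg: "0 \<le> ls T"
  by (simp add: ls_def)

lemma psi_H1P: "\<psi> \<in> H1P"
  and psi_L2inner: "q \<in> mesh_nodes \<T> \<Longrightarrow> L2inner \<psi> (\<phi> q) = (if p = q then 1 else 0)"
  using psi unfolding multiscale_basis_function_def is_arg_min_def by auto

lemma psi_square_integrable: "square_integrable_on \<psi> Omega" "square_integrable_on (grad \<psi>) Omega"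
  using H1P_square_integrable[OF psi_H1P] by auto

lemma psi_element:
  assumes "T \<in> \<T>"
  shows "square_integrable_on \<psi> T" "square_integrable_on (grad \<psi>) T"
  using square_integrable_element[OF _ assms] psi_square_integrable by auto

lemma phi_square_integrable: "q \<in> mesh_nodes \<T> \<Longrightarrow> square_integrable_on (\<phi> q) Omega"
  using H1P_square_integrable(1) phi_H1P by blast

lemma measure_element:
  assumes "T \<in> \<T>"
  shows "0 < measure lebesgue T" "measure lebesgue T \<le> unit_ball_vol (real CARD('n)) * H ^ CARD('n)"
proof -
  obtain c where "ball c r \<subseteq> T" using r(2)[OF assms] by blast
  then have "measure lebesgue (ball c r) \<le> measure lebesgue T"
    using mesh_lmeasurable[OF assms] by (intro measure_mono_fmeasurable) auto
  moreover have "0 < measure lebesgue (ball c r)" using r(1) by (simp add: content_ball_pos)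
  ultimately show "0 < measure lebesgue T" by linarith
  show "measure lebesgue T \<le> unit_ball_vol (real CARD('n)) * H ^ CARD('n)"
    using content_le_diameter[OF compact_imp_bounded[OF mesh_compact[OF assms]] mesh_lmeasurable[OF assms] H(2)[OF assms] H(1)] .
qed

text \<open>One term each for the slope \<open>1 / r\<close> of the cutoff acting on
  \<open>\<psi>\<close>, for the gradient of the correction, and for the potential acting on the
  correction. The factor \<open>\<epsilon>\<^sup>2 / 4\<close> is the
  \<open>\<epsilon>\<^sup>2 / 2\<close> of the energy halved by Young's inequality;
  \<open>unit_ball_vol\<close> comes from the measure of an element.\<close>

definition layer_const :: real where
  "layer_const = \<epsilon>\<^sup>2 / 4 * (H / r)
     + \<epsilon>\<^sup>2 / 4 * (real (CARD('n) + 1) * K * unit_ball_vol (real CARD('n)) * (H / r) ^ (CARD('n) + 1))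
     + Vmax * (real (CARD('n) + 1) * K * unit_ball_vol (real CARD('n)) * (H / r) ^ CARD('n) * H\<^sup>2)"

definition psi_mass :: "(real ^ 'n) set \<Rightarrow> real" where
  "psi_mass T = (LINT x|lebesgue_on T. norm (\<psi> x))"

text \<open>Pointwise majorant of the terms without a sign in the energy density of
  \<open>\<psi>\<close> and the test function on a mixed element. The factor
  \<open>psi_mass T\<close> bounds the coefficients of the correction, which are weighted integrals
  of \<open>\<psi>\<close> over \<open>T\<close>.\<close>

definition layer_bound :: "(real ^ 'n) set \<Rightarrow> real ^ 'n \<Rightarrow> real" where
  "layer_bound T x = \<epsilon>\<^sup>2 / 2 * (norm (grad \<psi> x) * norm (\<psi> x) / r
     + norm (grad \<psi> x) * (real (CARD('n) + 1) * (K / r ^ (CARD('n) + 1)) * psi_mass T))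
     + Vmax * (norm (\<psi> x) * (real (CARD('n) + 1) * (K / r ^ CARD('n)) * psi_mass T))"

lemma Vmax_nonneg: "0 \<le> Vmax"
  using V_bounds[OF wrap_in_Omega] order_trans by blast

lemma integrable_norm_psi:
  assumes "T \<in> \<T>"
  shows "integrable (lebesgue_on T) (\<lambda>x. norm (\<psi> x))" "integrable (lebesgue_on T) (\<lambda>x. norm (grad \<psi> x))"
  using square_integrable_integrable[OF _ mesh_lmeasurable[OF assms]] psi_element[OF assms] by auto

lemma integrable_layer_bound: "T \<in> \<T> \<Longrightarrow> integrable (lebesgue_on T) (layer_bound T)"
  unfolding layer_bound_def
  using integrable_norm_psi integrable_norm_mult[OF psi_element(2,1)] by simp

text \<open>Products of \<open>\<psi>\<close> and its gradient are split by Young's inequality with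
  weight \<open>H\<close>, which produces \<open>gr + ls\<close>. The masses are turned into squares
  by Cauchy-Schwarz on the element, whose measure is at most that of a ball of radius
  \<open>H\<close>.\<close>

lemma layer_bound_le:
  assumes T: "T \<in> \<T>"
  shows "(LINT x|lebesgue_on T. layer_bound T x) \<le> layer_const * (gr T + ls T)"
proof -
  let ?n = "CARD('n)" and ?N = "real (CARD('n) + 1)" and ?w = "unit_ball_vol (real CARD('n))"
  let ?m = "measure lebesgue T"
  define P where "P = psi_mass T"
  define G where "G = (LINT x|lebesgue_on T. norm (grad \<psi> x))"
  define I where "I = (LINT x|lebesgue_on T. norm (grad \<psi> x) * norm (\<psi> x))"
  have iI: "integrable (lebesgue_on T) (\<lambda>x. norm (grad \<psi> x) * norm (\<psi> x))"
    by (rule integrable_norm_mult[OF psi_element(2,1)[OF T]])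
  note i = integrable_norm_psi[OF T]
  have sq: "integrable (lebesgue_on T) (\<lambda>x. (norm (\<psi> x))\<^sup>2)" "integrable (lebesgue_on T) (\<lambda>x. (norm (grad \<psi> x))\<^sup>2)"
    using psi_element[OF T] by (auto simp: square_integrable_on_def)
  have P0: "0 \<le> P" "0 \<le> G" by (simp_all add: P_def G_def psi_mass_def)
  have gl: "0 \<le> gr T" "0 \<le> ls T" by (rule gr_nonneg ls_nonneg)+
  have w: "0 \<le> ?w" by simp
  have m: "0 < ?m" "?m \<le> ?w * H ^ ?n" using measure_element[OF T] by auto
  have I: "I \<le> H / 2 * (gr T + ls T)"
  proof -
    have "I \<le> (LINT x|lebesgue_on T. H / 2 * ((norm (grad \<psi> x))\<^sup>2 + (norm (\<psi> x))\<^sup>2 / H\<^sup>2))"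
      unfolding I_def
    proof (rule integral_mono[OF iI])
      fix x
      have "0 \<le> (norm (grad \<psi> x) - norm (\<psi> x) / H)\<^sup>2" by simp
      then have "2 * (norm (grad \<psi> x) * (norm (\<psi> x) / H)) \<le> (norm (grad \<psi> x))\<^sup>2 + (norm (\<psi> x))\<^sup>2 / H\<^sup>2"
        by (simp add: power2_diff power_divide)
      then have "H / 2 * (2 * (norm (grad \<psi> x) * (norm (\<psi> x) / H))) \<le> H / 2 * ((norm (grad \<psi> x))\<^sup>2 + (norm (\<psi> x))\<^sup>2 / H\<^sup>2)"
        using H(1) by (intro mult_left_mono) auto
      then show "norm (grad \<psi> x) * norm (\<psi> x) \<le> H / 2 * ((norm (grad \<psi> x))\<^sup>2 + (norm (\<psi> x))\<^sup>2 / H\<^sup>2)"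
        using H(1) by simp
    qed (use sq in simp)
    also have "\<dots> = H / 2 * (gr T + ls T)" using sq by (simp add: gr_def ls_def)
    finally show ?thesis .
  qed
  have PP: "P\<^sup>2 \<le> ?w * H ^ ?n * H\<^sup>2 * ls T"
  proof -
    have "P\<^sup>2 \<le> ?m * (LINT x|lebesgue_on T. (norm (\<psi> x))\<^sup>2)"
      unfolding P_def psi_mass_def by (rule integral_square_le[OF mesh_lmeasurable[OF T] m(1) i(1) sq(1)])
    also have "(LINT x|lebesgue_on T. (norm (\<psi> x))\<^sup>2) = H\<^sup>2 * ls T" using H(1) by (simp add: ls_def)
    also have "?m * (H\<^sup>2 * ls T) \<le> (?w * H ^ ?n) * (H\<^sup>2 * ls T)" using m(2) gl by (intro mult_right_mono) auto
    finally show ?thesis by (simp add: mult_ac)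
  qed
  have GG: "G\<^sup>2 \<le> ?w * H ^ ?n * gr T"
  proof -
    have "G\<^sup>2 \<le> ?m * gr T"
      unfolding G_def gr_def by (rule integral_square_le[OF mesh_lmeasurable[OF T] m(1) i(2) sq(2)])
    also have "\<dots> \<le> (?w * H ^ ?n) * gr T" using m(2) gl by (intro mult_right_mono) auto
    finally show ?thesis .
  qed
  have PG: "P * G \<le> ?w * H ^ (?n + 1) * (gr T + ls T) / 2"
  proof -
    have "0 \<le> (G - P / H)\<^sup>2" by simp
    then have "2 * (P * G) / H \<le> G\<^sup>2 + P\<^sup>2 / H\<^sup>2" by (simp add: power2_diff power_divide mult_ac)
    also have "\<dots> \<le> ?w * H ^ ?n * gr T + ?w * H ^ ?n * ls T"
      using GG PP H(1) by (intro add_mono) (simp_all add: divide_le_eq mult_ac)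
    finally have "2 * (P * G) \<le> (?w * H ^ ?n * gr T + ?w * H ^ ?n * ls T) * H" using H(1) by (simp add: divide_le_eq)
    then show ?thesis by (simp add: algebra_simps)
  qed
  have "(LINT x|lebesgue_on T. layer_bound T x) =
      \<epsilon>\<^sup>2 / 2 * (I / r + G * (?N * (K / r ^ (?n + 1)) * P)) + Vmax * (P * (?N * (K / r ^ ?n) * P))"
    unfolding layer_bound_def P_def[symmetric] using i iI
    by (simp add: I_def G_def P_def[unfolded psi_mass_def])
  also have "\<dots> = \<epsilon>\<^sup>2 / 2 * (I / r) + \<epsilon>\<^sup>2 / 2 * (?N * (K / r ^ (?n + 1)) * (P * G)) + Vmax * (?N * (K / r ^ ?n) * P\<^sup>2)"
    by (simp add: power2_eq_square algebra_simps)
  also have "\<dots> \<le> \<epsilon>\<^sup>2 / 2 * (H / 2 * (gr T + ls T) / r)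
      + \<epsilon>\<^sup>2 / 2 * (?N * (K / r ^ (?n + 1)) * (?w * H ^ (?n + 1) * (gr T + ls T) / 2))
      + Vmax * (?N * (K / r ^ ?n) * (?w * H ^ ?n * H\<^sup>2 * (gr T + ls T)))"
  proof (intro add_mono mult_left_mono divide_right_mono I PG Vmax_nonneg)
    have "?w * H ^ ?n * H\<^sup>2 * ls T \<le> ?w * H ^ ?n * H\<^sup>2 * (gr T + ls T)"
      using gl w H(1) by (intro mult_left_mono mult_nonneg_nonneg) auto
    then show "P\<^sup>2 \<le> ?w * H ^ ?n * H\<^sup>2 * (gr T + ls T)" using PP by linarith
  qed (use r(1) K(1) in auto)
  also have "\<dots> = layer_const * (gr T + ls T)"
  proof -
    have "e / 2 * (h / 2 * s / q) + e / 2 * (k0 * (k1 / q1) * (k2 * h1 * s / 2)) + v * (k0 * (k1 / q0) * (k2 * h0 * h2 * s))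
      = (e / 4 * (h / q) + e / 4 * (k0 * k1 * k2 * (h1 / q1)) + v * (k0 * k1 * k2 * (h0 / q0) * h2)) * s"
      for e h s q k0 k1 q1 k2 h1 v q0 h0 h2 :: real
      by (simp add: algebra_simps)
    then show ?thesis unfolding layer_const_def power_divide .
  qed
  finally show ?thesis .
qed

text \<open>With \<open>\<eta>\<close> the sum of the hat functions of the nodes outside \<open>M\<close>, the test function is \<open>\<eta> \<psi> - b\<close>, where
  \<open>b\<close> is supported in the mixed elements (those with nodes in \<open>M\<close> and outside \<open>M\<close>) and restores the
  orthogonality to all hat functions. Since the correction is carried out element by element,
  nothing outside the mixed elements enters the right-hand side.\<close>
lemma layer_estimate:
  assumes M: "M \<subseteq> mesh_nodes \<T>" "p \<in> M"
  defines "X \<equiv> {T \<in> \<T>. nodes T \<inter> M \<noteq> {} \<and> \<not> nodes T \<subseteq> M}"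
  shows "\<epsilon>\<^sup>2 / 2 * (\<Sum>T\<in>{T \<in> \<T>. nodes T \<inter> M = {}}. gr T) \<le> layer_const * (\<Sum>T\<in>X. gr T + ls T)"
proof -
  define N where "N = mesh_nodes \<T> - M"
  define \<eta> where "\<eta> = hat_sum N"
  define Z where "Z = {T \<in> \<T>. nodes T \<inter> M = {}}"
  have N: "N \<subseteq> mesh_nodes \<T>" by (auto simp: N_def)
  have X: "X \<subseteq> \<T>" by (auto simp: X_def)
  have eta01: "0 \<le> \<eta> x \<and> \<eta> x \<le> 1" if "T \<in> \<T>" "x \<in> T" for T x
    using hat_sum_bounds[OF N that] by (simp add: \<eta>_def)
  have eta1: "\<eta> x = 1" if "T \<in> Z" "x \<in> T" for T x
    unfolding \<eta>_def using that nodes_mesh_nodes[of T] by (intro hat_sum_const(1)[OF N]) (auto simp: Z_def N_def)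
  have eta0: "\<eta> x = 0" if "T \<in> \<T> - Z - X" "x \<in> T" for T x
    unfolding \<eta>_def using that nodes_nonempty[of T] by (intro hat_sum_const(2)[OF N, of T]) (auto simp: Z_def X_def N_def)
  \<comment> \<open>\<open>th k\<close> is the value of \<open>\<eta>\<close> at the node
    \<open>k\<close>. Subtracting \<open>th k\<close> times the constraint on \<open>\<psi>\<close>
    makes the defect vanish on all elements that are not mixed: on those containing \<open>k\<close>
    the cutoff is constantly \<open>th k\<close>, on the others \<open>hat k\<close> is
    zero.\<close>
  define th where "th k = (if k \<in> N then 1 else 0 :: real)" for k
  define d where "d k T = (LINT x|lebesgue_on T. complex_of_real ((\<eta> x - th k) * hat k x) * \<psi> x)" for k T
  have eta_hat: "\<bar>(\<eta> x - th k) * hat k x\<bar> \<le> 1" if "T \<in> \<T>" "x \<in> T" "k \<in> mesh_nodes \<T>" for T x k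
  proof -
    have "\<bar>\<eta> x - th k\<bar> \<le> 1" using eta01[OF that(1,2)] by (auto simp: th_def)
    moreover have "\<bar>hat k x\<bar> \<le> 1" using hat_bounds[OF that(3), of x] mesh_subset[OF that(1)] that(2) by auto
    ultimately show ?thesis unfolding abs_mult by (intro mult_le_one) auto
  qed
  have hat_m: "hat k \<in> borel_measurable (lebesgue_on Omega)" if "k \<in> mesh_nodes \<T>" for k
    unfolding hat_def[abs_def]
    by (rule borel_measurable_continuous_on[of Re]) (use phi_square_integrable[OF that] in \<open>auto intro!: continuous_intros simp: square_integrable_on_def\<close>)
  have eta_m: "\<eta> \<in> borel_measurable (lebesgue_on Omega)"
    unfolding \<eta>_def hat_sum_def[abs_def] using N hat_m by (intro borel_measurable_sum) auto
  have ek_m: "(\<lambda>x. complex_of_real ((\<eta> x - th k) * hat k x)) \<in> borel_measurable (lebesgue_on Omega)" if "k \<in> mesh_nodes \<T>" for k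
    by (rule borel_measurable_continuous_on[of complex_of_real])
       (use eta_m hat_m[OF that] in \<open>auto intro!: continuous_intros borel_measurable_times borel_measurable_diff\<close>)
  have int_d: "integrable (lebesgue_on Omega) (\<lambda>x. complex_of_real ((\<eta> x - th k) * hat k x) * \<psi> x)" if k: "k \<in> mesh_nodes \<T>" for k
  proof (rule Bochner_Integration.integrable_bound)
    show "integrable (lebesgue_on Omega) (\<lambda>x. norm (\<psi> x))"
      using square_integrable_integrable[OF psi_square_integrable(1)] by simp
    show "(\<lambda>x. complex_of_real ((\<eta> x - th k) * hat k x) * \<psi> x) \<in> borel_measurable (lebesgue_on Omega)"
      using psi_square_integrable(1) by (intro borel_measurable_times ek_m k) (simp add: square_integrable_on_def)
    show "AE x in lebesgue_on Omega. norm (complex_of_real ((\<eta> x - th k) * hat k x) * \<psi> x) \<le> norm (norm (\<psi> x))"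
    proof (rule AE_I2)
      fix x :: "real ^ 'n" assume "x \<in> space (lebesgue_on Omega)"
      then obtain T where "T \<in> \<T>" "x \<in> T" using Union_mesh by auto
      from eta_hat[OF this k] show "norm (complex_of_real ((\<eta> x - th k) * hat k x) * \<psi> x) \<le> norm (norm (\<psi> x))"
        unfolding norm_mult norm_of_real by (simp add: mult_left_le_one_le)
    qed
  qed
  have d_bound: "norm (d k T) \<le> psi_mass T" if T: "T \<in> \<T>" and k: "k \<in> mesh_nodes \<T>" for T k
    unfolding d_def psi_mass_def
  proof (rule Bochner_Integration.integral_norm_bound_integral[OF integrable_element[OF int_d[OF k] T] integrable_norm_psi(1)[OF T]])
    fix x assume "x \<in> space (lebesgue_on T)"
    then have "x \<in> T" by simp
    from eta_hat[OF T this k] show "norm (complex_of_real ((\<eta> x - th k) * hat k x) * \<psi> x) \<le> norm (\<psi> x)"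
      unfolding norm_mult norm_of_real by (simp add: mult_left_le_one_le)
  qed
  have d_bound': "norm (d k T) \<le> psi_mass T" if "T \<in> X" "k \<in> nodes T" for T k
    using d_bound[of T k] X nodes_mesh_nodes[of T] that by blast
  define Q where "Q b h \<longleftrightarrow> periodic_gradient b h \<and>
    (\<forall>l\<in>mesh_nodes \<T>. L2inner b (\<phi> l) = (\<Sum>T\<in>X. if l \<in> nodes T then d l T else 0)) \<and>
    (\<forall>T\<in>\<T> - X. \<forall>x\<in>interior T. b x = 0 \<and> h x = 0) \<and>
    (\<forall>T\<in>X. \<forall>x\<in>interior T. norm (b x) \<le> real (CARD('n) + 1) * (K / r ^ CARD('n)) * psi_mass T \<and>
       norm (h x) \<le> real (CARD('n) + 1) * (K / r ^ (CARD('n) + 1)) * psi_mass T)" for b h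
  have "\<exists>b h. Q b h"
    unfolding Q_def by (rule correction_exists[OF K(2) X r(1)]; (rule r(2) d_bound')?; assumption)
  then obtain b h where "Q b h" by blast
  note bh = this[unfolded Q_def]
  note b1 = conjunct1[OF bh] and b' = conjunct2[OF bh]
  note b2 = conjunct1[OF b', rule_format] and b'' = conjunct2[OF b']
  note b3 = conjunct1[OF b'', rule_format] and b4 = conjunct2[OF b'', rule_format]
  note b5 = b4[THEN conjunct2] and b4 = b4[THEN conjunct1]
  obtain e where e: "periodic_gradient (\<lambda>x. \<eta> x *\<^sub>R \<psi> x) e"
    "\<And>T x. T \<in> \<T> \<Longrightarrow> x \<in> interior T \<Longrightarrow> e x = \<eta> x *\<^sub>R grad \<psi> x + outer (hat_sum_slope N T) (\<psi> x)"
  proof -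
    obtain e where e: "periodic_gradient (\<lambda>x. hat_sum N x *\<^sub>R \<psi> x) e \<and>
      (\<forall>T\<in>\<T>. \<forall>x\<in>interior T. e x = hat_sum N x *\<^sub>R grad \<psi> x + outer (hat_sum_slope N T) (\<psi> x))"
      using periodic_gradient_hat_sum_mult[OF N H1P_periodic_gradient[OF psi_H1P]] by (elim exE) (rule that)
    show ?thesis
      by (rule that[of e]) (use e in \<open>simp_all add: \<eta>_def\<close>)
  qed
  define w where "w x = \<eta> x *\<^sub>R \<psi> x + (- 1) * b x" for x
  have pg: "periodic_gradient w (\<lambda>x. e x + (- 1) *s h x)"
    unfolding w_def by (intro periodic_gradient_add periodic_gradient_cmult e(1) b1)
  have wH: "w \<in> H1P" and wg: "AE x in lebesgue_on Omega. grad w x = e x + (- 1) *s h x"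
    using periodic_gradient_imp_H1P[OF pg] by auto
  have w0: "L2inner w (\<phi> q) = 0" if q: "q \<in> mesh_nodes \<T>" for q
  proof -
    have s: "square_integrable_on b Omega" using b1 by (simp add: periodic_gradient_def)
    have "L2inner w (\<phi> q) = (LINT x|lebesgue_on Omega. complex_of_real ((\<eta> x - th q) * hat q x) * \<psi> x
        + complex_of_real (th q) * (\<psi> x * cnj (\<phi> q x)) - b x * cnj (\<phi> q x))"
      unfolding L2inner_def
      by (rule Bochner_Integration.integral_cong) (simp_all add: w_def phi_eq_hat[OF q] scaleR_conv_of_real algebra_simps)
    also have "\<dots> = (LINT x|lebesgue_on Omega. complex_of_real ((\<eta> x - th q) * hat q x) * \<psi> x)
        + complex_of_real (th q) * L2inner \<psi> (\<phi> q) - L2inner b (\<phi> q)"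
    proof -
      have "(LINT x|lebesgue_on Omega. f1 x + c * f2 x - f3 x) = (LINT x|lebesgue_on Omega. f1 x)
         + c * (LINT x|lebesgue_on Omega. f2 x) - (LINT x|lebesgue_on Omega. f3 x)"
        if "integrable (lebesgue_on Omega) f1" "integrable (lebesgue_on Omega) f2" "integrable (lebesgue_on Omega) f3"
        for f1 f2 f3 :: "real ^ 'n \<Rightarrow> complex" and c
        using that by simp
      from this[OF int_d[OF q] integrable_mult_cnj[OF psi_square_integrable(1) phi_square_integrable[OF q]]
          integrable_mult_cnj[OF s phi_square_integrable[OF q]]] show ?thesis
        unfolding L2inner_def .
    qed
    \<comment> \<open>For \<open>q \<noteq> p\<close> the constraint on \<open>\<psi>\<close> is
      zero; for \<open>q = p\<close> it is 1, but then \<open>th p = 0\<close> because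
      \<open>p \<in> M\<close>.\<close>
    also have "complex_of_real (th q) * L2inner \<psi> (\<phi> q) = 0"
      using psi_L2inner[OF q] M(2) by (auto simp: th_def N_def)
    also have "(LINT x|lebesgue_on Omega. complex_of_real ((\<eta> x - th q) * hat q x) * \<psi> x) = (\<Sum>T\<in>\<T>. d q T)"
      unfolding d_def by (rule integral_Omega_eq_sum[OF int_d[OF q]])
    also have "(\<Sum>T\<in>\<T>. d q T) = (\<Sum>T\<in>X. if q \<in> nodes T then d q T else 0)"
    proof (rule sum.mono_neutral_cong_right[OF finite_mesh X])
      have dz: "d q T = 0" if "\<And>x. x \<in> T \<Longrightarrow> (\<eta> x - th q) * hat q x = 0" for T
      proof -
        have "d q T = (LINT x|lebesgue_on T. 0)"
          unfolding d_def by (rule Bochner_Integration.integral_cong) (use that in auto)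
        then show ?thesis by simp
      qed
      have hz: "d q T = 0" if "T \<in> \<T>" "q \<notin> nodes T" for T
        by (rule dz) (use hat_eq_0[OF q that(1) _ that(2)] in simp)
      show "d q T = (if q \<in> nodes T then d q T else 0)" if "T \<in> X" for T using hz X that by auto
      show "\<forall>T\<in>\<T> - X. d q T = 0"
      proof
        fix T assume T: "T \<in> \<T> - X"
        show "d q T = 0"
        proof (cases "q \<in> nodes T")
          case qT: True
          show ?thesis
          proof (rule dz)
            fix x assume x: "x \<in> T"
            have "\<eta> x = th q"
            proof (cases "T \<in> Z")
              case True
              then have "q \<notin> M" using qT by (auto simp: Z_def)
              then show ?thesis using eta1[OF True x] q by (simp add: th_def N_def)
            next
              case False
              then have "nodes T \<subseteq> M" using T by (auto simp: Z_def X_def)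
              then have "q \<in> M" using qT by blast
              moreover have "\<eta> x = 0" by (rule eta0[of T]) (use T False x in auto)
              ultimately show ?thesis by (simp add: th_def N_def)
            qed
            then show "(\<eta> x - th q) * hat q x = 0" by simp
          qed
        qed (use hz T in auto)
      qed
    qed
    finally show ?thesis using b2[OF q] by simp
  qed
  have "energy \<epsilon> V \<psi> w = 0"
    by (rule energy_orthogonal[OF psi wH phi_square_integrable w0])
  define F where "F x = \<epsilon>\<^sup>2 / 2 * (grad \<psi> x \<bullet> grad w x) + V x * (\<psi> x \<bullet> w x)" for x
  have iF: "integrable (lebesgue_on Omega) F" unfolding F_def by (rule integrable_energy[OF psi_H1P wH])
  have F_ae: "AE x in lebesgue_on T. x \<in> interior T \<and> F x = \<epsilon>\<^sup>2 / 2 * (\<eta> x * (norm (grad \<psi> x))\<^sup>2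
      + grad \<psi> x \<bullet> outer (hat_sum_slope N T) (\<psi> x) - grad \<psi> x \<bullet> h x) + V x * (\<eta> x * (norm (\<psi> x))\<^sup>2 - \<psi> x \<bullet> b x)"
    if T: "T \<in> \<T>" for T
    using AE_element_interior[OF T] AE_Omega_imp_element[OF wg T]
  proof eventually_elim
    case (elim x)
    have "(- 1) *s h x = - h x" by (simp add: vec_eq_iff)
    then have "grad w x = \<eta> x *\<^sub>R grad \<psi> x + outer (hat_sum_slope N T) (\<psi> x) - h x"
      using elim(2) e(2)[OF T elim(1)] by simp
    moreover have "w x = \<eta> x *\<^sub>R \<psi> x - b x" by (simp add: w_def)
    ultimately show ?case
      using elim(1) by (simp add: F_def inner_diff_right inner_add_right power2_norm_eq_inner)
  qed
  have slope: "hat_sum_slope N T = 0" if "T \<in> \<T> - X" for T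
  proof -
    have T: "T \<in> \<T>" using that by blast
    obtain c where c: "ball c r \<subseteq> T" using r(2)[OF T] by blast
    have "\<exists>k. \<forall>x\<in>T. \<eta> x = k" using eta1[of T] eta0[of T] that by (cases "T \<in> Z") auto
    then obtain k where k: "\<And>x. x \<in> T \<Longrightarrow> \<eta> x = k" by blast
    show ?thesis
      by (rule affine_const_gradient[OF c r(1), where a="\<Sum>p\<in>N. hat_offset p T" and k=k])
         (use hat_sum_affine[OF N T] k in \<open>simp add: \<eta>_def\<close>)
  qed
  have slope_le: "norm (hat_sum_slope N T) \<le> 1 / r" if T: "T \<in> \<T>" for T
  proof -
    obtain c where c: "ball c r \<subseteq> T" using r(2)[OF T] by blast
    have "norm (hat_sum_slope N T) * r \<le> 1"
      by (rule affine_gradient_le[OF c _ r(1), where a="\<Sum>p\<in>N. hat_offset p T"])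
         (use hat_sum_affine[OF N T] hat_sum_bounds[OF N T] in simp)
    then show ?thesis using r(1) by (simp add: field_simps)
  qed
  have V0: "0 \<le> V x \<and> V x \<le> Vmax" if "T \<in> \<T>" "x \<in> interior T" for T x
    using V_bounds mesh_subset[OF that(1)] interior_subset that(2) by (meson subsetD)
  \<comment> \<open>Here the test function equals \<open>\<psi>\<close>, so the full energy density
    appears, and its potential part is dropped. Elements with all nodes in \<open>M\<close>
    contribute nothing, as the test function vanishes on them; mixed elements cost at most
    \<open>layer_bound\<close>.\<close>
  have lower_Z: "\<epsilon>\<^sup>2 / 2 * gr T \<le> (LINT x|lebesgue_on T. F x)" if TZ: "T \<in> Z" for T
  proof -
    have T: "T \<in> \<T>" "T \<in> \<T> - X" using TZ by (auto simp: Z_def X_def)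
    have "(LINT x|lebesgue_on T. \<epsilon>\<^sup>2 / 2 * (norm (grad \<psi> x))\<^sup>2) \<le> (LINT x|lebesgue_on T. F x)"
    proof (rule integral_mono_AE)
      show "AE x in lebesgue_on T. \<epsilon>\<^sup>2 / 2 * (norm (grad \<psi> x))\<^sup>2 \<le> F x"
        using F_ae[OF T(1)]
      proof eventually_elim
        case (elim x)
        then have x: "x \<in> interior T" by blast
        have 1: "\<eta> x = 1" using eta1[OF TZ] x interior_subset by blast
        have 2: "outer 0 (\<psi> x) = 0" by (simp add: vec_eq_iff)
        have 3: "b x = 0" "h x = 0" using b3[OF T(2) x] by auto
        have "F x = \<epsilon>\<^sup>2 / 2 * (norm (grad \<psi> x))\<^sup>2 + V x * (norm (\<psi> x))\<^sup>2"
          using elim by (simp add: 1 2 3 slope[OF T(2)])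
        then show ?case using V0[OF T(1) x] by simp
      qed
      show "integrable (lebesgue_on T) (\<lambda>x. \<epsilon>\<^sup>2 / 2 * (norm (grad \<psi> x))\<^sup>2)"
        using psi_element(2)[OF T(1)] by (simp add: square_integrable_on_def)
    qed (rule integrable_element[OF iF T(1)])
    then show ?thesis by (simp add: gr_def)
  qed
  have lower_0: "0 \<le> (LINT x|lebesgue_on T. F x)" if TY: "T \<in> \<T> - Z - X" for T
  proof (rule integral_nonneg_AE)
    have T: "T \<in> \<T>" "T \<in> \<T> - X" using TY by auto
    show "AE x in lebesgue_on T. 0 \<le> F x"
      using F_ae[OF T(1)]
    proof eventually_elim
      case (elim x)
      then have x: "x \<in> interior T" by blast
      have 1: "\<eta> x = 0" using eta0[OF TY] x interior_subset by blast
      have 2: "outer 0 (\<psi> x) = 0" by (simp add: vec_eq_iff)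
      have 3: "b x = 0" "h x = 0" using b3[OF T(2) x] by auto
      show ?case using elim by (simp add: 1 2 3 slope[OF T(2)])
    qed
  qed
  have lower_X: "- (layer_const * (gr T + ls T)) \<le> (LINT x|lebesgue_on T. F x)" if TX: "T \<in> X" for T
  proof -
    have T: "T \<in> \<T>" using TX X by blast
    have "(LINT x|lebesgue_on T. - layer_bound T x) \<le> (LINT x|lebesgue_on T. F x)"
    proof (rule integral_mono_AE)
      show "AE x in lebesgue_on T. - layer_bound T x \<le> F x"
        using F_ae[OF T]
      proof eventually_elim
        case (elim x)
        then have x: "x \<in> interior T" by blast
        define a where "a = norm (grad \<psi> x)"
        define u where "u = norm (\<psi> x)"
        define Bg where "Bg = real (CARD('n) + 1) * (K / r ^ (CARD('n) + 1)) * psi_mass T"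
        define Bb where "Bb = real (CARD('n) + 1) * (K / r ^ CARD('n)) * psi_mass T"
        have eta: "0 \<le> \<eta> x" using eta01[OF T] x interior_subset by blast
        have au: "0 \<le> a" "0 \<le> u" by (simp_all add: a_def u_def)
        note v = V0[OF T x]
        have 1: "- (a * u / r) \<le> grad \<psi> x \<bullet> outer (hat_sum_slope N T) (\<psi> x)"
        proof -
          have "\<bar>grad \<psi> x \<bullet> outer (hat_sum_slope N T) (\<psi> x)\<bar> \<le> a * (norm (hat_sum_slope N T) * u)"
            using Cauchy_Schwarz_ineq2[of "grad \<psi> x" "outer (hat_sum_slope N T) (\<psi> x)"] by (simp add: a_def u_def norm_outer)
          also have "\<dots> \<le> a * (1 / r * u)" using slope_le[OF T] au by (intro mult_left_mono mult_right_mono) auto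
          finally show ?thesis by simp
        qed
        have 2: "grad \<psi> x \<bullet> h x \<le> a * Bg"
        proof -
          have "grad \<psi> x \<bullet> h x \<le> a * norm (h x)" unfolding a_def by (rule norm_cauchy_schwarz)
          also have "\<dots> \<le> a * Bg" using b5[OF TX x] au by (intro mult_left_mono) (simp_all add: Bg_def)
          finally show ?thesis .
        qed
        have 3: "\<psi> x \<bullet> b x \<le> u * Bb"
        proof -
          have "\<psi> x \<bullet> b x \<le> u * norm (b x)" unfolding u_def by (rule norm_cauchy_schwarz)
          also have "\<dots> \<le> u * Bb" using b4[OF TX x] au by (intro mult_left_mono) (simp_all add: Bb_def)
          finally show ?thesis .
        qed
        have Bb0: "0 \<le> u * Bb"
          using mult_nonneg_nonneg[OF au(2) order_trans[OF norm_ge_zero b4[OF TX x]]] unfolding Bb_def .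
        have "V x * (\<psi> x \<bullet> b x) \<le> V x * (u * Bb)" using 3 v by (intro mult_left_mono) auto
        also have "\<dots> \<le> Vmax * (u * Bb)" using v Bb0 by (intro mult_right_mono) auto
        finally have 4: "V x * (\<psi> x \<bullet> b x) \<le> Vmax * (u * Bb)" .
        \<comment> \<open>The squares multiplied by \<open>\<eta>\<close> are nonnegative and are
          dropped: on mixed elements only the cutoff slope and the correction have to be
          estimated.\<close>
        have 5: "0 \<le> V x * (\<eta> x * u\<^sup>2)" using v eta by simp
        have 6: "0 \<le> \<eta> x * a\<^sup>2" using eta by simp
        have "\<epsilon>\<^sup>2 / 2 * (- (a * u / r + a * Bg)) \<le> \<epsilon>\<^sup>2 / 2 * (\<eta> x * a\<^sup>2
            + grad \<psi> x \<bullet> outer (hat_sum_slope N T) (\<psi> x) - grad \<psi> x \<bullet> h x)"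
          using 1 2 6 by (intro mult_left_mono) auto
        moreover have "F x = \<epsilon>\<^sup>2 / 2 * (\<eta> x * a\<^sup>2 + grad \<psi> x \<bullet> outer (hat_sum_slope N T) (\<psi> x) - grad \<psi> x \<bullet> h x)
            + V x * (\<eta> x * u\<^sup>2 - \<psi> x \<bullet> b x)"
          using elim by (simp add: a_def u_def)
        moreover have "layer_bound T x = \<epsilon>\<^sup>2 / 2 * (a * u / r + a * Bg) + Vmax * (u * Bb)"
          by (simp add: layer_bound_def a_def u_def Bg_def Bb_def)
        moreover have "V x * (\<eta> x * u\<^sup>2 - \<psi> x \<bullet> b x) = V x * (\<eta> x * u\<^sup>2) - V x * (\<psi> x \<bullet> b x)"
          by (rule right_diff_distrib)
        moreover have "\<epsilon>\<^sup>2 / 2 * (- (a * u / r + a * Bg)) = - (\<epsilon>\<^sup>2 / 2 * (a * u / r + a * Bg))" by (rule mult_minus_right)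
        ultimately show ?case using 4 5 by linarith
      qed
    qed (use integrable_layer_bound[OF T] integrable_element[OF iF T] in auto)
    then show ?thesis using layer_bound_le[OF T] by simp
  qed
  have "0 = (\<Sum>T\<in>\<T>. LINT x|lebesgue_on T. F x)"
    using \<open>energy \<epsilon> V \<psi> w = 0\<close> integral_Omega_eq_sum[OF iF] by (simp add: energy_def F_def)
  also have "\<dots> \<ge> (\<Sum>T\<in>\<T>. (if T \<in> Z then \<epsilon>\<^sup>2 / 2 * gr T else 0) - (if T \<in> X then layer_const * (gr T + ls T) else 0))"
  proof (rule sum_mono)
    fix T assume T: "T \<in> \<T>"
    have "\<not> (T \<in> Z \<and> T \<in> X)" by (auto simp: Z_def X_def)
    then show "(if T \<in> Z then \<epsilon>\<^sup>2 / 2 * gr T else 0) - (if T \<in> X then layer_const * (gr T + ls T) else 0) \<le> (LINT x|lebesgue_on T. F x)"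
      using lower_Z[of T] lower_X[of T] lower_0[of T] T by auto
  qed
  finally have sums: "(\<Sum>T\<in>\<T>. if T \<in> Z then \<epsilon>\<^sup>2 / 2 * gr T else 0) \<le> (\<Sum>T\<in>\<T>. if T \<in> X then layer_const * (gr T + ls T) else 0)"
    by (simp add: sum_subtractf)
  have restrict: "(\<Sum>T\<in>\<T>. if T \<in> Y then c * f T else 0) = c * (\<Sum>T\<in>Y. f T)"
    if Y: "Y \<subseteq> \<T>" for Y c and f :: "(real ^ 'n) set \<Rightarrow> real"
  proof -
    have "\<T> \<inter> Y = Y" using Y by blast
    then show ?thesis
      using sum.inter_restrict[OF finite_mesh, of "\<lambda>T. c * f T" Y] by (simp add: sum_distrib_left)
  qed
  have ZT: "Z \<subseteq> \<T>" by (auto simp: Z_def)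
  have "\<epsilon>\<^sup>2 / 2 * (\<Sum>T\<in>Z. gr T) \<le> layer_const * (\<Sum>T\<in>X. gr T + ls T)"
    using sums unfolding restrict[OF X, of layer_const "\<lambda>T. gr T + ls T"] restrict[OF ZT, of "\<epsilon>\<^sup>2 / 2" gr] .
  then show ?thesis unfolding Z_def .
qed

end

section \<open>Poincare inequality and conclusion\<close>

lemma square_norm_le_twice:
  fixes a b :: "'a::real_normed_vector"
  shows "(norm (a - b))\<^sup>2 \<le> 2 * (norm a)\<^sup>2 + 2 * (norm b)\<^sup>2"
proof -
  have "(norm (a - b))\<^sup>2 \<le> (norm a + norm b)\<^sup>2" by (intro power_mono norm_triangle_ineq4) auto
  also have "\<dots> \<le> 2 * (norm a)\<^sup>2 + 2 * (norm b)\<^sup>2"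
    using sum_squares_bound[of "norm a" "norm b"] by (simp add: power2_sum)
  finally show ?thesis .
qed

lemma norm_vector_scalar_mult: "norm (c *s v) = norm c * norm (v :: complex ^ 'n::finite)"
  by (simp add: norm_vec_def norm_mult L2_set_right_distrib)

context multiscale_setting
begin

definition neighbours :: "(real ^ 'n) set \<Rightarrow> (real ^ 'n) set set" where
  "neighbours T = {G \<in> \<T>. wrap ` G \<inter> wrap ` T \<noteq> {}}"

lemma L2norm_nbhd_le: "(L2norm (nbhd \<T> T) (grad \<psi>))\<^sup>2 \<le> (\<Sum>G\<in>neighbours T. gr G)"
  unfolding L2norm_square gr_def
proof (rule integral_le_sum_elements)
  show "integrable (lebesgue_on Omega) (\<lambda>x. (norm (grad \<psi> x))\<^sup>2)"
    using psi_square_integrable(2) by (simp add: square_integrable_on_def)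
  show "nbhd \<T> T \<in> sets lebesgue"
    using nbhd_closed by (intro sets_completionI_sets) (auto intro: borel_closed)
qed (auto simp: neighbours_def nbhd_def)

text \<open>The numerators of the interpolant are the constrained quantities, so only the summand of
  \<open>p\<close> survives.\<close>

lemma clement_psi: "clement \<T> \<phi> \<psi> x = 1 / L2inner (\<lambda>_. 1) (\<phi> p) * \<phi> p x"
proof -
  have "clement \<T> \<phi> \<psi> x = (\<Sum>q\<in>mesh_nodes \<T>. if p = q then 1 / L2inner (\<lambda>_. 1) (\<phi> q) * \<phi> q x else 0)"
    unfolding clement_def by (rule sum.cong) (simp_all add: psi_L2inner)
  then show ?thesis using p finite_mesh_nodes by simp
qed

text \<open>On the elements of the support of \<open>\<phi> p\<close>, the interpolant of \<open>\<psi>\<close> is a multiple \<open>c \<phi> p\<close> of the hat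
  function. If \<open>\<phi> p\<close> is not constant there, then its slope is at least \<open>1 / H\<close>, so the interpolant is
  controlled by its gradient and hence by the gradient of \<open>\<psi>\<close>.\<close>
lemma element_poincare:
  assumes interp: "interpolation_bound \<T> \<phi> C\<^sub>I" and Hm: "H = mesh_size \<T>" and CI: "0 < C\<^sub>I"
    and T: "T \<in> \<T>" "p \<notin> nodes T \<or> \<not> nodes T \<subseteq> {p}"
  shows "ls T \<le> (6 * C\<^sub>I\<^sup>2 + 4) * (\<Sum>G\<in>neighbours T. gr G)"
proof -
  let ?S = "L2norm (nbhd \<T> T) (grad \<psi>)" and ?\<Sigma> = "\<Sum>G\<in>neighbours T. gr G"
  define c where "c = 1 / L2inner (\<lambda>_. 1) (\<phi> p)"
  define D where "D x = \<psi> x - c * \<phi> p x" for x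
  have D_eq: "(\<lambda>x. \<psi> x - clement \<T> \<phi> \<psi> x) = D" by (rule ext) (simp add: D_def clement_psi c_def)
  have bound: "inverse H * L2norm T D + L2norm T (grad D) \<le> C\<^sub>I * ?S"
    using interp T(1) psi_H1P unfolding interpolation_bound_def Hm D_eq[symmetric] by blast
  have S: "?S\<^sup>2 \<le> ?\<Sigma>" by (rule L2norm_nbhd_le)
  have Sig0: "0 \<le> ?\<Sigma>" by (intro sum_nonneg gr_nonneg)
  have "inverse H * L2norm T D \<le> C\<^sub>I * ?S" using bound L2norm_nonneg[of T "grad D"] by linarith
  then have "L2norm T D \<le> H * (C\<^sub>I * ?S)" using H(1) by (simp add: field_simps)
  then have "(L2norm T D)\<^sup>2 \<le> (H * (C\<^sub>I * ?S))\<^sup>2" by (intro power_mono L2norm_nonneg)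
  also have "\<dots> = H\<^sup>2 * (C\<^sub>I\<^sup>2 * ?S\<^sup>2)" by (simp add: power_mult_distrib)
  also have "\<dots> \<le> H\<^sup>2 * (C\<^sub>I\<^sup>2 * ?\<Sigma>)" using S by (intro mult_left_mono) auto
  finally have DT: "(LINT x|lebesgue_on T. (norm (D x))\<^sup>2) \<le> H\<^sup>2 * (C\<^sub>I\<^sup>2 * ?\<Sigma>)" by (simp only: L2norm_square)
  have "0 \<le> inverse H * L2norm T D" using H(1) L2norm_nonneg[of T D] by simp
  then have "L2norm T (grad D) \<le> C\<^sub>I * ?S" using bound by linarith
  then have "(L2norm T (grad D))\<^sup>2 \<le> (C\<^sub>I * ?S)\<^sup>2" by (intro power_mono L2norm_nonneg)
  also have "\<dots> \<le> C\<^sub>I\<^sup>2 * ?\<Sigma>" unfolding power_mult_distrib using S by (intro mult_left_mono) auto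
  finally have gD: "(LINT x|lebesgue_on T. (norm (grad D x))\<^sup>2) \<le> C\<^sub>I\<^sup>2 * ?\<Sigma>" by (simp only: L2norm_square)
  have main: "(LINT x|lebesgue_on T. (norm (\<psi> x))\<^sup>2) \<le> H\<^sup>2 * ((6 * C\<^sub>I\<^sup>2 + 4) * ?\<Sigma>)"
  proof (cases "p \<in> nodes T")
    case False
    have "(LINT x|lebesgue_on T. (norm (\<psi> x))\<^sup>2) = (LINT x|lebesgue_on T. (norm (D x))\<^sup>2)"
      by (rule Bochner_Integration.integral_cong)
         (use hat_eq_0[OF p T(1) _ False] hat_affine(2)[OF p T(1)] in \<open>simp_all add: D_def\<close>)
    also have "\<dots> \<le> H\<^sup>2 * (C\<^sub>I\<^sup>2 * ?\<Sigma>)" by (rule DT)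
    also have "\<dots> \<le> H\<^sup>2 * ((6 * C\<^sub>I\<^sup>2 + 4) * ?\<Sigma>)" using Sig0 by (intro mult_left_mono mult_right_mono) auto
    finally show ?thesis .
  next
    case True
    then have "\<not> nodes T \<subseteq> {p}" using T(2) by blast
    then obtain v0 v1 where v: "v0 \<in> verts T" "wrap v0 \<noteq> p" "v1 \<in> verts T" "wrap v1 = p"
      using True by (auto simp: nodes_def)
    define \<beta> where "\<beta> = hat_slope p T"
    let ?m = "measure lebesgue T"
    have m: "0 < ?m" by (rule measure_element(1)[OF T(1)])
    have \<beta>: "1 \<le> norm \<beta> * H"
    proof -
      have vT: "v0 \<in> T" "v1 \<in> T" using v verts_subset[OF T(1)] by auto
      have "1 = hat p v1 - hat p v0" using hat_vertex[OF p T(1)] v by simp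
      also have "\<dots> = \<beta> \<bullet> (v1 - v0)" using hat_affine(1)[OF p T(1)] vT by (simp add: \<beta>_def inner_diff_right)
      also have "\<dots> \<le> norm \<beta> * norm (v1 - v0)" by (rule norm_cauchy_schwarz)
      also have "\<dots> \<le> norm \<beta> * H"
      proof (rule mult_left_mono)
        have "dist v1 v0 \<le> diameter T"
          by (rule diameter_bounded_bound[OF compact_imp_bounded[OF mesh_compact[OF T(1)]] vT(2,1)])
        then show "norm (v1 - v0) \<le> H" using H(2)[OF T(1)] by (simp add: dist_norm)
      qed simp
      finally show ?thesis .
    qed
    obtain h where h: "periodic_gradient (\<phi> p) h \<and> (\<forall>T\<in>\<T>. \<forall>x\<in>interior T. h x = outer (hat_slope p T) 1)"
      using periodic_gradient_phi[OF p] by (elim exE) (rule that)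
    have pg: "periodic_gradient D (\<lambda>x. grad \<psi> x + (- c) *s h x)"
    proof -
      have "periodic_gradient (\<lambda>x. \<psi> x + (- c) * \<phi> p x) (\<lambda>x. grad \<psi> x + (- c) *s h x)"
        using h by (intro periodic_gradient_add periodic_gradient_cmult H1P_periodic_gradient psi_H1P) blast
      then show ?thesis by (simp add: D_def[abs_def])
    qed
    note DH = periodic_gradient_imp_H1P[OF pg]
    note sD = H1P_square_integrable[OF DH(1), THEN square_integrable_element[OF _ T(1)]]
    have iD: "integrable (lebesgue_on T) (\<lambda>x. (norm (D x))\<^sup>2)" "integrable (lebesgue_on T) (\<lambda>x. (norm (grad D x))\<^sup>2)"
      "integrable (lebesgue_on T) (\<lambda>x. (norm (\<psi> x))\<^sup>2)" "integrable (lebesgue_on T) (\<lambda>x. (norm (grad \<psi> x))\<^sup>2)"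
      using sD psi_element[OF T(1)] by (auto simp: square_integrable_on_def)
    have const: "integrable (lebesgue_on T) (\<lambda>x. k)" "(LINT x|lebesgue_on T. k) = k * ?m" for k :: real
      using mesh_lmeasurable[OF T(1)] integrable_bounded_lebesgue_on[of "\<lambda>_. k" T "\<bar>k\<bar>"]
      by (simp_all add: measure_restrict_space fmeasurableD)
    have mm: "measure (lebesgue_on T) T = ?m"
      using mesh_sets[OF T(1)] by (simp add: measure_restrict_space)
    \<comment> \<open>On the element the gradient of the interpolant is the constant tensor of
      \<open>\<beta>\<close> and \<open>c\<close>, and it is the difference of the gradients of
      \<open>\<psi>\<close> and \<open>D\<close>; integrating turns this into a bound of
      \<open>c\<close>.\<close>
    have "(LINT x|lebesgue_on T. (norm c * norm \<beta>)\<^sup>2) \<le> (LINT x|lebesgue_on T. 2 * (norm (grad \<psi> x))\<^sup>2 + 2 * (norm (grad D x))\<^sup>2)"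
    proof (rule integral_mono_AE)
      show "AE x in lebesgue_on T. (norm c * norm \<beta>)\<^sup>2 \<le> 2 * (norm (grad \<psi> x))\<^sup>2 + 2 * (norm (grad D x))\<^sup>2"
        using AE_element_interior[OF T(1)] AE_Omega_imp_element[OF DH(2) T(1)]
      proof eventually_elim
        case (elim x)
        have "h x = outer \<beta> 1" using h T(1) elim(1) by (auto simp: \<beta>_def)
        then have "grad \<psi> x - grad D x = c *s outer \<beta> 1" using elim(2) by (simp add: vec_eq_iff)
        then have "norm (grad \<psi> x - grad D x) = norm c * norm \<beta>"
          by (simp add: norm_vector_scalar_mult norm_outer)
        then show ?case using square_norm_le_twice[of "grad \<psi> x" "grad D x"] by simp
      qed
    qed (use const iD in auto)
    then have "(norm c * norm \<beta>)\<^sup>2 * ?m \<le> 2 * gr T + 2 * (LINT x|lebesgue_on T. (norm (grad D x))\<^sup>2)"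
      using iD by (simp add: mm gr_def mult.commute)
    also have "\<dots> \<le> 2 * ?\<Sigma> + 2 * (C\<^sub>I\<^sup>2 * ?\<Sigma>)"
    proof (intro add_mono mult_left_mono gD)
      have "T \<in> neighbours T" using T(1) v verts_subset[OF T(1)] by (auto simp: neighbours_def)
      moreover have "finite (neighbours T)" using finite_mesh by (simp add: neighbours_def)
      ultimately show "gr T \<le> ?\<Sigma>" by (intro member_le_sum) (auto simp: gr_nonneg)
    qed auto
    finally have c1: "(norm c * norm \<beta>)\<^sup>2 * ?m \<le> (2 + 2 * C\<^sub>I\<^sup>2) * ?\<Sigma>" by (simp add: algebra_simps)
    have c2: "(norm c)\<^sup>2 * ?m \<le> H\<^sup>2 * ((2 + 2 * C\<^sub>I\<^sup>2) * ?\<Sigma>)"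
    proof -
      have "norm c * 1 \<le> norm c * (norm \<beta> * H)" using \<beta> by (intro mult_left_mono) auto
      then have "(norm c)\<^sup>2 \<le> (norm c * (norm \<beta> * H))\<^sup>2" by (intro power_mono) auto
      also have "\<dots> = H\<^sup>2 * (norm c * norm \<beta>)\<^sup>2" by (simp add: power_mult_distrib)
      finally have "(norm c)\<^sup>2 * ?m \<le> (H\<^sup>2 * (norm c * norm \<beta>)\<^sup>2) * ?m" using m by (intro mult_right_mono) auto
      also have "\<dots> = H\<^sup>2 * ((norm c * norm \<beta>)\<^sup>2 * ?m)" by simp
      also have "\<dots> \<le> H\<^sup>2 * ((2 + 2 * C\<^sub>I\<^sup>2) * ?\<Sigma>)" using c1 by (intro mult_left_mono) auto
      finally show ?thesis .
    qed
    have "(LINT x|lebesgue_on T. (norm (\<psi> x))\<^sup>2) \<le> (LINT x|lebesgue_on T. 2 * (norm (D x))\<^sup>2 + 2 * (norm c)\<^sup>2)"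
    proof (rule integral_mono)
      fix x assume "x \<in> space (lebesgue_on T)"
      then have x: "x \<in> T" by simp
      have "norm (\<phi> p x) \<le> 1"
        using hat_affine(2)[OF p T(1) x] hat_bounds[OF p, of x] mesh_subset[OF T(1)] x by auto
      then have "norm (c * \<phi> p x) \<le> norm c" by (simp add: norm_mult mult_left_le)
      then have "(norm (c * \<phi> p x))\<^sup>2 \<le> (norm c)\<^sup>2" by (intro power_mono) auto
      moreover have "\<psi> x = D x - (- (c * \<phi> p x))" by (simp add: D_def)
      then have "(norm (\<psi> x))\<^sup>2 \<le> 2 * (norm (D x))\<^sup>2 + 2 * (norm (c * \<phi> p x))\<^sup>2"
        using square_norm_le_twice[of "D x" "- (c * \<phi> p x)"] by simp
      ultimately show "(norm (\<psi> x))\<^sup>2 \<le> 2 * (norm (D x))\<^sup>2 + 2 * (norm c)\<^sup>2" by linarith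
    qed (use iD const in auto)
    also have "\<dots> = 2 * (LINT x|lebesgue_on T. (norm (D x))\<^sup>2) + 2 * ((norm c)\<^sup>2 * ?m)"
      using iD const(1)[of "2 * (norm c)\<^sup>2"] by (simp add: mm mult.commute)
    \<comment> \<open>Twice \<open>C\<^sub>I\<^sup>2\<close> from the interpolation error plus twice
      \<open>2 + 2 * C\<^sub>I\<^sup>2\<close> from the multiple of the hat function gives the
      constant \<open>6 * C\<^sub>I\<^sup>2 + 4\<close>.\<close>
    also have "\<dots> \<le> 2 * (H\<^sup>2 * (C\<^sub>I\<^sup>2 * ?\<Sigma>)) + 2 * (H\<^sup>2 * ((2 + 2 * C\<^sub>I\<^sup>2) * ?\<Sigma>))"
      using DT c2 by (intro add_mono mult_left_mono) auto
    also have "\<dots> = H\<^sup>2 * ((6 * C\<^sub>I\<^sup>2 + 4) * ?\<Sigma>)" by (simp add: algebra_simps)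
    finally show ?thesis .
  qed
  then show ?thesis using H(1) unfolding ls_def by (simp add: divide_le_eq mult.commute)
qed

text \<open>\<open>hat p\<close> may vanish at \<open>x\<close>, but it is affine on the element,
  nonnegative at \<open>x\<close> and 1 at a vertex over \<open>p\<close>; so it is positive at
  points of the segment arbitrarily close to \<open>x\<close>, and the closure in
  \<open>supp\<close> takes care of \<open>x\<close>.\<close>

lemma element_subset_supp:
  assumes T: "T \<in> \<T>" "p \<in> nodes T"
  shows "T \<subseteq> supp (\<phi> p)"
proof
  fix x assume x: "x \<in> T"
  obtain v where v: "v \<in> verts T" "wrap v = p" using T(2) by (auto simp: nodes_def)
  have vT: "v \<in> T" using v verts_subset[OF T(1)] by blast
  show "x \<in> supp (\<phi> p)"
    unfolding supp_def closure_approachable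
  proof (intro allI impI)
    fix e :: real assume e: "0 < e"
    \<comment> \<open>The 1 added to the distance keeps the denominator positive also for
      \<open>x = v\<close>.\<close>
    define t where "t = min 1 (e / (2 * (1 + norm (v - x))))"
    have n: "0 < 1 + norm (v - x)" using norm_ge_zero[of "v - x"] by linarith
    have t: "0 < t" "t \<le> 1" using e n by (auto simp: t_def)
    define y where "y = (1 - t) *\<^sub>R x + t *\<^sub>R v"
    have yT: "y \<in> T" unfolding y_def using mesh_convex[OF T(1)] x vT t by (intro convexD) auto
    have "hat p y = (1 - t) * hat p x + t * hat p v"
      using hat_affine(1)[OF p T(1)] x vT yT by (simp add: y_def inner_add_right algebra_simps)
    moreover have "hat p v = 1" using hat_vertex[OF p T(1) v(1)] v(2) by simp
    moreover have "0 \<le> hat p x" using hat_bounds(1)[OF p, of x] mesh_subset[OF T(1)] x by blast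
    ultimately have "hat p y = (1 - t) * hat p x + t" "0 \<le> (1 - t) * hat p x" using t by simp_all
    then have "0 < hat p y" using t by linarith
    then have "\<phi> p y \<noteq> 0" using hat_affine(2)[OF p T(1) yT] by simp
    moreover have "dist y x < e"
    proof -
      have "y - x = t *\<^sub>R (v - x)" by (simp add: y_def algebra_simps)
      then have "dist y x = t * norm (v - x)" using t by (simp add: dist_norm)
      also have "\<dots> \<le> e / (2 * (1 + norm (v - x))) * norm (v - x)" by (intro mult_right_mono) (auto simp: t_def)
      also have "\<dots> < e"
      proof -
        define q where "q = norm (v - x)"
        have "0 \<le> q" by (simp add: q_def)
        then have "e * q < e * (2 * (1 + q))" using e by (intro mult_strict_left_mono) auto
        then show ?thesis unfolding q_def[symmetric] using \<open>0 \<le> q\<close> by (simp add: divide_less_eq)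
      qed
      finally show ?thesis .
    qed
    ultimately show "\<exists>y\<in>{x \<in> Omega. \<phi> p x \<noteq> 0}. dist y x < e"
      using yT mesh_subset[OF T(1)] by blast
  qed
qed

text \<open>Families of elements instead of point sets, matching the combinatorial decay statement.
  Starting from the elements that have \<open>p\<close> as a node, their unions stay in the
  neighbourhoods of \<open>supp (\<phi> p)\<close>; hence norms outside those neighbourhoods are
  bounded by sums outside the layers.\<close>

primrec layer :: "nat \<Rightarrow> (real ^ 'n) set set" where
  "layer 0 = {T \<in> \<T>. p \<in> nodes T}"
| "layer (Suc m) = {G \<in> \<T>. \<exists>T\<in>layer m. wrap ` T \<inter> wrap ` G \<noteq> {}}"

lemma layer_subset: "layer m \<subseteq> \<T>"
  by (cases m) auto

lemma Union_layer_subset: "\<Union>(layer m) \<subseteq> (nbhd \<T> ^^ m) (supp (\<phi> p))"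
proof (induction m)
  case 0
  then show ?case using element_subset_supp by auto
next
  case (Suc m)
  then show ?case by (auto simp: nbhd_def)
qed

lemma nbhd_power_closed: "closed ((nbhd \<T> ^^ m) (supp (\<phi> p)))"
  by (cases m) (auto simp: supp_def nbhd_closed)

lemma L2norm_outside_layer:
  "(L2norm (Omega - (nbhd \<T> ^^ m) (supp (\<phi> p))) (grad \<psi>))\<^sup>2 \<le> (\<Sum>T\<in>\<T> - layer m. gr T)"
  unfolding L2norm_square gr_def
proof (rule integral_le_sum_elements)
  show "integrable (lebesgue_on Omega) (\<lambda>x. (norm (grad \<psi> x))\<^sup>2)"
    using psi_square_integrable(2) by (simp add: square_integrable_on_def)
  have "(nbhd \<T> ^^ m) (supp (\<phi> p)) \<in> sets lebesgue"
    using nbhd_power_closed by (intro sets_completionI_sets) (auto intro: borel_closed)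
  then show "Omega - (nbhd \<T> ^^ m) (supp (\<phi> p)) \<in> sets lebesgue" by (intro sets.Diff) auto
  show "Omega - (nbhd \<T> ^^ m) (supp (\<phi> p)) \<subseteq> \<Union>(\<T> - layer m)"
    using Union_layer_subset[of m] Union_mesh by blast
qed auto

lemma L2norm_Omega_eq: "(L2norm Omega (grad \<psi>))\<^sup>2 = (\<Sum>T\<in>\<T>. gr T)"
  unfolding L2norm_square gr_def
  by (rule integral_Omega_eq_sum) (use psi_square_integrable(2) in \<open>simp add: square_integrable_on_def\<close>)

lemma nodes_Int_imp_wrap_Int:
  assumes "T \<in> \<T>" "G \<in> \<T>" "nodes T \<inter> nodes G \<noteq> {}"
  shows "wrap ` T \<inter> wrap ` G \<noteq> {}"
  using assms verts_subset unfolding nodes_def by blast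

text \<open>\<open>layer_estimate\<close> for both choices of \<open>M\<close>, with
  \<open>\<epsilon>\<^sup>2 / 2\<close> cancelled. For the nodes of layer \<open>m\<close>, an
  element with a node in \<open>M\<close> touches layer \<open>m\<close> and so lies in the next
  one, while every element of layer \<open>m\<close> has all its nodes in \<open>M\<close>; hence
  the mixed elements lie in the ring between the two layers.\<close>

lemma layer_decay_estimates:
  assumes "layer_const \<le> \<epsilon>\<^sup>2 / 2 * C"
  shows "(\<Sum>T\<in>\<T> - layer 0. gr T) \<le> C * (\<Sum>T\<in>{T \<in> \<T>. p \<in> nodes T \<and> \<not> nodes T \<subseteq> {p}}. gr T + ls T)"
    and "0 \<le> C \<Longrightarrow> (\<Sum>T\<in>\<T> - layer (Suc m). gr T) \<le> C * (\<Sum>T\<in>layer (Suc m) - layer m. gr T + ls T)"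
proof -
  have est: "(\<Sum>T\<in>{T \<in> \<T>. nodes T \<inter> M = {}}. gr T) \<le> C * (\<Sum>T\<in>{T \<in> \<T>. nodes T \<inter> M \<noteq> {} \<and> \<not> nodes T \<subseteq> M}. gr T + ls T)"
    if M: "M \<subseteq> mesh_nodes \<T>" "p \<in> M" for M
  proof -
    let ?A = "\<Sum>T\<in>{T \<in> \<T>. nodes T \<inter> M = {}}. gr T" and ?B = "\<Sum>T\<in>{T \<in> \<T>. nodes T \<inter> M \<noteq> {} \<and> \<not> nodes T \<subseteq> M}. gr T + ls T"
    have "0 \<le> ?B" by (intro sum_nonneg add_nonneg_nonneg gr_nonneg ls_nonneg)
    then have "layer_const * ?B \<le> (\<epsilon>\<^sup>2 / 2 * C) * ?B" using assms by (intro mult_right_mono)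
    then have "\<epsilon>\<^sup>2 / 2 * ?A \<le> \<epsilon>\<^sup>2 / 2 * (C * ?B)" using layer_estimate[OF M] by (simp only: mult.assoc)
    then show ?thesis by (rule mult_left_le_imp_le) (use eps in simp)
  qed
  have 1: "{T \<in> \<T>. nodes T \<inter> {p} = {}} = \<T> - layer 0"
    "{T \<in> \<T>. nodes T \<inter> {p} \<noteq> {} \<and> \<not> nodes T \<subseteq> {p}} = {T \<in> \<T>. p \<in> nodes T \<and> \<not> nodes T \<subseteq> {p}}" by auto
  have sp: "{p} \<subseteq> mesh_nodes \<T>" using p by simp
  show "(\<Sum>T\<in>\<T> - layer 0. gr T) \<le> C * (\<Sum>T\<in>{T \<in> \<T>. p \<in> nodes T \<and> \<not> nodes T \<subseteq> {p}}. gr T + ls T)"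
    using est[OF sp] unfolding 1 by simp
  show "(\<Sum>T\<in>\<T> - layer (Suc m). gr T) \<le> C * (\<Sum>T\<in>layer (Suc m) - layer m. gr T + ls T)" if C: "0 \<le> C"
  proof -
    define M where "M = (\<Union>T\<in>layer m. nodes T)"
    have touch: "T \<in> layer (Suc m)" if "T \<in> \<T>" "nodes T \<inter> M \<noteq> {}" for T
    proof -
      obtain G where G: "G \<in> layer m" "nodes G \<inter> nodes T \<noteq> {}" using \<open>nodes T \<inter> M \<noteq> {}\<close> unfolding M_def by blast
      then have "wrap ` G \<inter> wrap ` T \<noteq> {}"
        using nodes_Int_imp_wrap_Int[OF _ \<open>T \<in> \<T>\<close>, of G] layer_subset[of m] by blast
      then show ?thesis using \<open>T \<in> \<T>\<close> G(1) by auto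
    qed
    have sub0: "layer 0 \<subseteq> layer m"
    proof (induction m)
      case (Suc m)
      show ?case
      proof
        fix T assume T: "T \<in> layer 0"
        then have "T \<in> \<T>" "T \<in> layer m" "p \<in> nodes T" using Suc by auto
        moreover from this have "wrap ` T \<noteq> {}" using verts_subset[of T] by (auto simp: nodes_def)
        ultimately show "T \<in> layer (Suc m)" by auto
      qed
    qed simp
    have MM: "M \<subseteq> mesh_nodes \<T>" unfolding M_def using nodes_mesh_nodes layer_subset[of m] by blast
    obtain T0 where "T0 \<in> \<T>" "p \<in> nodes T0" using p unfolding mesh_nodes_eq by blast
    then have "T0 \<in> layer m" using sub0 by auto
    then have pM: "p \<in> M" using \<open>p \<in> nodes T0\<close> unfolding M_def by blast
    have "(\<Sum>T\<in>\<T> - layer (Suc m). gr T) \<le> (\<Sum>T\<in>{T \<in> \<T>. nodes T \<inter> M = {}}. gr T)"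
    proof (rule sum_mono2)
      show "finite {T \<in> \<T>. nodes T \<inter> M = {}}" using finite_mesh by simp
      show "\<T> - layer (Suc m) \<subseteq> {T \<in> \<T>. nodes T \<inter> M = {}}" using touch by blast
    qed (rule gr_nonneg)
    also have "\<dots> \<le> C * (\<Sum>T\<in>{T \<in> \<T>. nodes T \<inter> M \<noteq> {} \<and> \<not> nodes T \<subseteq> M}. gr T + ls T)" by (rule est[OF MM pM])
    also have "\<dots> \<le> C * (\<Sum>T\<in>layer (Suc m) - layer m. gr T + ls T)"
    proof (intro mult_left_mono sum_mono2 C)
      show "finite (layer (Suc m) - layer m)" using finite_subset[OF layer_subset finite_mesh] by blast
      show "{T \<in> \<T>. nodes T \<inter> M \<noteq> {} \<and> \<not> nodes T \<subseteq> M} \<subseteq> layer (Suc m) - layer m"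
      proof
        fix T assume T: "T \<in> {T \<in> \<T>. nodes T \<inter> M \<noteq> {} \<and> \<not> nodes T \<subseteq> M}"
        then have "T \<in> layer (Suc m)" using touch by blast
        moreover have "T \<notin> layer m" using T unfolding M_def by blast
        ultimately show "T \<in> layer (Suc m) - layer m" by blast
      qed
    qed (intro add_nonneg_nonneg gr_nonneg ls_nonneg)
    finally show ?thesis .
  qed
qed

end

section \<open>Mesh size and inscribed balls\<close>

context periodic_mesh
begin

lemma mesh_nonempty: "\<T> \<noteq> {}"
  using Union_mesh wrap_in_Omega by blast

lemma diameter_pos:
  assumes "T \<in> \<T>"
  shows "0 < diameter T"
proof -
  have card: "1 < card (verts T)" using mesh_verts(3)[OF assms] by simp
  have "verts T \<noteq> {}" using card by (metis card.empty not_less_zero)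
  then obtain v where v: "v \<in> verts T" by (meson ex_in_conv)
  have "verts T \<noteq> {v}" using card by auto
  then obtain w where w: "w \<in> verts T" "v \<noteq> w" using v by blast
  have "v \<in> T" "w \<in> T" using v w verts_subset[OF assms] by auto
  from diameter_bounded_bound[OF compact_imp_bounded[OF mesh_compact[OF assms]] this]
  have "dist v w \<le> diameter T" .
  moreover have "0 < dist v w" using w(2) by simp
  ultimately show ?thesis by linarith
qed

lemma diameter_le_mesh_size: "T \<in> \<T> \<Longrightarrow> diameter T \<le> mesh_size \<T>"
  unfolding mesh_size_def using finite_mesh by (intro Max_ge) auto

text \<open>Quasi-uniformity passes from the mesh size to the diameter of the element, shape
  regularity from there to an inscribed radius; the result is one radius for all elements.\<close>

lemma inscribed_ball:
  assumes "shape_regular \<sigma> \<T>" "quasi_uniform \<rho> \<T>" "0 < \<sigma>" "0 < \<rho>" "T \<in> \<T>"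
  shows "\<exists>c. ball c (mesh_size \<T> / (\<rho> * \<sigma>)) \<subseteq> T"
proof -
  obtain c s where c: "ball c s \<subseteq> T" "diameter T \<le> \<sigma> * s" using assms(1,5) unfolding shape_regular_def by blast
  have "mesh_size \<T> \<le> \<rho> * diameter T" using assms(2,5) unfolding quasi_uniform_def by blast
  also have "\<dots> \<le> \<rho> * (\<sigma> * s)" using c(2) assms(4) by (intro mult_left_mono) auto
  finally have "mesh_size \<T> / (\<rho> * \<sigma>) \<le> s" using assms(3,4) by (simp add: divide_le_eq mult_ac)
  then show ?thesis by (intro exI[of _ c] order_trans[OF subset_ball c(1)])
qed

end

theorem theorem3p2:
  fixes Vmin Vmax \<sigma> \<rho> C\<^sub>o\<^sub>l C\<^sub>I \<gamma> :: real
    and C :: "('n::finite \<Rightarrow> nat) \<Rightarrow> real"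
  assumes "0 < Vmin" and "Vmin \<le> Vmax"
    and "0 < \<sigma>" and "0 < \<rho>" and "0 < C\<^sub>o\<^sub>l" and "0 < C\<^sub>I" and "0 < \<gamma>"
  shows "\<exists>\<beta>::real. 0 < \<beta> \<and> \<beta> < 1 \<and>
    (\<forall>(\<epsilon>::real) (\<delta>::real) (V :: real ^ 'n \<Rightarrow> real) (\<T> :: (real ^ 'n) set set) (H::real)
       (\<phi> :: real ^ 'n \<Rightarrow> real ^ 'n \<Rightarrow> complex).
       0 < \<epsilon> \<and> \<epsilon> < 1 \<and> 0 < \<delta> \<and> \<delta> < 1 \<and>
       admissible_potential Vmin Vmax C \<delta> V \<and>
       periodic_simplicial_mesh \<T> \<and> shape_regular \<sigma> \<T> \<and> quasi_uniform \<rho> \<T> \<and>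
       H = mesh_size \<T> \<and>
       nodal_basis \<T> \<phi> \<and>
       overlap_bound \<T> C\<^sub>o\<^sub>l \<and> interpolation_bound \<T> \<phi> C\<^sub>I \<and> cutoff_bound \<T> \<gamma> \<and>
       H / \<epsilon> \<le> inverse (2 * C\<^sub>I * sqrt (C\<^sub>o\<^sub>l * Vmax * (1 + C\<^sub>I * C\<^sub>o\<^sub>l * \<gamma>))) \<longrightarrow>
       (\<forall>p\<in>mesh_nodes \<T>. \<forall>\<psi>. multiscale_basis_function \<T> \<phi> \<epsilon> V p \<psi> \<longrightarrow>
          (\<forall>m::nat. L2norm (Omega - (nbhd \<T> ^^ m) (supp (\<phi> p))) (grad \<psi>)
                      \<le> \<beta> ^ m * L2norm Omega (grad \<psi>))))"
proof -
  obtain K where K: "0 < K" "dual_bump_bound TYPE('n) K"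
    using dual_bump by blast
  \<comment> \<open>The bound of \<open>H / \<epsilon>\<close> in the resolution condition; it
    depends on the fixed constants only.\<close>
  define R where "R = inverse (2 * C\<^sub>I * sqrt (C\<^sub>o\<^sub>l * Vmax * (1 + C\<^sub>I * C\<^sub>o\<^sub>l * \<gamma>)))"
  define \<kappa> where "\<kappa> = \<rho> * \<sigma>"
  define N where "N = real (CARD('n) + 1) * K * unit_ball_vol (real CARD('n))"
  \<comment> \<open>\<open>layer_const\<close> divided by \<open>\<epsilon>\<^sup>2 / 2\<close>,
    with \<open>H / r\<close> replaced by \<open>\<kappa>\<close> and \<open>H\<^sup>2\<close> by
    its bound \<open>\<epsilon>\<^sup>2 * R\<^sup>2\<close>.\<close>
  define Q where "Q = \<kappa> / 2 + N * \<kappa> ^ (CARD('n) + 1) / 2 + 2 * (Vmax * (N * \<kappa> ^ CARD('n) * R\<^sup>2))"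
  have \<kappa>: "0 < \<kappa>" using assms by (simp add: \<kappa>_def)
  have N: "0 \<le> N" using K(1) by (simp add: N_def)
  have Vm: "0 \<le> Vmax" using assms by linarith
  have Q: "0 \<le> Q" using \<kappa> N Vm by (simp add: Q_def)
  have P0: "0 \<le> 6 * C\<^sub>I\<^sup>2 + 4" by simp
  \<comment> \<open>The rate is fixed before mesh, potential and small parameters are introduced;
    this is the required uniformity.\<close>
  obtain \<beta> where \<beta>: "0 < \<beta>" "\<beta> < 1"
    and decay: "\<forall>S (g :: (real ^ 'n) set \<Rightarrow> real) l E A X m. layered_sums Q (6 * C\<^sub>I\<^sup>2 + 4) C\<^sub>o\<^sub>l S g l E A X \<longrightarrow>
      (\<Sum>T\<in>S - A m. g T) \<le> (\<beta> ^ m)\<^sup>2 * (\<Sum>T\<in>S. g T)"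
    using layer_decay[OF Q P0 less_imp_le[OF \<open>0 < C\<^sub>o\<^sub>l\<close>], where 'a="(real ^ 'n) set"] by blast
  show ?thesis
  proof (intro exI[of _ \<beta>] conjI \<beta> allI impI ballI, elim conjE)
    fix \<epsilon> \<delta> and V :: "real ^ 'n \<Rightarrow> real" and \<T> :: "(real ^ 'n) set set" and H
      and \<phi> :: "real ^ 'n \<Rightarrow> real ^ 'n \<Rightarrow> complex" and p \<psi> and m :: nat
    assume eps: "0 < \<epsilon>" and V: "admissible_potential Vmin Vmax C \<delta> V"
      and mesh: "periodic_simplicial_mesh \<T>" and shape: "shape_regular \<sigma> \<T>" "quasi_uniform \<rho> \<T>"
      and H_eq: "H = mesh_size \<T>" and nodal: "nodal_basis \<T> \<phi>" and ol: "overlap_bound \<T> C\<^sub>o\<^sub>l"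
      and interp: "interpolation_bound \<T> \<phi> C\<^sub>I"
      and res: "H / \<epsilon> \<le> inverse (2 * C\<^sub>I * sqrt (C\<^sub>o\<^sub>l * Vmax * (1 + C\<^sub>I * C\<^sub>o\<^sub>l * \<gamma>)))"
      and p: "p \<in> mesh_nodes \<T>" and psi: "multiscale_basis_function \<T> \<phi> \<epsilon> V p \<psi>"
    interpret nodal_mesh \<T> \<phi> by unfold_locales (rule mesh nodal)+
    have H0: "0 < H"
    proof -
      obtain T where T: "T \<in> \<T>" using mesh_nonempty by blast
      show ?thesis using diameter_pos[OF T] diameter_le_mesh_size[OF T] H_eq by linarith
    qed
    \<comment> \<open>The radius \<open>H / \<kappa>\<close> makes the ratio \<open>H / r\<close>
      equal to the constant \<open>\<kappa> = \<rho> * \<sigma>\<close>.\<close>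
    interpret multiscale_setting \<T> \<phi> V Vmax \<epsilon> p \<psi> "H / \<kappa>" H K
    proof unfold_locales
      show "0 \<le> V x \<and> V x \<le> Vmax" if "x \<in> Omega" for x
        using V that \<open>0 < Vmin\<close> unfolding admissible_potential_def by force
      show "V \<in> borel_measurable (lebesgue_on Omega)" by (rule admissible_potential_measurable[OF V])
      show "\<exists>c. ball c (H / \<kappa>) \<subseteq> T" if "T \<in> \<T>" for T
        using inscribed_ball[OF shape \<open>0 < \<sigma>\<close> \<open>0 < \<rho>\<close> that] by (simp add: H_eq \<kappa>_def)
      show "diameter T \<le> H" if "T \<in> \<T>" for T using diameter_le_mesh_size[OF that] H_eq by simp
      show "0 < H / \<kappa>" using H0 \<kappa> by simp
    qed (rule eps psi p H0 K)+
    \<comment> \<open>The resolution condition turns the \<open>H\<^sup>2\<close> next to the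
      potential into \<open>\<epsilon>\<^sup>2\<close>, so that all of \<open>layer_const\<close>
      scales like the gradient part of the energy.\<close>
    have Hsq: "H\<^sup>2 \<le> \<epsilon>\<^sup>2 * R\<^sup>2"
    proof -
      have "H / \<epsilon> \<le> R" using res unfolding R_def .
      then have "H \<le> \<epsilon> * R" using eps by (simp add: divide_le_eq mult.commute)
      then have "H\<^sup>2 \<le> (\<epsilon> * R)\<^sup>2" using H0 by (intro power_mono) auto
      then show ?thesis by (simp only: power_mult_distrib)
    qed
    have const: "layer_const \<le> \<epsilon>\<^sup>2 / 2 * Q"
    proof -
      have "H / (H / \<kappa>) = \<kappa>" using H0 by simp
      then have "layer_const = \<epsilon>\<^sup>2 / 4 * \<kappa> + \<epsilon>\<^sup>2 / 4 * (N * \<kappa> ^ (CARD('n) + 1)) + Vmax * (N * \<kappa> ^ CARD('n) * H\<^sup>2)"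
        unfolding layer_const_def N_def by (simp only:)
      also have "\<dots> \<le> \<epsilon>\<^sup>2 / 4 * \<kappa> + \<epsilon>\<^sup>2 / 4 * (N * \<kappa> ^ (CARD('n) + 1)) + Vmax * (N * \<kappa> ^ CARD('n) * (\<epsilon>\<^sup>2 * R\<^sup>2))"
        using Hsq N \<kappa> Vm by (intro add_left_mono mult_left_mono mult_nonneg_nonneg) auto
      also have "\<dots> = \<epsilon>\<^sup>2 / 2 * Q" unfolding Q_def by (simp add: algebra_simps)
      finally show ?thesis .
    qed
    let ?X = "{T \<in> \<T>. p \<in> nodes T \<and> \<not> nodes T \<subseteq> {p}}"
    have "layered_sums Q (6 * C\<^sub>I\<^sup>2 + 4) C\<^sub>o\<^sub>l \<T> gr ls (\<lambda>T G. wrap ` T \<inter> wrap ` G \<noteq> {}) layer ?X"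
      unfolding layered_sums_def
    proof (intro conjI ballI allI impI)
      show "finite \<T>" by (rule finite_mesh)
      show "0 \<le> gr T" "0 \<le> ls T" for T by (rule gr_nonneg ls_nonneg)+
      show "wrap ` T \<inter> wrap ` T \<noteq> {}" if "T \<in> \<T>" for T
        using nodes_nonempty[OF that] verts_subset[OF that] by (auto simp: nodes_def)
      show "wrap ` G \<inter> wrap ` T \<noteq> {}" if "wrap ` T \<inter> wrap ` G \<noteq> {}" for T G :: "(real ^ 'n) set"
        using that by blast
      show "real (card {T \<in> \<T>. wrap ` T \<inter> wrap ` G \<noteq> {}}) \<le> C\<^sub>o\<^sub>l" if "G \<in> \<T>" for G
      proof -
        have "{T \<in> \<T>. wrap ` T \<inter> wrap ` G \<noteq> {}} \<subseteq> {T \<in> \<T>. T \<subseteq> nbhd \<T> G}" by (auto simp: nbhd_def)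
        then have "card {T \<in> \<T>. wrap ` T \<inter> wrap ` G \<noteq> {}} \<le> card {T \<in> \<T>. T \<subseteq> nbhd \<T> G}"
          using finite_mesh by (intro card_mono) auto
        moreover have "real (card {T \<in> \<T>. T \<subseteq> nbhd \<T> G}) \<le> C\<^sub>o\<^sub>l" using ol that unfolding overlap_bound_def by blast
        ultimately show ?thesis by linarith
      qed
      show "layer 0 \<subseteq> \<T>" by (rule layer_subset)
      show "layer (Suc k) = {G \<in> \<T>. \<exists>T\<in>layer k. wrap ` T \<inter> wrap ` G \<noteq> {}}" for k by (rule layer.simps)
      show "?X \<subseteq> layer 0" by auto
      show "ls T \<le> (6 * C\<^sub>I\<^sup>2 + 4) * (\<Sum>G\<in>{G \<in> \<T>. wrap ` T \<inter> wrap ` G \<noteq> {}}. gr G)"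
        if "T \<in> (\<T> - layer 0) \<union> ?X" for T
      proof -
        have "T \<in> \<T>" "p \<notin> nodes T \<or> \<not> nodes T \<subseteq> {p}" using that by auto
        note poincare = element_poincare[OF interp H_eq \<open>0 < C\<^sub>I\<close> this]
        have "neighbours T = {G \<in> \<T>. wrap ` T \<inter> wrap ` G \<noteq> {}}" unfolding neighbours_def by blast
        then show ?thesis using poincare by (simp only:)
      qed
      show "(\<Sum>T\<in>\<T> - layer 0. gr T) \<le> Q * (\<Sum>T\<in>?X. gr T + ls T)" by (rule layer_decay_estimates(1)[OF const])
      show "(\<Sum>T\<in>\<T> - layer (Suc k). gr T) \<le> Q * (\<Sum>T\<in>layer (Suc k) - layer k. gr T + ls T)" for k
        by (rule layer_decay_estimates(2)[OF const Q])
    qed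
    then have "(\<Sum>T\<in>\<T> - layer m. gr T) \<le> (\<beta> ^ m)\<^sup>2 * (\<Sum>T\<in>\<T>. gr T)"
      using decay by blast
    then have "(L2norm (Omega - (nbhd \<T> ^^ m) (supp (\<phi> p))) (grad \<psi>))\<^sup>2 \<le> (\<beta> ^ m)\<^sup>2 * (L2norm Omega (grad \<psi>))\<^sup>2"
      using L2norm_outside_layer[of m] unfolding L2norm_Omega_eq by linarith
    then have "(L2norm (Omega - (nbhd \<T> ^^ m) (supp (\<phi> p))) (grad \<psi>))\<^sup>2 \<le> (\<beta> ^ m * L2norm Omega (grad \<psi>))\<^sup>2"
      by (simp only: power_mult_distrib)
    then show "L2norm (Omega - (nbhd \<T> ^^ m) (supp (\<phi> p))) (grad \<psi>) \<le> \<beta> ^ m * L2norm Omega (grad \<psi>)"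
      by (rule power2_le_imp_le) (intro mult_nonneg_nonneg zero_le_power less_imp_le[OF \<beta>(1)] L2norm_nonneg)
  qed
qed

end
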